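(* For any $\epsilon>0$, there is a two-sided adaptive algorithm for $\epsilon$-testing size-$s$ Boolean Circuit with respect to the uniform distribution that makes $\tilde O(s^2/\epsilon)$ queries.
   Context: Boolean functions $f:\{0,1\}^n\to\{0,1\}$ are accessed through a membership-query oracle that returns $f(x)$ for a queried $x$. $f$ is $\epsilon$-far from a class $C$ (with respect to the uniform distribution) if $\Pr_{x}[f(x)\neq g(x)]\ge\epsilon$ for every $g\in C$, with $x$ uniform on $\{0,1\}^n$. A two-sided adaptive algorithm for $\epsilon$-testing $C$ is a randomized algorithm that, given $\epsilon$ and membership-query access to an arbitrary $f$ (and able to draw uniform random strings), chooses queries possibly adaptively, accepts with probability at least $2/3$ if $f\in C$, and rejects with probability at least $2/3$ if $f$ is $\epsilon$-far from every function in $C$. $\tilde O(T)$ means $O(T\cdot\mathrm{poly}(\log T))$. A Boolean circuit is a rooted directed acyclic graph whose internal nodes are labeled AND, OR or NOT, AND/OR gates having arbitrary fan-in, and every directed path from the root ends at one of the nodes $x_1,\dots,x_n,0,1$; size-$s$ Boolean Circuit is the class of Boolean circuits with at most $s$ gates. *)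

theory Defs
  imports "HOL-Probability.Probability" "HOL-Computational_Algebra.Polynomial"
begin

section \<open>The Boolean cube and distance to a class\<close>

text \<open>
  Boolean functions on $\{0,1\}^n$ are represented by functions on all bit lists of which only the
  values on \<open>cube n\<close> matter.
\<close>

definition cube :: "nat \<Rightarrow> bool list set" where
  "cube n = {x. length x = n}"

definition far_from :: "nat \<Rightarrow> real \<Rightarrow> (bool list \<Rightarrow> bool) \<Rightarrow> (bool list \<Rightarrow> bool) set \<Rightarrow> bool" where
  "far_from n \<epsilon> f K \<longleftrightarrow>
     (\<forall>g\<in>K. measure_pmf.prob (pmf_of_set (cube n)) {x. f x \<noteq> g x} \<ge> \<epsilon>)"

section \<open>Boolean circuits\<close>

text \<open>
  The nodes of a circuit over \<open>n\<close> variables are its gates, the variables (\<open>Input i\<close> with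
  \<open>i < n\<close> is the variable usually written $x_{i+1}$) and the two constants.
  An edge points from a gate to one of its inputs.
\<close>

datatype node = Gate nat | Input nat | Const bool

datatype gate_type = Conj | Disj | Neg

record circuit =
  gates :: "nat set"
  gtype :: "nat \<Rightarrow> gate_type"
  edges :: "(node \<times> node) set"
  top_node :: node

definition nodes :: "nat \<Rightarrow> circuit \<Rightarrow> node set" where
  "nodes n C = Gate ` gates C \<union> Input ` {..<n} \<union> range Const"

text \<open>
  Only gates have outgoing edges and every gate has at least one; together with finiteness and
  acyclicity this says that every maximal directed path ends at a variable or a constant.
\<close>

definition boolean_circuit :: "nat \<Rightarrow> circuit \<Rightarrow> bool" where
  "boolean_circuit n C \<longleftrightarrow>
     finite (gates C) \<and>
     top_node C \<in> nodes n C \<and>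
     edges C \<subseteq> Gate ` gates C \<times> nodes n C \<and>
     acyclic (edges C) \<and>
     (\<forall>g\<in>gates C. (top_node C, Gate g) \<in> (edges C)\<^sup>*) \<and>
     (\<forall>g\<in>gates C. edges C `` {Gate g} \<noteq> {}) \<and>
     (\<forall>g\<in>gates C. gtype C g = Neg \<longrightarrow> card (edges C `` {Gate g}) = 1)"

definition circuit_size :: "circuit \<Rightarrow> nat" where
  "circuit_size C = card (gates C)"

text \<open>
  Evaluation is by well-founded recursion along the edges.  A negation gate has exactly one
  successor, so the universal quantifier in its case ranges over that single node.
\<close>

definition eval_step :: "circuit \<Rightarrow> bool list \<Rightarrow> (node \<Rightarrow> bool) \<Rightarrow> node \<Rightarrow> bool" where
  "eval_step C x val v =
     (case v of
        Gate g \<Rightarrow>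
          (case gtype C g of
             Conj \<Rightarrow> \<forall>w \<in> edges C `` {v}. val w
           | Disj \<Rightarrow> \<exists>w \<in> edges C `` {v}. val w
           | Neg \<Rightarrow> \<forall>w \<in> edges C `` {v}. \<not> val w)
      | Input i \<Rightarrow> x ! i
      | Const b \<Rightarrow> b)"

definition eval_node :: "circuit \<Rightarrow> bool list \<Rightarrow> node \<Rightarrow> bool" where
  "eval_node C x = wfrec ((edges C)\<inverse>) (eval_step C x)"

definition eval_circuit :: "circuit \<Rightarrow> bool list \<Rightarrow> bool" where
  "eval_circuit C x = eval_node C x (top_node C)"

lemma eval_node_unfold:
  assumes "boolean_circuit n C"
  shows "eval_node C x v = eval_step C x (eval_node C x) v"
proof -
  have "finite (edges C)"
    using assms by (auto simp: boolean_circuit_def nodes_def intro: finite_subset)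
  then have wf: "wf ((edges C)\<inverse>)"
    using assms by (intro finite_acyclic_wf_converse) (auto simp: boolean_circuit_def)
  have "eval_node C x v = eval_step C x (cut (eval_node C x) ((edges C)\<inverse>) v) v"
    unfolding eval_node_def by (rule wfrec[OF wf])
  also have "\<dots> = eval_step C x (eval_node C x) v"
    by (auto simp: eval_step_def cut_apply split: node.split gate_type.split)
  finally show ?thesis .
qed

definition circuit_class :: "nat \<Rightarrow> nat \<Rightarrow> (bool list \<Rightarrow> bool) set" where
  "circuit_class n s =
     {f. \<exists>C. boolean_circuit n C \<and> circuit_size C \<le> s \<and> (\<forall>x\<in>cube n. f x = eval_circuit C x)}"

section \<open>Randomized adaptive query algorithms\<close>

text \<open>
  A deterministic adaptive algorithm is a decision tree: the next query depends on the answers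
  received so far, and \<open>Output True\<close> means acceptance.  A randomized algorithm is a probability
  distribution over decision trees, i.e. all random choices are made in advance; drawing uniform
  random strings during the run is a special case.
\<close>

datatype (queried: 'q) decision_tree =
    Output bool
  | Query 'q "bool \<Rightarrow> 'q decision_tree"

primrec run :: "('q \<Rightarrow> bool) \<Rightarrow> 'q decision_tree \<Rightarrow> bool" where
  "run f (Output b) = b"
| "run f (Query x t) = run f (t (f x))"

primrec num_queries :: "('q \<Rightarrow> bool) \<Rightarrow> 'q decision_tree \<Rightarrow> nat" where
  "num_queries f (Output b) = 0"
| "num_queries f (Query x t) = Suc (num_queries f (t (f x)))"

type_synonym randomized_algorithm = "bool list decision_tree pmf"

definition makes_at_most :: "randomized_algorithm \<Rightarrow> nat \<Rightarrow> bool" where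
  "makes_at_most A q \<longleftrightarrow> (\<forall>t\<in>set_pmf A. \<forall>f. num_queries f t \<le> q)"

definition two_sided_tester ::
  "nat \<Rightarrow> real \<Rightarrow> (bool list \<Rightarrow> bool) set \<Rightarrow> randomized_algorithm \<Rightarrow> bool" where
  "two_sided_tester n \<epsilon> K A \<longleftrightarrow>
     (\<forall>t\<in>set_pmf A. queried t \<subseteq> cube n) \<and>
     (\<forall>f\<in>K. measure_pmf.prob A {t. run f t} \<ge> 2 / 3) \<and>
     (\<forall>f. far_from n \<epsilon> f K \<longrightarrow> measure_pmf.prob A {t. \<not> run f t} \<ge> 2 / 3)"

section \<open>Soft-O bounds\<close>

text \<open>
  The bound $g = O(T \cdot \mathrm{poly}(\log T))$, uniformly on the parameter range \<open>D\<close>.  The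
  constant hidden in the $O$ and the base of the logarithm are absorbed into the polynomial.
\<close>

definition soft_O_on :: "'a set \<Rightarrow> ('a \<Rightarrow> real) \<Rightarrow> ('a \<Rightarrow> real) \<Rightarrow> bool" where
  "soft_O_on D g T \<longleftrightarrow> (\<exists>p :: real poly. \<forall>a\<in>D. g a \<le> T a * poly p (ln (T a)))"

end

theory Submission
  imports Defs "HOL-Real_Asymp.Real_Asymp"
begin

text \<open>
  A conjunction or disjunction of more than \<open>L\<close> variables is constant up to probability $2^{-L}$, so
  with \<open>L\<close> logarithmic in \<open>s / \<epsilon>\<close> a size-\<open>s\<close> circuit is almost always equal to one that reads only
  \<open>k = s L + 1\<close> variables.  There are \<open>2\<close> to the power $\tilde O(s^2)$ circuits of the latter kind.

  The tester maps the variables randomly to \<open>r = poly (k / \<epsilon>)\<close> blocks and queries \<open>f\<close> at inputs that are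
  constant on blocks, with exactly half of the blocks set to one.  Over the random map such an
  input is uniformly distributed, while its values on the few relevant variables are known.
  It looks for a choice of \<open>k\<close> blocks and a circuit on \<open>k\<close> variables that agree with all samples, and
  then checks that rerandomizing the variables outside the chosen blocks does not change \<open>f\<close>.

  For soundness, let a set \<open>U\<close> have its squared Fourier coefficient as weight.  If some \<open>k\<close> blocks of a
  random map carry almost all of the influence, almost all weight is on sets inside the union of
  these blocks.  A set of more than \<open>k\<close> elements rarely fits into \<open>k\<close> blocks, and variables of small
  total weight are spread evenly over the blocks; hence the weight is concentrated on the subsets
  of a single set of \<open>k\<close> variables, and \<open>f\<close> is close to a junta on them.  The consistent
  hypothesis then agrees with this junta, after its inputs are replaced by variables or constants.
\<close>

section \<open>Averages over finite sets\<close>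

text \<open>The query bound must not depend on \<open>n\<close>, although a union bound over all
  choices of \<open>k\<close> among \<open>n\<close> variables costs about \<open>k log n\<close>
  samples. With \<open>r\<close> blocks there are only \<open>r^k\<close> choices, and the logarithm
  of the number of hypotheses is dominated by the edge sets, \<open>s * (s + k + 2)\<close> bits,
  which is \<open>s^2\<close> up to logarithms. Halves answer two opposing demands. For a fixed half
  each variable is set independently with probability exactly 1/2, so a query is exactly uniform for
  every \<open>n\<close>; a uniformly random set of blocks has fluctuating density, which a function
  of many variables can detect. The price is that the coordinates of a half are dependent, but on
  O(k) blocks this costs only a factor 2. Consistency says nothing about inputs that are not
  constant on blocks, hence the resampling check. The blocks it uses depend on the samples, so
  soundness speaks of all choices of \<open>k\<close> blocks at once: either for most maps every
  choice leaves noticeable influence outside and the check rejects, or for a tenth of the maps some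
  choice captures the influence, and then \<open>f\<close> is near a junta.\<close>

definition avg :: "'a set \<Rightarrow> ('a \<Rightarrow> real) \<Rightarrow> real" where
  "avg S g = (\<Sum>x\<in>S. g x) / real (card S)"

text \<open>Probabilities are fractions of finite sets of seeds: independent choices become products
  or \<open>PiE\<close>, and Fubini is an exchange of finite sums. The passage to \<open>pmf\<close>
  happens only when the tester is assembled. On the empty set the value is 0.\<close>

definition ufrac :: "'a set \<Rightarrow> ('a \<Rightarrow> bool) \<Rightarrow> real" where
  "ufrac S P = avg S (\<lambda>x. of_bool (P x))"

lemma ufrac_card: "finite S \<Longrightarrow> ufrac S P = real (card {x \<in> S. P x}) / real (card S)"
  by (auto simp: ufrac_def avg_def Int_def conj_commute)

lemma avg_mono: "(\<And>x. x \<in> S \<Longrightarrow> g x \<le> h x) \<Longrightarrow> avg S g \<le> avg S h"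
  by (auto simp: avg_def intro!: divide_right_mono sum_mono)

lemma avg_cong: "S = T \<Longrightarrow> (\<And>x. x \<in> T \<Longrightarrow> g x = h x) \<Longrightarrow> avg S g = avg T h"
  by (auto simp: avg_def)

lemma avg_const: "finite S \<Longrightarrow> S \<noteq> {} \<Longrightarrow> avg S (\<lambda>_. c) = c"
  by (auto simp: avg_def)

lemma avg_le: "finite S \<Longrightarrow> S \<noteq> {} \<Longrightarrow> (\<And>x. x \<in> S \<Longrightarrow> g x \<le> c) \<Longrightarrow> avg S g \<le> c"
  using avg_mono[of S g "\<lambda>_. c"] by (simp add: avg_const)

lemma avg_nonneg: "(\<And>x. x \<in> S \<Longrightarrow> 0 \<le> g x) \<Longrightarrow> 0 \<le> avg S g"
  by (auto simp: avg_def intro!: divide_nonneg_nonneg sum_nonneg)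

lemma avg_add: "avg S (\<lambda>x. g x + h x) = avg S g + avg S h"
  by (simp add: avg_def sum.distrib add_divide_distrib)

lemma avg_diff: "avg S (\<lambda>x. g x - h x) = avg S g - avg S h"
  by (simp add: avg_def sum_subtractf diff_divide_distrib)

lemma avg_cmult: "avg S (\<lambda>x. c * g x) = c * avg S g"
  by (simp add: avg_def sum_distrib_left)

lemma avg_multc: "avg S (\<lambda>x. g x * c) = avg S g * c"
  by (simp add: avg_def sum_distrib_right)

lemma avg_sum: "avg S (\<lambda>x. \<Sum>i\<in>I. g i x) = (\<Sum>i\<in>I. avg S (g i))"
  by (simp add: avg_def sum.swap[of _ I S] sum_divide_distrib)

lemma avg_swap: "avg S (\<lambda>x. avg T (\<lambda>y. g x y)) = avg T (\<lambda>y. avg S (\<lambda>x. g x y))"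
  by (simp add: avg_def sum_divide_distrib[symmetric] sum.swap[of _ T S] mult.commute)

lemma avg_times: "avg (S \<times> T) (\<lambda>(x, y). g x y) = avg S (\<lambda>x. avg T (\<lambda>y. g x y))"
  by (simp add: avg_def sum.cartesian_product card_cartesian_product sum_divide_distrib[symmetric]
      mult.commute)

lemma avg_bij_betw: "bij_betw b S T \<Longrightarrow> avg S (\<lambda>x. g (b x)) = avg T g"
  by (simp add: avg_def sum.reindex_bij_betw bij_betw_same_card)

lemma exists_le_avg:
  assumes "finite S" "S \<noteq> {}"
  shows "\<exists>x\<in>S. g x \<le> avg S g"
proof (rule ccontr)
  assume "\<not> ?thesis"
  then have "(\<Sum>x\<in>S. avg S g) < (\<Sum>x\<in>S. g x)"
    using assms by (intro sum_strict_mono) auto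
  then show False using assms by (simp add: avg_def)
qed

lemma ufrac_nonneg: "0 \<le> ufrac S P"
  by (simp add: ufrac_def avg_nonneg)

lemma ufrac_cong: "S = T \<Longrightarrow> (\<And>x. x \<in> T \<Longrightarrow> P x = Q x) \<Longrightarrow> ufrac S P = ufrac T Q"
  unfolding ufrac_def by (intro avg_cong) auto

lemma ufrac_mono: "(\<And>x. x \<in> S \<Longrightarrow> P x \<Longrightarrow> Q x) \<Longrightarrow> ufrac S P \<le> ufrac S Q"
  unfolding ufrac_def by (intro avg_mono) auto

lemma ufrac_le_add:
  assumes "\<And>x. x \<in> S \<Longrightarrow> P x \<Longrightarrow> Q x \<or> R x"
  shows "ufrac S P \<le> ufrac S Q + ufrac S R"
  unfolding ufrac_def avg_add[symmetric] using assms by (intro avg_mono) auto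

lemma ufrac_bex_le:
  assumes "finite I"
  shows "ufrac S (\<lambda>x. \<exists>i\<in>I. P i x) \<le> (\<Sum>i\<in>I. ufrac S (P i))"
proof -
  have "of_bool (\<exists>i\<in>I. P i x) \<le> (\<Sum>i\<in>I. of_bool (P i x) :: real)" for x
  proof (cases "\<exists>i\<in>I. P i x")
    case True
    then obtain i where "i \<in> I" "P i x" by auto
    then show ?thesis
      using member_le_sum[of i I "\<lambda>i. of_bool (P i x) :: real"] assms by auto
  qed (auto intro: sum_nonneg)
  then show ?thesis unfolding ufrac_def avg_sum[symmetric] by (intro avg_mono)
qed

lemma ufrac_not: "finite S \<Longrightarrow> S \<noteq> {} \<Longrightarrow> ufrac S (\<lambda>x. \<not> P x) = 1 - ufrac S P"
  using avg_diff[of S "\<lambda>_. 1" "\<lambda>x. of_bool (P x)"]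
  by (simp add: ufrac_def avg_const of_bool_not_iff)

lemma ufrac_le_1: "finite S \<Longrightarrow> S \<noteq> {} \<Longrightarrow> ufrac S P \<le> 1"
  using ufrac_not[of S P] ufrac_nonneg[of S "\<lambda>x. \<not> P x"] by simp

lemma ufrac_bij_betw: "bij_betw b S T \<Longrightarrow> ufrac S (\<lambda>x. P (b x)) = ufrac T P"
  unfolding ufrac_def using avg_bij_betw[of b S T "\<lambda>x. of_bool (P x)"] by simp

lemma ufrac_times: "ufrac (S \<times> T) (\<lambda>(x, y). P x y) = avg S (\<lambda>x. ufrac T (P x))"
  using avg_times[of S T "\<lambda>x y. of_bool (P x y)"] by (simp add: ufrac_def case_prod_unfold)

lemma ufrac_times_swap: "ufrac (S \<times> T) (\<lambda>(x, y). P x y) = avg T (\<lambda>y. ufrac S (\<lambda>x. P x y))"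
  unfolding ufrac_times unfolding ufrac_def by (rule avg_swap)

text \<open>Slices on which \<open>G\<close> fails contribute 0, so a bound on the remaining slices
  is enough and no division by the probability of \<open>G\<close> occurs.\<close>

lemma ufrac_times_le:
  assumes "finite S" "S \<noteq> {}" "0 \<le> c" "\<And>x. x \<in> S \<Longrightarrow> G x \<Longrightarrow> ufrac T (P x) \<le> c"
  shows "ufrac (S \<times> T) (\<lambda>(x, y). G x \<and> P x y) \<le> c"
proof -
  have "ufrac T (\<lambda>y. G x \<and> P x y) \<le> c" if "x \<in> S" for x
    using assms that by (cases "G x") (auto simp: ufrac_def avg_def)
  then show ?thesis unfolding ufrac_times using assms by (intro avg_le) auto
qed

lemma ufrac_fst: "finite T \<Longrightarrow> T \<noteq> {} \<Longrightarrow> ufrac (S \<times> T) (\<lambda>(x, y). P x) = ufrac S P"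
  unfolding ufrac_times by (simp add: ufrac_def avg_const)

lemma markov:
  assumes "finite S" "0 < a" "\<And>x. x \<in> S \<Longrightarrow> 0 \<le> g x" "avg S g \<le> a * c"
  shows "ufrac S (\<lambda>x. a < g x) \<le> c"
proof -
  have "a * ufrac S (\<lambda>x. a < g x) \<le> avg S g"
    unfolding ufrac_def avg_cmult[symmetric] using assms by (intro avg_mono) auto
  then show ?thesis using assms by (smt (verit) mult_le_cancel_left_pos)
qed

lemma ufrac_PiE:
  assumes "finite I" "\<And>i. i \<in> I \<Longrightarrow> finite (B i)"
  shows "ufrac (PiE I B) (\<lambda>f. \<forall>i\<in>I. P i (f i)) = (\<Prod>i\<in>I. ufrac (B i) (P i))"
proof -
  have "{f \<in> PiE I B. \<forall>i\<in>I. P i (f i)} = PiE I (\<lambda>i. {y \<in> B i. P i y})"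
    by (fastforce simp: PiE_def Pi_def extensional_def)
  then show ?thesis
    using assms by (simp add: ufrac_card finite_PiE card_PiE prod_dividef)
qed

lemma ufrac_PiE_component:
  assumes "finite I" "\<And>i. i \<in> I \<Longrightarrow> finite (B i)" "\<And>i. i \<in> I \<Longrightarrow> B i \<noteq> {}" "j \<in> I"
  shows "ufrac (PiE I B) (\<lambda>f. P (f j)) = ufrac (B j) P"
proof -
  have "ufrac (PiE I B) (\<lambda>f. P (f j)) = ufrac (PiE I B) (\<lambda>f. \<forall>i\<in>I. i = j \<longrightarrow> P (f i))"
    using assms by (intro ufrac_cong) auto
  also have "\<dots> = (\<Prod>i\<in>I. ufrac (B i) (\<lambda>y. i = j \<longrightarrow> P y))"
    by (rule ufrac_PiE) (use assms in auto)
  also have "\<dots> = (\<Prod>i\<in>I. if i = j then ufrac (B j) P else 1)"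
    using assms by (intro prod.cong) (auto simp: ufrac_def avg_const)
  finally show ?thesis using assms by simp
qed

lemma ufrac_PiE_ex_le:
  assumes "finite I" "\<And>i. i \<in> I \<Longrightarrow> finite (B i)" "\<And>i. i \<in> I \<Longrightarrow> B i \<noteq> {}"
    and "\<And>i. i \<in> I \<Longrightarrow> ufrac (B i) (P i) \<le> c"
  shows "ufrac (PiE I B) (\<lambda>f. \<exists>i\<in>I. P i (f i)) \<le> real (card I) * c"
proof -
  have "ufrac (PiE I B) (\<lambda>f. \<exists>i\<in>I. P i (f i)) \<le> (\<Sum>i\<in>I. ufrac (PiE I B) (\<lambda>f. P i (f i)))"
    by (rule ufrac_bex_le) fact
  also have "\<dots> \<le> (\<Sum>i\<in>I. c)"
    using assms by (intro sum_mono) (simp add: ufrac_PiE_component)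
  finally show ?thesis by simp
qed

section \<open>Uniformly random subsets and resampling\<close>

lemma bij_betw_Pow_split:
  assumes "A \<subseteq> N"
  shows "bij_betw (\<lambda>(P, Q). P \<union> Q) (Pow A \<times> Pow (N - A)) (Pow N)"
  by (rule bij_betw_byWitness[where f' = "\<lambda>X. (X \<inter> A, X - A)"]) (use assms in auto)

lemma avg_Pow_split:
  assumes "A \<subseteq> N"
  shows "avg (Pow N) g = avg (Pow A) (\<lambda>P. avg (Pow (N - A)) (\<lambda>Q. g (P \<union> Q)))"
  using avg_bij_betw[OF bij_betw_Pow_split[OF assms], of g]
    avg_times[of "Pow A" "Pow (N - A)" "\<lambda>P Q. g (P \<union> Q)"]
  by (simp add: case_prod_unfold)

lemma avg_Pow_insert:
  assumes "finite A" "a \<notin> A"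
  shows "avg (Pow (insert a A)) g = (avg (Pow A) g + avg (Pow A) (\<lambda>X. g (insert a X))) / 2"
proof -
  have "insert a A - A = {a}" using assms by auto
  then have "avg (Pow (insert a A)) g = avg (Pow A) (\<lambda>P. avg {{}, {a}} (\<lambda>Q. g (P \<union> Q)))"
    using avg_Pow_split[of A "insert a A" g] by (auto simp: Pow_insert insert_commute)
  also have "\<dots> = avg (Pow A) (\<lambda>P. (g P + g (insert a P)) * (1 / 2))"
    by (intro avg_cong) (auto simp: avg_def)
  finally show ?thesis by (simp only: avg_multc avg_add)
qed

lemma ufrac_Pow_Int:
  assumes "finite N" "A \<subseteq> N"
  shows "ufrac (Pow N) (\<lambda>X. P (X \<inter> A)) = ufrac (Pow A) P"
proof -
  have "ufrac (Pow N) (\<lambda>X. P (X \<inter> A)) =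
      avg (Pow A) (\<lambda>Y. avg (Pow (N - A)) (\<lambda>Q. of_bool (P ((Y \<union> Q) \<inter> A))))"
    unfolding ufrac_def by (rule avg_Pow_split) fact
  also have "\<dots> = avg (Pow A) (\<lambda>Y. avg (Pow (N - A)) (\<lambda>Q. of_bool (P Y)))"
    by (intro avg_cong arg_cong[where f = of_bool] arg_cong[where f = P]) auto
  also have "\<dots> = ufrac (Pow A) P"
    unfolding ufrac_def using assms by (intro avg_cong avg_const) auto
  finally show ?thesis .
qed

lemma ufrac_Pow_single:
  assumes "finite A" "Z \<subseteq> A"
  shows "ufrac (Pow A) (\<lambda>X. X = Z) = (1 / 2) ^ card A"
proof -
  have "{x \<in> Pow A. x = Z} = {Z}" using assms by auto
  then show ?thesis using assms by (simp add: ufrac_card card_Pow power_divide)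
qed

lemma ufrac_Pow_Int_eq:
  assumes "finite N" "A \<subseteq> N" "Z \<subseteq> A"
  shows "ufrac (Pow N) (\<lambda>X. X \<inter> A = Z) = (1 / 2) ^ card A"
  using ufrac_Pow_Int[OF assms(1,2), of "\<lambda>X. X = Z"] ufrac_Pow_single[of A Z] assms finite_subset
  by auto

definition mix :: "'a set \<Rightarrow> 'a set \<Rightarrow> 'a set \<Rightarrow> 'a set" where
  "mix A X X' = (X \<inter> A) \<union> (X' - A)"

text \<open>Exchanging the parts of \<open>X\<close> and \<open>X'\<close> outside \<open>A\<close>
  is an involution on pairs whose first component is the mixed set, so the mixed set is again
  uniform.\<close>

lemma ufrac_mix:
  assumes "finite N"
  shows "ufrac (Pow N \<times> Pow N) (\<lambda>(X, X'). P (mix A X X')) = ufrac (Pow N) P"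
proof -
  have b: "bij_betw (\<lambda>(X, X'). (mix A X X', mix A X' X)) (Pow N \<times> Pow N) (Pow N \<times> Pow N)"
    by (rule bij_betw_byWitness[where f' = "\<lambda>(X, X'). (mix A X X', mix A X' X)"])
      (auto simp: mix_def)
  have "ufrac (Pow N \<times> Pow N) (\<lambda>(X, X'). P (mix A X X')) = ufrac (Pow N \<times> Pow N) (\<lambda>(X, X'). P X)"
    by (subst ufrac_bij_betw[OF b, symmetric]) (intro ufrac_cong; auto)
  also have "\<dots> = ufrac (Pow N) P"
    using assms by (intro ufrac_fst) auto
  finally show ?thesis .
qed

lemma ufrac_Pow_inj:
  assumes "finite J" "inj_on \<phi> J"
  shows "ufrac (Pow (\<phi> ` J)) (\<lambda>Y. P {i \<in> J. \<phi> i \<in> Y}) = ufrac (Pow J) P"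
proof -
  have "bij_betw (\<lambda>Y. {i \<in> J. \<phi> i \<in> Y}) (Pow (\<phi> ` J)) (Pow J)"
    by (rule bij_betw_byWitness[where f' = "\<lambda>X. \<phi> ` X"])
      (use assms(2) in \<open>auto simp: inj_on_def\<close>)
  then show ?thesis by (rule ufrac_bij_betw)
qed

section \<open>Circuits\<close>

definition bits :: "nat \<Rightarrow> nat set \<Rightarrow> bool list" where
  "bits n X = map (\<lambda>i. i \<in> X) [0..<n]"

lemma length_bits [simp]: "length (bits n X) = n"
  by (simp add: bits_def)

lemma bits_in_cube [simp]: "bits n X \<in> cube n"
  by (simp add: cube_def)

lemma nth_bits [simp]: "i < n \<Longrightarrow> bits n X ! i \<longleftrightarrow> i \<in> X"
  by (simp add: bits_def)

lemma bij_betw_bits: "bij_betw (bits n) (Pow {..<n}) (cube n)"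
  by (rule bij_betw_byWitness[where f' = "\<lambda>x. {i. i < n \<and> x ! i}"])
    (auto simp: cube_def bits_def intro!: nth_equalityI)

text \<open>Finiteness and acyclicity of the edges suffice for the recursion. The intermediate
  circuits below may have unreachable gates, or gates without successors.\<close>

lemma eval_node_unfold':
  assumes "finite (edges C)" "acyclic (edges C)"
  shows "eval_node C x v = eval_step C x (eval_node C x) v"
proof -
  have wf: "wf ((edges C)\<inverse>)"
    using assms by (rule finite_acyclic_wf_converse)
  have "eval_node C x v = eval_step C x (cut (eval_node C x) ((edges C)\<inverse>) v) v"
    unfolding eval_node_def by (rule wfrec[OF wf])
  also have "\<dots> = eval_step C x (eval_node C x) v"
    by (auto simp: eval_step_def cut_apply split: node.split gate_type.split)
  finally show ?thesis .
qed

text \<open>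
  The circuit conditions without reachability of the gates; \<open>pre_circuit_prune\<close> recovers it.
\<close>

definition pre_circuit :: "nat \<Rightarrow> circuit \<Rightarrow> bool" where
  "pre_circuit n C \<longleftrightarrow>
     finite (gates C) \<and>
     top_node C \<in> nodes n C \<and>
     edges C \<subseteq> Gate ` gates C \<times> nodes n C \<and>
     acyclic (edges C) \<and>
     (\<forall>g\<in>gates C. edges C `` {Gate g} \<noteq> {}) \<and>
     (\<forall>g\<in>gates C. gtype C g = Neg \<longrightarrow> card (edges C `` {Gate g}) = 1)"

lemma boolean_circuit_imp_pre_circuit: "boolean_circuit n C \<Longrightarrow> pre_circuit n C"
  by (auto simp: boolean_circuit_def pre_circuit_def)

lemma pre_circuit_finite_edges: "pre_circuit n C \<Longrightarrow> finite (edges C)"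
  by (auto simp: pre_circuit_def nodes_def intro: finite_subset)

text \<open>Evaluation sees only gate types and successor sets. Conjunction and disjunction are
  quantifiers over these sets, so \<open>\<nu>\<close> may merge successors. The condition on
  variables speaks of values, so that a variable may be sent to another variable or to a constant.
  Pruning, substitution and renumbering of gates are all instances.\<close>

lemma eval_node_hom:
  assumes C: "finite (edges C)" "acyclic (edges C)"
    and D: "finite (edges D)" "acyclic (edges D)"
    and closed: "\<And>v w. v \<in> R \<Longrightarrow> (v, w) \<in> edges C \<Longrightarrow> w \<in> R"
    and gate: "\<And>g. Gate g \<in> R \<Longrightarrow> \<exists>g'. \<nu> (Gate g) = Gate g' \<and> gtype D g' = gtype C g \<and>
      edges D `` {Gate g'} = \<nu> ` (edges C `` {Gate g})"
    and input: "\<And>i. Input i \<in> R \<Longrightarrow> eval_node D u (\<nu> (Input i)) = x ! i"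
    and const: "\<And>b. Const b \<in> R \<Longrightarrow> \<nu> (Const b) = Const b"
    and "v \<in> R"
  shows "eval_node D u (\<nu> v) = eval_node C x v"
  using finite_acyclic_wf_converse[OF C] \<open>v \<in> R\<close>
proof (induction v rule: wf_induct_rule)
  case (less v)
  show ?case
  proof (cases v)
    case (Gate g)
    then obtain g' where g': "\<nu> v = Gate g'" "gtype D g' = gtype C g"
      "edges D `` {Gate g'} = \<nu> ` (edges C `` {v})"
      using gate less.prems by metis
    have IH: "eval_node D u (\<nu> w) = eval_node C x w" if "w \<in> edges C `` {v}" for w
      using less that closed by auto
    show ?thesis
      using IH Gate g' unfolding eval_node_unfold'[OF C, of x v] eval_node_unfold'[OF D, of u "\<nu> v"]
      by (auto simp: eval_step_def g' split: gate_type.split)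
  next
    case (Input i)
    then show ?thesis
      using input less.prems by (simp add: eval_node_unfold'[OF C, of x "Input i"] eval_step_def)
  next
    case (Const b)
    then have "\<nu> v = Const b" using const less.prems by simp
    then show ?thesis
      using Const by (simp add: eval_node_unfold'[OF C] eval_node_unfold'[OF D] eval_step_def)
  qed
qed

lemma pre_circuit_prune:
  assumes C: "pre_circuit n C"
  shows "\<exists>D. boolean_circuit n D \<and> circuit_size D \<le> circuit_size C \<and>
    (\<forall>x. eval_circuit D x = eval_circuit C x)"
proof -
  let ?E = "edges C"
  define R where "R = {v. (top_node C, v) \<in> ?E\<^sup>*}"
  define D where "D = C\<lparr>gates := {g \<in> gates C. Gate g \<in> R}, edges := ?E \<inter> (R \<times> UNIV)\<rparr>"
  have D_simps [simp]: "gates D = {g \<in> gates C. Gate g \<in> R}" "edges D = ?E \<inter> (R \<times> UNIV)"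
    "top_node D = top_node C" "gtype D = gtype C"
    by (simp_all add: D_def)
  have closed: "w \<in> R" if "v \<in> R" "(v, w) \<in> ?E" for v w
    using that by (auto simp: R_def intro: rtrancl.rtrancl_into_rtrancl)
  have reach: "(top_node C, v) \<in> (edges D)\<^sup>*" if "(top_node C, v) \<in> ?E\<^sup>*" for v
    using that
  proof (induction rule: rtrancl_induct)
    case (step v w)
    then have "(v, w) \<in> edges D" by (auto simp: R_def)
    then show ?case using step by (auto intro: rtrancl.rtrancl_into_rtrancl)
  qed simp
  have out: "edges D `` {Gate g} = ?E `` {Gate g}" if "Gate g \<in> R" for g
    using that by auto
  have nodes: "w \<in> nodes n D" if "w \<in> nodes n C" "w \<in> R" for w
    using that by (auto simp: nodes_def)
  have top: "top_node C \<in> R" by (simp add: R_def)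
  have acyc: "acyclic (edges D)"
    using C by (auto simp: pre_circuit_def intro: acyclic_subset)
  have "boolean_circuit n D"
    unfolding boolean_circuit_def
  proof (intro conjI ballI impI)
    show "edges D \<subseteq> Gate ` gates D \<times> nodes n D"
    proof safe
      fix v w assume vw: "(v, w) \<in> edges D"
      then obtain g where "v = Gate g" "g \<in> gates C" "w \<in> nodes n C"
        using C by (auto simp: pre_circuit_def)
      then show "v \<in> Gate ` gates D" "w \<in> nodes n D"
        using vw closed nodes by auto
    qed
  qed (use C top nodes reach acyc out in \<open>auto simp: pre_circuit_def R_def\<close>)
  moreover have "circuit_size D \<le> circuit_size C"
    using C by (auto simp: circuit_size_def pre_circuit_def intro: card_mono)
  moreover have "eval_circuit D x = eval_circuit C x" for x
  proof -
    have fin: "finite (edges D)" "finite ?E" "acyclic ?E"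
      using pre_circuit_finite_edges[OF C] C by (auto simp: pre_circuit_def)
    have "eval_node D x (id (top_node C)) = eval_node C x (top_node C)"
      by (rule eval_node_hom[where R = R])
        (use fin acyc closed top out in \<open>auto simp: eval_node_unfold'[OF fin(1) acyc] eval_step_def\<close>)
    then show ?thesis by (simp add: eval_circuit_def)
  qed
  ultimately show ?thesis by blast
qed

text \<open>The value at a gate is a dummy; substitutions only produce variables and
  constants.\<close>

fun node_val :: "bool list \<Rightarrow> node \<Rightarrow> bool" where
  "node_val x (Input i) = x ! i"
| "node_val x (Const b) = b"
| "node_val x (Gate g) = False"

lemma trancl_only_gates:
  assumes "E' \<subseteq> range Gate \<times> UNIV" "\<And>v g. (v, Gate g) \<in> E' \<Longrightarrow> (v, Gate g) \<in> E"
    and "(v, w) \<in> E'\<^sup>+" "w = Gate g"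
  shows "(v, w) \<in> E\<^sup>+"
  using assms(3,4)
proof (induction arbitrary: g rule: trancl_induct)
  case (base w)
  then show ?case using assms(2) by auto
next
  case (step w z)
  then obtain g' where "w = Gate g'" using assms(1) by auto
  then show ?case using step assms(2) by (metis trancl.trancl_into_trancl)
qed

text \<open>Every node on a cycle has an outgoing edge and is therefore a gate. Hence new edges into
  variables or constants close no cycle, which covers both substitution and truncation.\<close>

lemma acyclic_only_gates:
  assumes "acyclic E" "E' \<subseteq> range Gate \<times> UNIV"
    and "\<And>v g. (v, Gate g) \<in> E' \<Longrightarrow> (v, Gate g) \<in> E"
  shows "acyclic E'"
  unfolding acyclic_def
proof safe
  fix v assume v: "(v, v) \<in> E'\<^sup>+"
  then obtain w where "(v, w) \<in> E'" by (meson tranclD)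
  then obtain g where "v = Gate g" using assms(2) by auto
  then have "(v, v) \<in> E\<^sup>+" using trancl_only_gates[OF assms(2,3) v] by auto
  then show False using assms(1) by (auto simp: acyclic_def)
qed

text \<open>Agreement is required only at variables that occur in the circuit. This is what lets a
  circuit over \<open>n\<close> variables that reads few of them become a circuit over
  \<open>k\<close> variables, and it leaves \<open>\<theta>\<close> arbitrary elsewhere. Distinct
  variables may be identified: successor sets then shrink but stay nonempty, and singletons stay
  singletons.\<close>

lemma pre_circuit_subst:
  assumes C: "pre_circuit n C" and \<theta>: "\<And>i. \<theta> i \<in> Input ` {..<n'} \<union> range Const"
  shows "\<exists>D. boolean_circuit n' D \<and> circuit_size D \<le> circuit_size C \<and>
    (\<forall>x u. (\<forall>i. Input i \<in> insert (top_node C) (Range (edges C)) \<longrightarrow> node_val u (\<theta> i) = x ! i) \<longrightarrow>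
       eval_circuit D u = eval_circuit C x)"
proof -
  let ?E = "edges C"
  define \<nu> where "\<nu> = (\<lambda>v. case v of Input i \<Rightarrow> \<theta> i | _ \<Rightarrow> v)"
  have \<nu>_simps [simp]: "\<nu> (Gate g) = Gate g" "\<nu> (Const b) = Const b" "\<nu> (Input i) = \<theta> i" for g b i
    by (simp_all add: \<nu>_def)
  have \<nu>_gate: "v = Gate g" if "\<nu> v = Gate g" for v g
    using that \<theta> by (cases v) (auto, metis UnE image_iff node.distinct(1,3))
  define D where "D = C\<lparr>edges := apsnd \<nu> ` ?E, top_node := \<nu> (top_node C)\<rparr>"
  have D_simps [simp]: "gates D = gates C" "edges D = apsnd \<nu> ` ?E"
    "top_node D = \<nu> (top_node C)" "gtype D = gtype C"
    by (simp_all add: D_def)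
  have out: "edges D `` {v} = \<nu> ` (?E `` {v})" for v
    by force
  have nodes: "\<nu> v \<in> nodes n' D" if "v \<in> nodes n C" for v
  proof (cases v)
    case (Input i)
    then show ?thesis using \<theta>[of i] by (auto simp: nodes_def)
  qed (use that in \<open>auto simp: nodes_def\<close>)
  have acyc: "acyclic (edges D)"
  proof (rule acyclic_only_gates[of ?E])
    show "edges D \<subseteq> range Gate \<times> UNIV" using C by (auto simp: pre_circuit_def)
  qed (use C \<nu>_gate in \<open>auto simp: pre_circuit_def, metis\<close>)
  have "pre_circuit n' D"
    unfolding pre_circuit_def
  proof (intro conjI ballI impI)
    show "edges D \<subseteq> Gate ` gates D \<times> nodes n' D"
    proof
      fix e assume "e \<in> edges D"
      then obtain v w where "e = (v, \<nu> w)" "(v, w) \<in> ?E" by auto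
      then show "e \<in> Gate ` gates D \<times> nodes n' D"
        using C nodes by (auto simp: pre_circuit_def)
    qed
    show "card (edges D `` {Gate g}) = 1" if "g \<in> gates D" "gtype D g = Neg" for g
    proof -
      have "card (?E `` {Gate g}) = 1" using that C by (auto simp: pre_circuit_def)
      then obtain w where "?E `` {Gate g} = {w}" by (auto simp: card_1_singleton_iff)
      then show ?thesis unfolding out by simp
    qed
    show "edges D `` {Gate g} \<noteq> {}" if "g \<in> gates D" for g
      using that C unfolding out by (auto simp: pre_circuit_def)
  qed (use C nodes acyc in \<open>auto simp: pre_circuit_def\<close>)
  then obtain D' where D': "boolean_circuit n' D'" "circuit_size D' \<le> circuit_size D"
    "\<And>x. eval_circuit D' x = eval_circuit D x"
    using pre_circuit_prune by blast
  have "eval_circuit D u = eval_circuit C x"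
    if "\<forall>i. Input i \<in> insert (top_node C) (Range ?E) \<longrightarrow> node_val u (\<theta> i) = x ! i" for x u
  proof -
    have fin: "finite (edges D)" "finite ?E" "acyclic ?E"
      using pre_circuit_finite_edges[OF C] C by (auto simp: pre_circuit_def)
    have val: "eval_node D u (\<theta> i) = node_val u (\<theta> i)" for i
      using \<theta>[of i] by (auto simp: eval_node_unfold'[OF fin(1) acyc] eval_step_def)
    have "eval_node D u (\<nu> (top_node C)) = eval_node C x (top_node C)"
      by (rule eval_node_hom[where R = "insert (top_node C) (Range ?E)"])
        (use fin acyc that out val in auto)
    then show ?thesis by (simp add: eval_circuit_def)
  qed
  then show ?thesis using D' by (intro exI[of _ D'] conjI) (auto simp: circuit_size_def)
qed

text \<open>Soundness uses this to turn a hypothesis about blocks into a circuit over the original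
  variables without adding gates.\<close>

lemma circuit_class_subst:
  assumes "h \<in> circuit_class k s" "\<And>j. \<theta> j \<in> Input ` {..<n} \<union> range Const"
  shows "(\<lambda>x. h (map (\<lambda>j. node_val x (\<theta> j)) [0..<k])) \<in> circuit_class n s"
proof -
  obtain C where C: "boolean_circuit k C" "circuit_size C \<le> s" "\<And>y. y \<in> cube k \<Longrightarrow> h y = eval_circuit C y"
    using assms(1) by (auto simp: circuit_class_def)
  obtain D where D: "boolean_circuit n D" "circuit_size D \<le> circuit_size C"
    and ev: "\<And>x u. (\<And>i. Input i \<in> insert (top_node C) (Range (edges C)) \<Longrightarrow> node_val u (\<theta> i) = x ! i) \<Longrightarrow>
       eval_circuit D u = eval_circuit C x"
    using pre_circuit_subst[where \<theta> = \<theta> and n' = n, OF boolean_circuit_imp_pre_circuit[OF C(1)] assms(2)]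
    by auto
  have used: "i < k" if "Input i \<in> insert (top_node C) (Range (edges C))" for i
    using that C(1) by (auto simp: boolean_circuit_def nodes_def)
  have "h (map (\<lambda>j. node_val u (\<theta> j)) [0..<k]) = eval_circuit D u" for u
  proof -
    have "eval_circuit D u = eval_circuit C (map (\<lambda>j. node_val u (\<theta> j)) [0..<k])"
      by (rule ev) (use used in auto)
    then show ?thesis by (simp add: C(3) cube_def)
  qed
  then show ?thesis using C(2) D by (force simp: circuit_class_def)
qed

section \<open>Approximation by circuits that read few variables\<close>

lemma ufrac_all_in:
  assumes "finite N" "I \<subseteq> N" "L \<le> card I"
  shows "ufrac (Pow N) (\<lambda>X. I \<subseteq> X) \<le> (1 / 2) ^ L"
    and "ufrac (Pow N) (\<lambda>X. X \<inter> I = {}) \<le> (1 / 2) ^ L"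
proof -
  have "ufrac (Pow N) (\<lambda>X. I \<subseteq> X) = ufrac (Pow N) (\<lambda>X. X \<inter> I = I)"
    by (intro ufrac_cong) auto
  also have "\<dots> = (1 / 2) ^ card I"
    using assms by (intro ufrac_Pow_Int_eq) auto
  also have "\<dots> \<le> (1 / 2) ^ L"
    using assms by (intro power_decreasing) auto
  finally show "ufrac (Pow N) (\<lambda>X. I \<subseteq> X) \<le> (1 / 2) ^ L" .
  have "ufrac (Pow N) (\<lambda>X. X \<inter> I = {}) = (1 / 2) ^ card I"
    using assms by (intro ufrac_Pow_Int_eq) auto
  also have "\<dots> \<le> (1 / 2) ^ L"
    using assms by (intro power_decreasing) auto
  finally show "ufrac (Pow N) (\<lambda>X. X \<inter> I = {}) \<le> (1 / 2) ^ L" .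
qed

definition gate_inputs :: "circuit \<Rightarrow> nat \<Rightarrow> nat set" where
  "gate_inputs C g = {i. (Gate g, Input i) \<in> edges C}"

definition wide_gates :: "nat \<Rightarrow> circuit \<Rightarrow> nat set" where
  "wide_gates L C = {g \<in> gates C. gtype C g \<noteq> Neg \<and> L < card (gate_inputs C g)}"

text \<open>
  A conjunction (disjunction) of more than \<open>L\<close> variables is almost always false (true), so the
  gate is fed a single constant instead.
\<close>

definition truncate_circuit :: "nat \<Rightarrow> circuit \<Rightarrow> circuit" where
  "truncate_circuit L C = C\<lparr>edges :=
     {(v, w) \<in> edges C. v \<notin> Gate ` wide_gates L C} \<union>
     (\<lambda>g. (Gate g, Const (gtype C g = Disj))) ` wide_gates L C\<rparr>"

lemma truncate_simps [simp]:
  "gates (truncate_circuit L C) = gates C" "gtype (truncate_circuit L C) = gtype C"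
  "top_node (truncate_circuit L C) = top_node C"
  by (simp_all add: truncate_circuit_def)

lemma edges_truncate:
  "edges (truncate_circuit L C) = {(v, w) \<in> edges C. v \<notin> Gate ` wide_gates L C} \<union>
     (\<lambda>g. (Gate g, Const (gtype C g = Disj))) ` wide_gates L C"
  by (simp add: truncate_circuit_def)

lemma edges_truncate_Image:
  "edges (truncate_circuit L C) `` {Gate g} =
     (if g \<in> wide_gates L C then {Const (gtype C g = Disj)} else edges C `` {Gate g})"
  by (auto simp: edges_truncate)

lemma pre_circuit_truncate:
  assumes C: "pre_circuit n C"
  shows "pre_circuit n (truncate_circuit L C)"
  unfolding pre_circuit_def
proof (intro conjI ballI impI)
  show "acyclic (edges (truncate_circuit L C))"
    by (rule acyclic_only_gates[of "edges C"]) (use C in \<open>auto simp: pre_circuit_def edges_truncate\<close>)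
  show "edges (truncate_circuit L C) \<subseteq> Gate ` gates (truncate_circuit L C) \<times> nodes n (truncate_circuit L C)"
    using C by (auto simp: pre_circuit_def edges_truncate nodes_def wide_gates_def)
qed (use C in \<open>auto simp: pre_circuit_def edges_truncate_Image wide_gates_def nodes_def\<close>)

text \<open>A single variable with the deciding value fixes the output of a conjunction or
  disjunction, whatever the other successors are, so the replacement constant is then the true value
  of the gate.\<close>

lemma eval_truncate:
  assumes C: "pre_circuit n C"
    and good: "\<And>g. g \<in> wide_gates L C \<Longrightarrow> gtype C g = Conj \<Longrightarrow> \<exists>i\<in>gate_inputs C g. \<not> x ! i"
      "\<And>g. g \<in> wide_gates L C \<Longrightarrow> gtype C g = Disj \<Longrightarrow> \<exists>i\<in>gate_inputs C g. x ! i"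
  shows "eval_circuit (truncate_circuit L C) x = eval_circuit C x"
proof -
  have fC: "finite (edges C)" "acyclic (edges C)"
    using pre_circuit_finite_edges[OF C] C by (auto simp: pre_circuit_def)
  have fT: "finite (edges (truncate_circuit L C))" "acyclic (edges (truncate_circuit L C))"
    using pre_circuit_finite_edges[OF pre_circuit_truncate[OF C]] pre_circuit_truncate[OF C]
    by (auto simp: pre_circuit_def)
  have inp: "eval_node C x (Input i) = x ! i" for i
    by (simp add: eval_node_unfold'[OF fC] eval_step_def)
  have const: "eval_node (truncate_circuit L C) x (Const b) = b" for b
    by (simp add: eval_node_unfold'[OF fT] eval_step_def)
  have "eval_node (truncate_circuit L C) x v = eval_node C x v" for v
    using finite_acyclic_wf_converse[OF fC]
  proof (induction v rule: wf_induct_rule)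
    case (less v)
    show ?case
    proof (cases v)
      case (Gate g)
      show ?thesis
      proof (cases "g \<in> wide_gates L C")
        case True
        have "\<exists>w\<in>edges C `` {Gate g}. \<not> eval_node C x w" if "gtype C g = Conj"
          using good(1)[OF True that] inp by (auto simp: gate_inputs_def)
        moreover have "\<exists>w\<in>edges C `` {Gate g}. eval_node C x w" if "gtype C g = Disj"
          using good(2)[OF True that] inp by (auto simp: gate_inputs_def)
        moreover have "gtype C g \<noteq> Neg"
          using True by (simp add: wide_gates_def)
        ultimately show ?thesis
          using True Gate unfolding eval_node_unfold'[OF fC, of x v] eval_node_unfold'[OF fT, of x v]
          by (auto simp: eval_step_def edges_truncate_Image const split: gate_type.split)
      next
        case False
        then show ?thesis
          using less.IH Gate
          unfolding eval_node_unfold'[OF fC, of x v] eval_node_unfold'[OF fT, of x v]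
          by (auto simp: eval_step_def edges_truncate_Image split: gate_type.split)
      qed
    next
      case (Input i)
      then show ?thesis
        by (simp add: eval_node_unfold'[OF fC] eval_node_unfold'[OF fT] eval_step_def)
    next
      case (Const b)
      then show ?thesis
        by (simp add: eval_node_unfold'[OF fC] eval_node_unfold'[OF fT] eval_step_def)
    qed
  qed
  then show ?thesis by (simp add: eval_circuit_def)
qed

text \<open>After truncation each of the at most \<open>s\<close> gates reads at most
  \<open>L\<close> variables; the extra variable in \<open>s * L + 1\<close> covers a circuit whose
  root is itself a variable. Negations stay below the threshold because \<open>L \<ge> 1\<close>.
  Each truncated gate is wrong with probability at most \<open>2^-L\<close>, which gives the error
  by a union bound.\<close>

lemma circuit_near_narrow:
  assumes C: "boolean_circuit n C" and s: "circuit_size C \<le> s" and "L \<ge> 1" "n \<ge> 1"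
  shows "\<exists>h\<in>circuit_class (s * L + 1) s. \<exists>\<pi>. (\<forall>j. \<pi> j < n) \<and>
    ufrac (Pow {..<n}) (\<lambda>X. eval_circuit C (bits n X) \<noteq>
      h (map (\<lambda>j. \<pi> j \<in> X) [0..<s * L + 1])) \<le> real s / 2 ^ L"
proof -
  let ?T = "truncate_circuit L C" and ?k = "s * L + 1"
  have pC: "pre_circuit n C" and pT: "pre_circuit n ?T"
    using C by (auto intro: boolean_circuit_imp_pre_circuit pre_circuit_truncate)
  have finG: "finite (gates C)" "card (gates C) \<le> s"
    using C s by (auto simp: boolean_circuit_def circuit_size_def)
  define V where "V = {i. Input i \<in> insert (top_node C) (Range (edges ?T))}"
  have inputs_lt: "gate_inputs C g \<subseteq> {..<n}" for g
    using C by (auto simp: gate_inputs_def boolean_circuit_def nodes_def)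
  have V_lt: "V \<subseteq> {..<n}"
    using pT by (auto simp: V_def pre_circuit_def nodes_def)
  then have finV: "finite V" using finite_subset by blast
  have narrow: "card (gate_inputs C g) \<le> L" if "g \<in> gates C - wide_gates L C" for g
  proof (cases "gtype C g = Neg")
    case True
    then have 1: "card (edges C `` {Gate g}) = 1"
      using that C by (auto simp: boolean_circuit_def)
    then have "card (gate_inputs C g) \<le> card (edges C `` {Gate g})"
      by (intro card_inj_on_le[of Input]) (auto simp: gate_inputs_def inj_on_def card_ge_0_finite)
    then show ?thesis using 1 \<open>L \<ge> 1\<close> by simp
  qed (use that in \<open>auto simp: wide_gates_def\<close>)
  have "V \<subseteq> {i. Input i = top_node C} \<union> (\<Union>g\<in>gates C - wide_gates L C. gate_inputs C g)"
  proof
    fix i assume "i \<in> V"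
    then consider "Input i = top_node C"
      | v where "(v, Input i) \<in> edges C" "v \<notin> Gate ` wide_gates L C"
      by (auto simp: V_def edges_truncate)
    then show "i \<in> {i. Input i = top_node C} \<union> (\<Union>g\<in>gates C - wide_gates L C. gate_inputs C g)"
    proof cases
      case 2
      then obtain g where "v = Gate g" "g \<in> gates C"
        using C by (auto simp: boolean_circuit_def)
      then show ?thesis using 2 by (auto simp: gate_inputs_def)
    qed auto
  qed
  then have "card V \<le> card ({i. Input i = top_node C} \<union> (\<Union>g\<in>gates C - wide_gates L C. gate_inputs C g))"
    using finG finite_subset[OF inputs_lt]
    by (intro card_mono finite_UnI finite_UN_I) (cases "top_node C", auto)
  also have "\<dots> \<le> card {i. Input i = top_node C} + card (\<Union>g\<in>gates C - wide_gates L C. gate_inputs C g)"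
    by (rule card_Un_le)
  also have "card {i. Input i = top_node C} \<le> 1"
    by (cases "top_node C") auto
  also have "card (\<Union>g\<in>gates C - wide_gates L C. gate_inputs C g) \<le>
      (\<Sum>g\<in>gates C - wide_gates L C. card (gate_inputs C g))"
    using finG by (intro card_UN_le) auto
  also have "\<dots> \<le> (\<Sum>g\<in>gates C - wide_gates L C. L)"
    using narrow by (rule sum_mono)
  also have "\<dots> \<le> card (gates C) * L"
    using finG by (simp add: card_mono)
  also have "\<dots> \<le> s * L" using finG by simp
  finally have cardV: "card V \<le> ?k" by simp
  obtain e where e: "bij_betw e {0..<card V} V"
    using ex_bij_betw_nat_finite[OF finV] by blast
  define pos where "pos = inv_into {0..<card V} e"
  have pos: "pos i < card V" "e (pos i) = i" if "i \<in> V" for i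
    using that e unfolding pos_def
    by (metis atLeastLessThan_iff bij_betw_imp_surj_on inv_into_into)
      (metis that e bij_betw_inv_into_right pos_def)
  define \<theta> where "\<theta> = (\<lambda>i. if i \<in> V then Input (pos i) else Const False)"
  \<comment> \<open>Positions beyond \<open>card V\<close> are padded with variable 0, which exists
    because \<open>n \<ge> 1\<close>.\<close>
  define \<pi> where "\<pi> = (\<lambda>j. if j < card V then e j else 0)"
  have \<pi>_lt: "\<pi> j < n" for j
  proof (cases "j < card V")
    case True
    then have "e j \<in> V" using e by (auto simp: bij_betw_def)
    then show ?thesis using V_lt True by (auto simp: \<pi>_def)
  qed (use \<open>n \<ge> 1\<close> in \<open>auto simp: \<pi>_def\<close>)
  have "\<theta> i \<in> Input ` {..<?k} \<union> range Const" for i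
    using pos(1)[of i] cardV by (auto simp: \<theta>_def)
  from pre_circuit_subst[where \<theta> = \<theta>, OF pT this]
  obtain D where D: "boolean_circuit ?k D" "circuit_size D \<le> circuit_size ?T"
    and ev: "\<And>x u. \<forall>i. Input i \<in> insert (top_node ?T) (Range (edges ?T)) \<longrightarrow> node_val u (\<theta> i) = x ! i \<Longrightarrow>
       eval_circuit D u = eval_circuit ?T x"
    by auto
  have evD: "eval_circuit D (map (\<lambda>j. \<pi> j \<in> X) [0..<?k]) = eval_circuit ?T (bits n X)" for X
  proof (intro ev allI impI)
    fix i assume "Input i \<in> insert (top_node ?T) (Range (edges ?T))"
    then have i: "i \<in> V" by (simp add: V_def)
    then have "pos i < ?k" "\<pi> (pos i) = i" "i < n"
      using pos[of i] cardV V_lt by (auto simp: \<pi>_def)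
    then show "node_val (map (\<lambda>j. \<pi> j \<in> X) [0..<?k]) (\<theta> i) = bits n X ! i"
      using i by (simp add: \<theta>_def del: upt_Suc)
  qed
  have "ufrac (Pow {..<n}) (\<lambda>X. eval_circuit C (bits n X) \<noteq> eval_circuit ?T (bits n X)) \<le>
      ufrac (Pow {..<n}) (\<lambda>X. \<exists>g\<in>wide_gates L C.
        gtype C g = Conj \<and> gate_inputs C g \<subseteq> X \<or> gtype C g = Disj \<and> X \<inter> gate_inputs C g = {})"
  proof (rule ufrac_mono, rule ccontr)
    fix X assume ne: "eval_circuit C (bits n X) \<noteq> eval_circuit ?T (bits n X)"
      and no: "\<not> (\<exists>g\<in>wide_gates L C.
        gtype C g = Conj \<and> gate_inputs C g \<subseteq> X \<or> gtype C g = Disj \<and> X \<inter> gate_inputs C g = {})"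
    have *: "bits n X ! i \<longleftrightarrow> i \<in> X" if "i \<in> gate_inputs C g" for i g
      using that inputs_lt[of g] by auto
    have "eval_circuit ?T (bits n X) = eval_circuit C (bits n X)"
    proof (rule eval_truncate[OF pC])
      fix g assume g: "g \<in> wide_gates L C"
      show "\<exists>i\<in>gate_inputs C g. \<not> bits n X ! i" if "gtype C g = Conj"
        using no g that * by blast
      show "\<exists>i\<in>gate_inputs C g. bits n X ! i" if "gtype C g = Disj"
        using no g that * by blast
    qed
    then show False using ne by simp
  qed
  also have "\<dots> \<le> (\<Sum>g\<in>wide_gates L C. ufrac (Pow {..<n}) (\<lambda>X.
      gtype C g = Conj \<and> gate_inputs C g \<subseteq> X \<or> gtype C g = Disj \<and> X \<inter> gate_inputs C g = {}))"
    using finG by (intro ufrac_bex_le) (auto simp: wide_gates_def)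
  also have "\<dots> \<le> (\<Sum>g\<in>wide_gates L C. (1 / 2) ^ L)"
  proof (rule sum_mono)
    fix g assume g: "g \<in> wide_gates L C"
    then have L: "L \<le> card (gate_inputs C g)" by (simp add: wide_gates_def)
    show "ufrac (Pow {..<n}) (\<lambda>X. gtype C g = Conj \<and> gate_inputs C g \<subseteq> X \<or>
        gtype C g = Disj \<and> X \<inter> gate_inputs C g = {}) \<le> (1 / 2) ^ L"
      using ufrac_all_in[OF finite_lessThan inputs_lt[of g] L] g
      by (cases "gtype C g") (auto simp: wide_gates_def)
  qed
  also have "\<dots> = real (card (wide_gates L C)) * (1 / 2) ^ L" by simp
  also have "\<dots> \<le> real s * (1 / 2) ^ L"
  proof (intro mult_right_mono)
    have "card (wide_gates L C) \<le> card (gates C)"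
      using finG by (intro card_mono) (auto simp: wide_gates_def)
    then show "real (card (wide_gates L C)) \<le> real s" using finG by simp
  qed auto
  finally have "ufrac (Pow {..<n}) (\<lambda>X. eval_circuit C (bits n X) \<noteq>
      eval_circuit D (map (\<lambda>j. \<pi> j \<in> X) [0..<?k])) \<le> real s / 2 ^ L"
    unfolding evD by (simp add: power_divide)
  moreover have "eval_circuit D \<in> circuit_class ?k s"
    using D s by (force simp: circuit_class_def circuit_size_def)
  ultimately show ?thesis using \<pi>_lt by blast
qed

section \<open>Counting circuits\<close>

lemma trancl_map_prod_inj:
  assumes "(a, b) \<in> (map_prod \<nu> \<nu> ` E)\<^sup>+" "inj_on \<nu> (Field E)"
  shows "\<exists>v w. a = \<nu> v \<and> b = \<nu> w \<and> (v, w) \<in> E\<^sup>+"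
  using assms(1)
proof (induction rule: trancl_induct)
  case (step b c)
  then obtain v w w' z where *: "a = \<nu> v" "b = \<nu> w" "(v, w) \<in> E\<^sup>+" "b = \<nu> w'" "c = \<nu> z" "(w', z) \<in> E"
    by auto
  have "w \<in> Field E" using *(3) by (metis FieldI2 tranclD2)
  moreover have "w' \<in> Field E" using *(6) by (rule FieldI1)
  ultimately have "w = w'" using assms(2) * by (auto dest: inj_onD)
  then show ?case using * by (metis trancl.trancl_into_trancl)
qed auto

lemma acyclic_map_prod_inj:
  assumes "acyclic E" "inj_on \<nu> (Field E)"
  shows "acyclic (map_prod \<nu> \<nu> ` E)"
  unfolding acyclic_def
proof safe
  fix a assume "(a, a) \<in> (map_prod \<nu> \<nu> ` E)\<^sup>+"
  then obtain v w where *: "a = \<nu> v" "a = \<nu> w" "(v, w) \<in> E\<^sup>+"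
    using trancl_map_prod_inj[OF _ assms(2)] by blast
  have "v \<in> Field E" "w \<in> Field E" using *(3) by (metis FieldI1 FieldI2 tranclD tranclD2)+
  then show False using * assms by (metis acyclic_def inj_onD)
qed

text \<open>Renumber the gates into \<open>{..<s}\<close>. Then gate types, a subset of the at most
  \<open>s * (s + k + 2)\<close> possible edges and a root determine the function. Codes need not
  describe valid circuits, since only surjectivity onto \<open>F\<close> matters. Restriction to the
  cube makes the class finite, as values off the cube are arbitrary.\<close>

lemma card_circuit_class:
  fixes k s
  defines "F \<equiv> (\<lambda>h. restrict h (cube k)) ` circuit_class k s"
  shows "finite F" "card F \<le> 3 ^ s * 2 ^ (s * (s + k + 2)) * (s + k + 2)"
proof -
  define N where "N = Gate ` {..<s} \<union> Input ` {..<k} \<union> range Const"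
  have cardN: "finite N" "card N \<le> s + k + 2"
  proof -
    have r: "range Const = {Const True, Const False}" by (auto simp: image_def)
    show "finite N" by (simp add: N_def)
    have "card N \<le> card (Gate ` {..<s}) + card (Input ` {..<k}) + card (range Const)"
      unfolding N_def by (intro order.trans[OF card_Un_le] add_right_mono card_Un_le)
    also have "\<dots> \<le> s + k + 2"
      unfolding r using card_image_le[of "{..<s}" Gate] card_image_le[of "{..<k}" Input] by simp
    finally show "card N \<le> s + k + 2" .
  qed
  define codes where "codes = (PiE {..<s} (\<lambda>_. UNIV :: gate_type set)) \<times> (Pow (Gate ` {..<s} \<times> N) \<times> N)"
  define decode where "decode = (\<lambda>(ty, E, t). restrict
    (eval_circuit \<lparr>gates = {..<s}, gtype = ty, edges = E, top_node = t\<rparr>) (cube k))"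
  have U: "(UNIV :: gate_type set) = {Conj, Disj, Neg}"
    using gate_type.exhaust by auto
  have finU: "finite (UNIV :: gate_type set)" "card (UNIV :: gate_type set) = 3"
    unfolding U by simp_all
  have fin: "finite codes"
    unfolding codes_def using cardN finU by (intro finite_cartesian_product finite_PiE) auto
  have "F \<subseteq> decode ` codes"
  proof
    fix f assume "f \<in> F"
    then obtain h where h: "h \<in> circuit_class k s" "f = restrict h (cube k)"
      by (auto simp: F_def)
    then obtain C where C: "boolean_circuit k C" "circuit_size C \<le> s" "\<And>y. y \<in> cube k \<Longrightarrow> h y = eval_circuit C y"
      by (auto simp: circuit_class_def)
    have fC: "finite (edges C)" "acyclic (edges C)"
      using pre_circuit_finite_edges C(1) boolean_circuit_imp_pre_circuit
      by (auto simp: boolean_circuit_def)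
    have "\<exists>\<rho>. \<rho> ` gates C \<subseteq> {..<s} \<and> inj_on \<rho> (gates C)"
      using C by (intro card_le_inj) (auto simp: boolean_circuit_def circuit_size_def)
    then obtain \<rho> where \<rho>: "\<rho> ` gates C \<subseteq> {..<s}" "inj_on \<rho> (gates C)" by blast
    define \<nu> where "\<nu> = (\<lambda>v. case v of Gate g \<Rightarrow> Gate (\<rho> g) | _ \<Rightarrow> v)"
    have \<nu>_simps [simp]: "\<nu> (Gate g) = Gate (\<rho> g)" "\<nu> (Const b) = Const b" "\<nu> (Input i) = Input i" for g b i
      by (simp_all add: \<nu>_def)
    have inj: "inj_on \<nu> (nodes k C)"
    proof (rule inj_onI)
      fix v w assume "v \<in> nodes k C" "w \<in> nodes k C" "\<nu> v = \<nu> w"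
      then show "v = w"
        using inj_onD[OF \<rho>(2)] by (cases v; cases w) (auto simp: nodes_def)
    qed
    have field: "Field (edges C) \<subseteq> nodes k C"
      using C(1) by (auto simp: boolean_circuit_def Field_def nodes_def)
    have nodes: "\<nu> v \<in> N" if "v \<in> nodes k C" for v
      using that \<rho>(1) by (auto simp: nodes_def N_def)
    define ty where "ty = restrict (\<lambda>g. gtype C (inv_into (gates C) \<rho> g)) {..<s}"
    define E where "E = map_prod \<nu> \<nu> ` edges C"
    define D where "D = \<lparr>gates = {..<s}, gtype = ty, edges = E, top_node = \<nu> (top_node C)\<rparr>"
    have D_simps [simp]: "edges D = E" "gtype D = ty" by (simp_all add: D_def)
    have "E \<subseteq> Gate ` {..<s} \<times> N"
    proof
      fix e assume "e \<in> E"
      then obtain v w where "e = (\<nu> v, \<nu> w)" "(v, w) \<in> edges C" by (auto simp: E_def)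
      moreover from this obtain g where "v = Gate g" "g \<in> gates C" "w \<in> nodes k C"
        using C(1) by (auto simp: boolean_circuit_def)
      ultimately show "e \<in> Gate ` {..<s} \<times> N"
        using nodes \<rho>(1) by auto
    qed
    moreover have "\<nu> (top_node C) \<in> N"
      using C(1) nodes by (auto simp: boolean_circuit_def)
    ultimately have code: "(ty, E, \<nu> (top_node C)) \<in> codes"
      by (auto simp: codes_def ty_def)
    have fD: "finite (edges D)" "acyclic (edges D)"
      using fC acyclic_map_prod_inj[OF fC(2) inj_on_subset[OF inj field]] by (auto simp: E_def)
    have "eval_node D y (\<nu> (top_node C)) = eval_node C y (top_node C)" for y
    proof (rule eval_node_hom[where R = "nodes k C", OF fC fD])
      fix g assume g: "Gate g \<in> nodes k C"
      then have g': "g \<in> gates C" by (auto simp: nodes_def)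
      have "ty (\<rho> g) = gtype C g"
        using g' \<rho> by (auto simp: ty_def)
      moreover have "E `` {Gate (\<rho> g)} = \<nu> ` (edges C `` {Gate g})"
      proof safe
        fix a assume "(Gate (\<rho> g), a) \<in> E"
        then obtain v w where vw: "\<nu> v = \<nu> (Gate g)" "a = \<nu> w" "(v, w) \<in> edges C"
          by (auto simp: E_def)
        moreover have "v \<in> nodes k C" using vw(3) field by (auto simp: Field_def)
        ultimately have "v = Gate g" using inj_onD[OF inj vw(1)] g by auto
        then show "a \<in> \<nu> ` (edges C `` {Gate g})" using vw by auto
      next
        fix w assume "(Gate g, w) \<in> edges C"
        then have "map_prod \<nu> \<nu> (Gate g, w) \<in> E" unfolding E_def by (rule imageI)
        then show "(Gate (\<rho> g), \<nu> w) \<in> E" by simp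
      qed
      ultimately show "\<exists>g'. \<nu> (Gate g) = Gate g' \<and> gtype D g' = gtype C g \<and>
        edges D `` {Gate g'} = \<nu> ` (edges C `` {Gate g})" by simp
    qed (use C(1) field in \<open>auto simp: boolean_circuit_def Field_def eval_node_unfold'[OF fD] eval_step_def\<close>)
    then have "f = decode (ty, E, \<nu> (top_node C))"
      unfolding h(2) decode_def prod.case D_def
      using C(3) by (intro restrict_ext) (simp add: eval_circuit_def)
    then show "f \<in> decode ` codes" using code by blast
  qed
  then show "finite F" using fin by (rule finite_surj[rotated])
  have "card F \<le> card codes"
    using \<open>F \<subseteq> decode ` codes\<close> fin by (meson card_image_le card_mono finite_imageI order.trans)
  also have "\<dots> = 3 ^ s * (2 ^ card (Gate ` {..<s} \<times> N) * card N)"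
    using cardN by (simp add: codes_def card_cartesian_product card_PiE finU card_Pow)
  also have "\<dots> \<le> 3 ^ s * (2 ^ (s * (s + k + 2)) * (s + k + 2))"
  proof (intro mult_le_mono power_increasing order.refl)
    have "card (Gate ` {..<s}) \<le> s" using card_image_le[of "{..<s}" Gate] by simp
    then show "card (Gate ` {..<s} \<times> N) \<le> s * (s + k + 2)"
      unfolding card_cartesian_product using cardN by (intro mult_le_mono)
  qed (use cardN in auto)
  finally show "card F \<le> 3 ^ s * 2 ^ (s * (s + k + 2)) * (s + k + 2)"
    by (simp only: mult.assoc)
qed

section \<open>Random block maps and balanced samples\<close>

text \<open>With a block map this is the input that is constant on blocks; with a map naming
  variables it reads off the inputs of a circuit on few variables. Both uses compose through
  \<open>pull_pull\<close>.\<close>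

definition pull :: "nat \<Rightarrow> (nat \<Rightarrow> nat) \<Rightarrow> nat set \<Rightarrow> nat set" where
  "pull n \<phi> Y = {i. i < n \<and> \<phi> i \<in> Y}"

definition maps :: "nat \<Rightarrow> nat \<Rightarrow> (nat \<Rightarrow> nat) set" where
  "maps n r = PiE {..<n} (\<lambda>_. {..<r})"

definition halves :: "nat \<Rightarrow> nat set set" where
  "halves r = {Y. Y \<subseteq> {..<r} \<and> 2 * card Y = r}"

lemma pull_subset: "pull n \<phi> Y \<subseteq> {..<n}"
  by (auto simp: pull_def)

lemma pull_mix: "pull n \<phi> (mix S Y Y') = mix (pull n \<phi> S) (pull n \<phi> Y) (pull n \<phi> Y')"
  by (auto simp: pull_def mix_def)

lemma finite_maps [simp]: "finite (maps n r)"
  by (simp add: maps_def finite_PiE)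

lemma maps_nonempty [simp]: "r > 0 \<Longrightarrow> maps n r \<noteq> {}"
  by (auto simp: maps_def PiE_eq_empty_iff)

lemma finite_halves [simp]: "finite (halves r)"
  by (rule finite_subset[of _ "Pow {..<r}"]) (auto simp: halves_def)

lemma halves_nonempty [simp]: "even r \<Longrightarrow> halves r \<noteq> {}"
proof -
  assume "even r"
  then have "{..<r div 2} \<in> halves r" by (auto simp: halves_def)
  then show ?thesis by blast
qed

text \<open>For fixed \<open>Y\<close> the blocks of distinct variables are independent and each
  hits \<open>Y\<close> with probability exactly 1/2. The identity is exact for every
  \<open>n\<close> and every event, so nothing about the function being queried is needed.\<close>

lemma ufrac_pull:
  assumes "Y \<in> halves r" "r > 0"
  shows "ufrac (maps n r) (\<lambda>\<phi>. P (pull n \<phi> Y)) = ufrac (Pow {..<n}) P"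
proof -
  have one: "ufrac (maps n r) (\<lambda>\<phi>. pull n \<phi> Y = X) = (1 / 2) ^ n" if "X \<in> Pow {..<n}" for X
  proof -
    have Y: "Y \<subseteq> {..<r}" "2 * card Y = r" using assms by (auto simp: halves_def)
    then have finY: "finite Y" using finite_subset by blast
    have c: "ufrac {..<r} (\<lambda>b. b \<in> Y) = 1 / 2"
    proof -
      have "{b \<in> {..<r}. b \<in> Y} = Y" using Y by auto
      moreover have "real r = 2 * real (card Y)" using Y(2) by (metis of_nat_mult of_nat_numeral)
      ultimately show ?thesis using assms(2) by (simp add: ufrac_card)
    qed
    then have c': "ufrac {..<r} (\<lambda>b. b \<notin> Y) = 1 / 2"
      using assms(2) by (subst ufrac_not) (auto simp: lessThan_empty_iff)
    have "ufrac (maps n r) (\<lambda>\<phi>. pull n \<phi> Y = X) =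
        ufrac (maps n r) (\<lambda>\<phi>. \<forall>i\<in>{..<n}. \<phi> i \<in> Y \<longleftrightarrow> i \<in> X)"
      using that by (intro ufrac_cong) (auto simp: pull_def)
    also have "\<dots> = (\<Prod>i<n. ufrac {..<r} (\<lambda>b. b \<in> Y \<longleftrightarrow> i \<in> X))"
      unfolding maps_def by (rule ufrac_PiE) auto
    also have "\<dots> = (\<Prod>i<n. 1 / 2)"
    proof (rule prod.cong)
      fix i show "ufrac {..<r} (\<lambda>b. b \<in> Y \<longleftrightarrow> i \<in> X) = 1 / 2"
        using c c' by (cases "i \<in> X") simp_all
    qed simp
    finally show ?thesis by simp
  qed
  have "ufrac (maps n r) (\<lambda>\<phi>. P (pull n \<phi> Y)) =
      avg (maps n r) (\<lambda>\<phi>. \<Sum>X\<in>Pow {..<n}. of_bool (P X) * of_bool (pull n \<phi> Y = X))"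
    unfolding ufrac_def
  proof (intro avg_cong)
    fix \<phi>
    have "(\<Sum>X\<in>Pow {..<n}. of_bool (P X) * of_bool (pull n \<phi> Y = X)) =
        (\<Sum>X\<in>Pow {..<n}. if X = pull n \<phi> Y then of_bool (P X) else 0 :: real)"
      by (intro sum.cong) auto
    then show "of_bool (P (pull n \<phi> Y)) =
        (\<Sum>X\<in>Pow {..<n}. of_bool (P X) * of_bool (pull n \<phi> Y = X) :: real)"
      using pull_subset[of n \<phi> Y] by (simp add: sum.delta)
  qed simp
  also have "\<dots> = (\<Sum>X\<in>Pow {..<n}. of_bool (P X) * ufrac (maps n r) (\<lambda>\<phi>. pull n \<phi> Y = X))"
    unfolding avg_sum avg_cmult ufrac_def ..
  also have "\<dots> = (\<Sum>X\<in>Pow {..<n}. of_bool (P X) * (1 / 2) ^ n)"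
    using one by (intro sum.cong) auto
  also have "\<dots> = ufrac (Pow {..<n}) P"
    unfolding ufrac_def avg_def sum_distrib_right[symmetric] by (simp add: card_Pow power_divide)
  finally show ?thesis .
qed

text \<open>The ratio of the two binomials is the probability that a random \<open>H\<close>-subset
  of \<open>R\<close> points contains \<open>a\<close> given points and avoids \<open>b\<close>
  others. Reveal these points one at a time: each conditional probability has numerator at least
  \<open>c\<close> and denominator at most \<open>r\<close>.\<close>

lemma binomial_pattern_lower:
  assumes "a + c \<le> H" "H + b + c \<le> R" "R \<le> r"
  shows "(R choose H) * c ^ (a + b) \<le> (R - (a + b) choose (H - a)) * r ^ (a + b)"
  using assms
proof (induction a arbitrary: R H)
  case 0
  then show ?case
  proof (induction b arbitrary: R)
    case (Suc b)
    have "(R choose H) * c ^ (0 + Suc b) = (c * (R choose H)) * c ^ (0 + b)" by simp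
    also have "\<dots> \<le> ((R - H) * (R choose H)) * c ^ (0 + b)"
      using Suc.prems by (intro mult_right_mono) auto
    also have "\<dots> = R * ((R - 1 choose H) * c ^ (0 + b))"
      by (simp only: binomial_absorb_comp mult.assoc)
    also have "\<dots> \<le> r * ((R - 1 - (0 + b) choose (H - 0)) * r ^ (0 + b))"
      using Suc.prems by (intro mult_mono Suc.IH) auto
    finally show ?case by (simp add: mult_ac)
  qed simp
next
  case (Suc a)
  then obtain H' where H: "H = Suc H'" by (cases H) auto
  have "(R choose H) * c ^ (Suc a + b) = (c * (R choose H)) * c ^ (a + b)" by simp
  also have "\<dots> \<le> (H * (R choose H)) * c ^ (a + b)"
    using Suc.prems by (intro mult_right_mono) auto
  also have "\<dots> = R * ((R - 1 choose H') * c ^ (a + b))"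
    unfolding H by (simp only: binomial_absorption mult.assoc)
  also have "\<dots> \<le> r * ((R - 1 - (a + b) choose (H' - a)) * r ^ (a + b))"
    using Suc.prems H by (intro mult_mono Suc.IH) auto
  finally show ?case by (simp add: mult_ac H)
qed

lemma card_halves_pattern:
  assumes "r = 2 * h" "D \<subseteq> {..<r}" "Z \<subseteq> D" "card Z \<le> h"
  shows "card {Y \<in> halves r. Y \<inter> D = Z} = (r - card D choose (h - card Z))"
proof -
  have fin: "finite D" "finite Z" using assms finite_subset by (metis finite_lessThan)+
  have "bij_betw (\<lambda>W. W \<union> Z) {W. W \<subseteq> {..<r} - D \<and> card W = h - card Z} {Y \<in> halves r. Y \<inter> D = Z}"
  proof (rule bij_betw_byWitness[where f' = "\<lambda>Y. Y - D"])
    show "(\<lambda>W. W \<union> Z) ` {W. W \<subseteq> {..<r} - D \<and> card W = h - card Z} \<subseteq> {Y \<in> halves r. Y \<inter> D = Z}"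
    proof safe
      fix W assume W: "W \<subseteq> {..<r} - D" "card W = h - card Z"
      then have "finite W" using finite_subset by (metis finite_Diff finite_lessThan)
      then have "card (W \<union> Z) = card W + card Z"
        using W assms fin by (intro card_Un_disjoint) auto
      then show "W \<union> Z \<in> halves r" using W assms by (auto simp: halves_def)
    qed (use assms in auto)
    show "(\<lambda>Y. Y - D) ` {Y \<in> halves r. Y \<inter> D = Z} \<subseteq> {W. W \<subseteq> {..<r} - D \<and> card W = h - card Z}"
    proof safe
      fix Y assume Y: "Y \<in> halves r" "Z = Y \<inter> D"
      have "card (Y - D) = card Y - card (Y \<inter> D)"
        using fin by (simp add: card_Diff_subset_Int)
      then show "card (Y - D) = h - card (Y \<inter> D)"
        using Y assms by (auto simp: halves_def)
    qed (auto simp: halves_def)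
  qed (use assms in auto)
  then have "card {Y \<in> halves r. Y \<inter> D = Z} = card {W. W \<subseteq> {..<r} - D \<and> card W = h - card Z}"
    by (rule bij_betw_same_card[symmetric])
  also have "\<dots> = (r - card D choose (h - card Z))"
    using assms fin by (simp add: n_subsets card_Diff_subset)
  finally show ?thesis .
qed

text \<open>Few coordinates of a random half are nearly independent.\<close>

lemma ufrac_halves_pattern:
  assumes r: "r = 2 * h" "D \<subseteq> {..<r}" "Z \<subseteq> D" "card D \<le> K" "4 * K\<^sup>2 \<le> r"
  shows "(1 / 2) ^ card D / 2 \<le> ufrac (halves r) (\<lambda>Y. Y \<inter> D = Z)"
proof -
  define d where "d = card D"
  have finD: "finite D" using assms finite_subset by (metis finite_lessThan)
  have Zd: "card Z \<le> d" unfolding d_def using assms finD by (intro card_mono) auto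
  have "d\<^sup>2 \<le> K\<^sup>2" using assms(4) by (simp add: d_def power_mono)
  then have d2: "4 * d\<^sup>2 \<le> r" using assms(5) by linarith
  then have "2 * d\<^sup>2 \<le> h" using r by simp
  then have dh: "d \<le> h" by (cases "d = 0") (auto simp: power2_eq_square intro: order.trans[rotated])
  have "card (halves r) = (r choose h)"
    unfolding halves_def r(1) using n_subsets[of "{..<2 * h}" h] by simp
  moreover have "card {Y \<in> halves r. Y \<inter> D = Z} = (r - d choose (h - card Z))"
    unfolding d_def using r Zd dh by (intro card_halves_pattern) (auto simp: d_def)
  ultimately have eq: "ufrac (halves r) (\<lambda>Y. Y \<inter> D = Z) = real (r - d choose (h - card Z)) / real (r choose h)"
    by (simp add: ufrac_card)
  have "(r choose h) * (h - d) ^ (card Z + (d - card Z)) \<le>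
      (r - (card Z + (d - card Z)) choose (h - card Z)) * r ^ (card Z + (d - card Z))"
    using r Zd dh by (intro binomial_pattern_lower) auto
  then have "(r choose h) * (h - d) ^ d \<le> (r - d choose (h - card Z)) * r ^ d"
    using Zd by simp
  then have "real (r choose h) * (real h - real d) ^ d \<le> real (r - d choose (h - card Z)) * real r ^ d"
    using dh by (metis of_nat_diff of_nat_le_iff of_nat_mult of_nat_power)
  moreover have "(1 / 2) ^ d / 2 * real r ^ d \<le> (real h - real d) ^ d"
  proof (cases "d = 0")
    case False
    then have rpos: "real r > 0" using d2 by (auto intro!: Nat.gr0I)
    \<comment> \<open>The choice \<open>c = h - d\<close> gives
      \<open>c / r = (1 - 2 d / r) / 2\<close>. By Bernoulli the \<open>d\<close>-th power of the
      bracket is at least \<open>1 - 2 d^2 / r\<close>, and \<open>4 d^2 \<le> r\<close> makes this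
      at least 1/2.\<close>
    have "1 / 2 \<le> 1 + real d * (- (2 * real d / real r))"
    proof -
      have "4 * (real d)\<^sup>2 \<le> real r" using d2 by (metis of_nat_le_iff of_nat_mult of_nat_numeral of_nat_power)
      then show ?thesis using rpos by (simp add: field_simps power2_eq_square)
    qed
    also have "\<dots> \<le> (1 + - (2 * real d / real r)) ^ d"
    proof (rule Bernoulli_inequality)
      have "real d \<le> real h" using dh by simp
      then show "- 1 \<le> - (2 * real d / real r)" using rpos r by (simp add: field_simps)
    qed
    finally have "(1 / 2) ^ d / 2 * real r ^ d \<le> (1 / 2) ^ d * (1 + - (2 * real d / real r)) ^ d * real r ^ d"
      using rpos by (simp add: field_simps)
    also have "\<dots> = (1 / 2 * (1 + - (2 * real d / real r)) * real r) ^ d"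
      by (simp only: power_mult_distrib)
    also have "1 / 2 * (1 + - (2 * real d / real r)) * real r = real h - real d"
      using rpos r by (simp add: field_simps)
    finally show ?thesis .
  qed simp
  moreover have "real (r choose h) > 0" using r by (simp add: zero_less_binomial)
  moreover have "real r ^ d > 0"
    using d2 by (cases "d = 0") (auto intro!: Nat.gr0I)
  ultimately have "(1 / 2) ^ d / 2 * real r ^ d * real (r choose h) \<le>
      real (r - d choose (h - card Z)) * real r ^ d"
    by (smt (verit) mult.commute mult_left_mono)
  then show ?thesis
    unfolding eq d_def[symmetric] using \<open>real (r choose h) > 0\<close> \<open>real r ^ d > 0\<close>
    by (simp add: pos_le_divide_eq mult_ac)
qed

text \<open>Sum over the patterns on \<open>D\<close>: each has probability \<open>2^-card D\<close>
  under independent bits and at least half of that under a random half. One direction suffices,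
  because only probabilities of errors are transferred.\<close>

lemma ufrac_Pow_le_halves:
  assumes r: "even r" "D \<subseteq> {..<r}" "card D \<le> K" "4 * K\<^sup>2 \<le> r"
    and dep: "\<And>Y. Y \<subseteq> {..<r} \<Longrightarrow> P Y \<longleftrightarrow> P (Y \<inter> D)"
  shows "ufrac (Pow {..<r}) P \<le> 2 * ufrac (halves r) P"
proof -
  obtain h where h: "r = 2 * h" using r(1) by (rule evenE)
  have finD: "finite D" using r finite_subset by (metis finite_lessThan)
  have "ufrac (Pow {..<r}) P = ufrac (Pow {..<r}) (\<lambda>Y. P (Y \<inter> D))"
    using dep by (intro ufrac_cong) auto
  also have "\<dots> = ufrac (Pow D) P"
    using r by (intro ufrac_Pow_Int) auto
  also have "\<dots> = (\<Sum>Z\<in>Pow D. of_bool (P Z) * (1 / 2) ^ card D)"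
    unfolding ufrac_def avg_def sum_distrib_right[symmetric]
    using finD by (simp add: card_Pow power_divide)
  also have "\<dots> \<le> (\<Sum>Z\<in>Pow D. 2 * (of_bool (P Z) * ufrac (halves r) (\<lambda>Y. Y \<inter> D = Z)))"
  proof (rule sum_mono)
    fix Z assume "Z \<in> Pow D"
    then have "(1 / 2) ^ card D / 2 \<le> ufrac (halves r) (\<lambda>Y. Y \<inter> D = Z)"
      using ufrac_halves_pattern[OF h r(2) _ r(3,4)] by simp
    then show "of_bool (P Z) * (1 / 2) ^ card D \<le> 2 * (of_bool (P Z) * ufrac (halves r) (\<lambda>Y. Y \<inter> D = Z))"
      by (cases "P Z") auto
  qed
  also have "\<dots> = 2 * avg (halves r) (\<lambda>Y. \<Sum>Z\<in>Pow D. of_bool (P Z) * of_bool (Y \<inter> D = Z))"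
    unfolding avg_sum avg_cmult ufrac_def sum_distrib_left ..
  also have "avg (halves r) (\<lambda>Y. \<Sum>Z\<in>Pow D. of_bool (P Z) * of_bool (Y \<inter> D = Z)) = ufrac (halves r) P"
    unfolding ufrac_def
  proof (intro avg_cong)
    fix Y assume "Y \<in> halves r"
    then have "P Y \<longleftrightarrow> P (Y \<inter> D)" using dep by (auto simp: halves_def)
    moreover have "(\<Sum>Z\<in>Pow D. of_bool (P Z) * of_bool (Y \<inter> D = Z)) =
        (\<Sum>Z\<in>Pow D. if Z = Y \<inter> D then of_bool (P Z) else 0 :: real)"
      by (intro sum.cong) auto
    ultimately show "(\<Sum>Z\<in>Pow D. of_bool (P Z) * of_bool (Y \<inter> D = Z) :: real) = of_bool (P Y)"
      using finD by (simp add: sum.delta)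
  qed simp
  finally show ?thesis .
qed

text \<open>Complementary to \<open>ufrac_pull\<close>: here the map is fixed and the block pattern
  is random. Variables of \<open>J\<close> lie in distinct blocks and so receive independent bits,
  but only the part inside \<open>J\<close> is uniform.\<close>

lemma ufrac_pull_inj:
  assumes "J \<subseteq> {..<n}" "inj_on \<phi> J" "\<phi> ` J \<subseteq> {..<r}"
  shows "ufrac (Pow {..<r}) (\<lambda>Y. P (pull n \<phi> Y \<inter> J)) = ufrac (Pow {..<n}) (\<lambda>X. P (X \<inter> J))"
proof -
  have finJ: "finite J" using assms finite_subset by blast
  have "ufrac (Pow {..<r}) (\<lambda>Y. P (pull n \<phi> Y \<inter> J)) =
      ufrac (Pow {..<r}) (\<lambda>Y. P {i \<in> J. \<phi> i \<in> Y \<inter> \<phi> ` J})"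
    using assms(1) by (intro ufrac_cong arg_cong[where f = P]) (auto simp: pull_def)
  also have "\<dots> = ufrac (Pow (\<phi> ` J)) (\<lambda>Y. P {i \<in> J. \<phi> i \<in> Y})"
    using assms by (intro ufrac_Pow_Int) auto
  also have "\<dots> = ufrac (Pow J) P"
    using finJ assms(2) by (rule ufrac_Pow_inj)
  also have "\<dots> = ufrac (Pow {..<n}) (\<lambda>X. P (X \<inter> J))"
    using assms by (intro ufrac_Pow_Int[symmetric]) auto
  finally show ?thesis .
qed

lemma ufrac_pull_inj2:
  assumes "J \<subseteq> {..<n}" "inj_on \<phi> J" "\<phi> ` J \<subseteq> {..<r}"
  shows "ufrac (Pow {..<r} \<times> Pow {..<r}) (\<lambda>(Y, Y'). Q (pull n \<phi> Y \<inter> J) (pull n \<phi> Y' \<inter> J)) =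
    ufrac (Pow {..<n} \<times> Pow {..<n}) (\<lambda>(X, X'). Q (X \<inter> J) (X' \<inter> J))"
proof -
  have "ufrac (Pow {..<r} \<times> Pow {..<r}) (\<lambda>(Y, Y'). Q (pull n \<phi> Y \<inter> J) (pull n \<phi> Y' \<inter> J)) =
      avg (Pow {..<r}) (\<lambda>Y. ufrac (Pow {..<n}) (\<lambda>X'. Q (pull n \<phi> Y \<inter> J) (X' \<inter> J)))"
    unfolding ufrac_times using ufrac_pull_inj[OF assms] by (intro avg_cong) auto
  also have "\<dots> = avg (Pow {..<n}) (\<lambda>X'. ufrac (Pow {..<r}) (\<lambda>Y. Q (pull n \<phi> Y \<inter> J) (X' \<inter> J)))"
    unfolding ufrac_def by (rule avg_swap)
  also have "\<dots> = avg (Pow {..<n}) (\<lambda>X'. ufrac (Pow {..<n}) (\<lambda>X. Q (X \<inter> J) (X' \<inter> J)))"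
    by (intro avg_cong ufrac_pull_inj[OF assms]) auto
  also have "\<dots> = ufrac (Pow {..<n} \<times> Pow {..<n}) (\<lambda>(X, X'). Q (X \<inter> J) (X' \<inter> J))"
    by (rule ufrac_times_swap[symmetric])
  finally show ?thesis .
qed

section \<open>Collisions of a random block map\<close>

lemma ufrac_collision:
  assumes "i < n" "j < n" "i \<noteq> j" "r > 0"
  shows "ufrac (maps n r) (\<lambda>\<phi>. \<phi> i = \<phi> j) \<le> 1 / real r"
proof -
  have one: "ufrac (maps n r) (\<lambda>\<phi>. \<phi> i = b \<and> \<phi> j = b) = (1 / real r) ^ 2" if "b < r" for b
  proof -
    have "ufrac (maps n r) (\<lambda>\<phi>. \<phi> i = b \<and> \<phi> j = b) =
        ufrac (maps n r) (\<lambda>\<phi>. \<forall>l\<in>{..<n}. l \<in> {i, j} \<longrightarrow> \<phi> l = b)"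
      using assms(1,2) by (intro ufrac_cong) blast+
    also have "\<dots> = (\<Prod>l<n. ufrac {..<r} (\<lambda>y. l \<in> {i, j} \<longrightarrow> y = b))"
      unfolding maps_def by (rule ufrac_PiE) auto
    also have "\<dots> = (\<Prod>l<n. if l \<in> {i, j} then 1 / real r else 1)"
    proof (rule prod.cong)
      fix l
      have "{x \<in> {..<r}. x = b} = {b}" using that by auto
      then have b: "ufrac {..<r} (\<lambda>y. y = b) = 1 / real r"
        by (simp only: ufrac_card finite_lessThan) simp
      have "{..<r} \<noteq> {}" using assms(4) by (simp add: lessThan_empty_iff)
      then have "ufrac {..<r} (\<lambda>y. True) = 1"
        unfolding ufrac_def by (simp add: avg_const)
      with b show "ufrac {..<r} (\<lambda>y. l \<in> {i, j} \<longrightarrow> y = b) = (if l \<in> {i, j} then 1 / real r else 1)"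
        by (cases "l \<in> {i, j}") (simp_all only: simp_thms if_True if_False)
    qed simp
    also have "\<dots> = (\<Prod>l\<in>{..<n} \<inter> {i, j}. 1 / real r)"
      by (rule prod.inter_restrict[symmetric]) simp
    also have "{..<n} \<inter> {i, j} = {i, j}" using assms by auto

    finally show ?thesis using assms by (simp add: power2_eq_square)
  qed
  have "ufrac (maps n r) (\<lambda>\<phi>. \<phi> i = \<phi> j) \<le> ufrac (maps n r) (\<lambda>\<phi>. \<exists>b\<in>{..<r}. \<phi> i = b \<and> \<phi> j = b)"
    using assms by (intro ufrac_mono) (auto simp: maps_def)
  also have "\<dots> \<le> (\<Sum>b<r. ufrac (maps n r) (\<lambda>\<phi>. \<phi> i = b \<and> \<phi> j = b))"
    by (rule ufrac_bex_le) simp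
  also have "\<dots> = (\<Sum>b<r. (1 / real r) ^ 2)"
    using one by (intro sum.cong) auto
  also have "\<dots> = 1 / real r" by (simp add: power2_eq_square)
  finally show ?thesis .
qed

lemma ufrac_not_inj:
  assumes "J \<subseteq> {..<n}" "r > 0"
  shows "ufrac (maps n r) (\<lambda>\<phi>. \<not> inj_on \<phi> J) \<le> (real (card J))\<^sup>2 / real r"
proof -
  have finJ: "finite J" using assms finite_subset by blast
  let ?I = "{(i, j) \<in> J \<times> J. i \<noteq> j}"
  have finI: "finite ?I" by (rule finite_subset[of _ "J \<times> J"]) (use finJ in auto)
  have "ufrac (maps n r) (\<lambda>\<phi>. \<not> inj_on \<phi> J) \<le> ufrac (maps n r) (\<lambda>\<phi>. \<exists>p\<in>?I. \<phi> (fst p) = \<phi> (snd p))"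
    by (intro ufrac_mono) (auto simp: inj_on_def)
  also have "\<dots> \<le> (\<Sum>p\<in>?I. ufrac (maps n r) (\<lambda>\<phi>. \<phi> (fst p) = \<phi> (snd p)))"
    using finI by (rule ufrac_bex_le)
  also have "\<dots> \<le> (\<Sum>p\<in>?I. 1 / real r)"
    using assms by (intro sum_mono ufrac_collision) auto
  also have "\<dots> = real (card ?I) / real r" by simp
  also have "\<dots> \<le> (real (card J))\<^sup>2 / real r"
  proof (intro divide_right_mono)
    have "card ?I \<le> card (J \<times> J)" using finJ by (intro card_mono) auto
    also have "\<dots> = card J * card J" by (rule card_cartesian_product)
    finally show "real (card ?I) \<le> (real (card J))\<^sup>2"
      unfolding power2_eq_square of_nat_mult[symmetric] by (rule of_nat_mono)
  qed simp
  finally show ?thesis .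
qed

section \<open>Learning by consistency with independent samples\<close>

lemma ufrac_PiE_all_le:
  assumes "finite B" "ufrac B P \<le> 1 - \<eta>"
  shows "ufrac (PiE {..<m} (\<lambda>_. B)) (\<lambda>f. \<forall>i<m. P (f i)) \<le> exp (- \<eta> * real m)"
proof -
  have "ufrac (PiE {..<m} (\<lambda>_. B)) (\<lambda>f. \<forall>i\<in>{..<m}. P (f i)) = (\<Prod>i<m. ufrac B P)"
    by (rule ufrac_PiE) (use assms in auto)
  also have "\<dots> = ufrac B P ^ m" by simp
  also have "\<dots> \<le> exp (- \<eta>) ^ m"
    using assms(2) exp_ge_add_one_self[of "- \<eta>"] ufrac_nonneg by (intro power_mono) auto
  also have "\<dots> = exp (- \<eta> * real m)"
    by (simp add: exp_of_nat_mult[symmetric] mult.commute)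
  finally show ?thesis by (simp add: Ball_def)
qed

text \<open>The usual union bound for a finite hypothesis class. The event mentions all consistent
  hypotheses, so the learner is free to choose any of them.\<close>

lemma ufrac_consistent_but_far:
  assumes "finite B" "B \<noteq> {}" "finite Hyp"
  shows "ufrac (PiE {..<M} (\<lambda>_. B)) (\<lambda>ys. \<exists>c\<in>Hyp. (\<forall>t<M. F (ys t) = v c (ys t)) \<and>
      \<eta> < ufrac B (\<lambda>Y. F Y \<noteq> v c Y)) \<le> real (card Hyp) * exp (- \<eta> * real M)"
proof -
  have "ufrac (PiE {..<M} (\<lambda>_. B)) (\<lambda>ys. \<exists>c\<in>Hyp. (\<forall>t<M. F (ys t) = v c (ys t)) \<and>
      \<eta> < ufrac B (\<lambda>Y. F Y \<noteq> v c Y)) \<le>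
    (\<Sum>c\<in>Hyp. ufrac (PiE {..<M} (\<lambda>_. B)) (\<lambda>ys. (\<forall>t<M. F (ys t) = v c (ys t)) \<and>
      \<eta> < ufrac B (\<lambda>Y. F Y \<noteq> v c Y)))"
    using assms(3) by (rule ufrac_bex_le)
  also have "\<dots> \<le> (\<Sum>c\<in>Hyp. exp (- \<eta> * real M))"
  proof (rule sum_mono)
    fix c
    show "ufrac (PiE {..<M} (\<lambda>_. B)) (\<lambda>ys. (\<forall>t<M. F (ys t) = v c (ys t)) \<and>
      \<eta> < ufrac B (\<lambda>Y. F Y \<noteq> v c Y)) \<le> exp (- \<eta> * real M)"
    proof (cases "\<eta> < ufrac B (\<lambda>Y. F Y \<noteq> v c Y)")
      case True
      then have "ufrac B (\<lambda>Y. F Y = v c Y) \<le> 1 - \<eta>"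
        using ufrac_not[OF assms(1,2), of "\<lambda>Y. F Y = v c Y"] by simp
      then show ?thesis using True ufrac_PiE_all_le[OF assms(1)] by simp
    qed (simp add: ufrac_def avg_def)
  qed
  finally show ?thesis by simp
qed

section \<open>Fourier weights and juntas\<close>

text \<open>The Walsh character of the cube indexed by \<open>U\<close>.\<close>

definition chi :: "nat set \<Rightarrow> nat set \<Rightarrow> real" where
  "chi U X = (- 1) ^ card (U \<inter> X)"

lemma sum_Pow_insert:
  assumes "finite A" "a \<notin> A"
  shows "(\<Sum>U\<in>Pow (insert a A). g U) = (\<Sum>U\<in>Pow A. g U + g (insert a U))"
proof -
  have "(\<Sum>U\<in>Pow (insert a A). g U) = (\<Sum>U\<in>Pow A. g U) + (\<Sum>U\<in>insert a ` Pow A. g U)"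
    unfolding Pow_insert using assms by (intro sum.union_disjoint) auto
  also have "(\<Sum>U\<in>insert a ` Pow A. g U) = (\<Sum>U\<in>Pow A. g (insert a U))"
    using assms by (intro sum.reindex_cong[where l = "insert a"]) (auto simp: inj_on_def)
  finally show ?thesis by (simp add: sum.distrib)
qed

text \<open>Split on the coordinate \<open>a\<close>. The coefficients at \<open>U\<close> and
  \<open>insert a U\<close> are half the sum and half the difference of the coefficients of the two
  restrictions, and the parallelogram identity adds their squares. The function is real-valued
  because the lemma is applied to conditional means.\<close>

lemma parseval:
  assumes "finite A"
  shows "avg (Pow A) (\<lambda>P. (m P)\<^sup>2) = (\<Sum>U\<in>Pow A. (avg (Pow A) (\<lambda>P. m P * chi U P))\<^sup>2)"
  using assms
proof (induction A arbitrary: m rule: finite_induct)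
  case empty
  then show ?case by (simp add: avg_def chi_def)
next
  case (insert a A)
  let ?m' = "\<lambda>P. m (insert a P)"
  let ?c = "\<lambda>m U. avg (Pow A) (\<lambda>P. m P * chi U P)"
  have c: "avg (Pow (insert a A)) (\<lambda>P. m P * chi U P) = (?c m U + ?c ?m' U) / 2"
    "avg (Pow (insert a A)) (\<lambda>P. m P * chi (insert a U) P) = (?c m U - ?c ?m' U) / 2" if "U \<in> Pow A" for U
  proof -
    have fin: "finite (U \<inter> P)" for P using that insert.hyps finite_subset by blast
    have U: "chi U (insert a P) = chi U P" "chi (insert a U) P = chi U P"
      "chi (insert a U) (insert a P) = - chi U P" if "P \<in> Pow A" for P
    proof -
      have "U \<inter> insert a P = U \<inter> P" "insert a U \<inter> P = U \<inter> P"
        "insert a U \<inter> insert a P = insert a (U \<inter> P)" "a \<notin> U \<inter> P"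
        using that \<open>U \<in> Pow A\<close> insert.hyps by auto
      then show "chi U (insert a P) = chi U P" "chi (insert a U) P = chi U P"
        "chi (insert a U) (insert a P) = - chi U P"
        using fin[of P] by (simp_all add: chi_def)
    qed
    show "avg (Pow (insert a A)) (\<lambda>P. m P * chi U P) = (?c m U + ?c ?m' U) / 2"
    proof -
      have "avg (Pow A) (\<lambda>P. ?m' P * chi U (insert a P)) = ?c ?m' U"
        using U by (intro avg_cong) auto
      then show ?thesis unfolding avg_Pow_insert[OF insert.hyps] by simp
    qed
    have "avg (Pow A) (\<lambda>P. ?m' P * chi (insert a U) (insert a P)) = avg (Pow A) (\<lambda>P. (- 1) * (?m' P * chi U P))"
      using U by (intro avg_cong) auto
    also have "\<dots> = - ?c ?m' U" unfolding avg_cmult by simp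
    finally have "avg (Pow A) (\<lambda>P. ?m' P * chi (insert a U) (insert a P)) = - ?c ?m' U" .
    moreover have "avg (Pow A) (\<lambda>P. m P * chi (insert a U) P) = ?c m U"
      using U by (intro avg_cong) auto
    ultimately show "avg (Pow (insert a A)) (\<lambda>P. m P * chi (insert a U) P) = (?c m U - ?c ?m' U) / 2"
      unfolding avg_Pow_insert[OF insert.hyps] by simp
  qed
  have "(\<Sum>U\<in>Pow (insert a A). (avg (Pow (insert a A)) (\<lambda>P. m P * chi U P))\<^sup>2) =
      (\<Sum>U\<in>Pow A. ((?c m U + ?c ?m' U) / 2)\<^sup>2 + ((?c m U - ?c ?m' U) / 2)\<^sup>2)"
    unfolding sum_Pow_insert[OF insert.hyps] by (intro sum.cong refl) (simp only: c)
  also have "\<dots> = (\<Sum>U\<in>Pow A. ((?c m U)\<^sup>2 + (?c ?m' U)\<^sup>2) / 2)"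
    by (intro sum.cong) (auto simp: power2_eq_square field_simps)
  also have "\<dots> = (avg (Pow A) (\<lambda>P. (m P)\<^sup>2) + avg (Pow A) (\<lambda>P. (?m' P)\<^sup>2)) / 2"
    by (simp add: insert.IH sum.distrib sum_divide_distrib[symmetric])
  also have "\<dots> = avg (Pow (insert a A)) (\<lambda>P. (m P)\<^sup>2)"
    by (rule avg_Pow_insert[OF insert.hyps, symmetric])
  finally show ?case ..
qed

section \<open>Resampling in terms of Fourier weight\<close>

definition sgn_of :: "(nat set \<Rightarrow> bool) \<Rightarrow> nat set \<Rightarrow> real" where
  "sgn_of f X = (if f X then 1 else - 1)"

definition weight :: "nat set \<Rightarrow> (nat set \<Rightarrow> bool) \<Rightarrow> nat set \<Rightarrow> real" where
  "weight N f U = (avg (Pow N) (\<lambda>X. sgn_of f X * chi U X))\<^sup>2"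

definition resample :: "nat set \<Rightarrow> (nat set \<Rightarrow> bool) \<Rightarrow> nat set \<Rightarrow> real" where
  "resample N f A = ufrac (Pow N \<times> Pow N) (\<lambda>(X, X'). f X \<noteq> f (mix A X X'))"

text \<open>The condition sits inside a sum over a fixed index set, so that averages over maps and
  other sums can be exchanged with it even when \<open>Q\<close> depends on the map.\<close>

definition wsum :: "nat set \<Rightarrow> (nat set \<Rightarrow> real) \<Rightarrow> (nat set \<Rightarrow> bool) \<Rightarrow> real" where
  "wsum N w Q = (\<Sum>U\<in>Pow N. if Q U then w U else 0)"

lemma weight_nonneg: "0 \<le> weight N f U"
  by (simp add: weight_def)

lemma total_weight:
  assumes "finite N"
  shows "(\<Sum>U\<in>Pow N. weight N f U) = 1"
proof -
  have "(\<Sum>U\<in>Pow N. weight N f U) = avg (Pow N) (\<lambda>X. (sgn_of f X)\<^sup>2)"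
    unfolding weight_def using parseval[OF assms] by simp
  also have "\<dots> = avg (Pow N) (\<lambda>_. 1)" by (intro avg_cong) (auto simp: sgn_of_def)
  also have "\<dots> = 1" using assms by (intro avg_const) auto
  finally show ?thesis .
qed

text \<open>Given the common part \<open>P\<close> inside \<open>A\<close>, the two points are
  independent, so the correlation is the mean square of the conditional mean \<open>m P\<close>.
  Parseval on \<open>A\<close> finishes, because the coefficients of \<open>m\<close> are those of
  \<open>f\<close> at the subsets of \<open>A\<close>.\<close>

lemma avg_mix_sgn:
  assumes "finite N" "A \<subseteq> N"
  shows "avg (Pow N \<times> Pow N) (\<lambda>(X, X'). sgn_of f X * sgn_of f (mix A X X')) = (\<Sum>U\<in>Pow A. weight N f U)"
proof -
  have finA: "finite A" using assms finite_subset by blast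
  have ne: "finite (Pow (N - A))" "Pow (N - A) \<noteq> {}" "finite (Pow A)" "Pow A \<noteq> {}"
    using assms finA by auto
  define m where "m = (\<lambda>P. avg (Pow (N - A)) (\<lambda>Q. sgn_of f (P \<union> Q)))"
  have inner: "avg (Pow N) (\<lambda>X'. sgn_of f (P \<union> Q) * sgn_of f (mix A (P \<union> Q) X')) = sgn_of f (P \<union> Q) * m P"
    if "P \<in> Pow A" "Q \<in> Pow (N - A)" for P Q
  proof -
    have "avg (Pow N) (\<lambda>X'. sgn_of f (mix A (P \<union> Q) X')) =
        avg (Pow A) (\<lambda>P'. avg (Pow (N - A)) (\<lambda>Q'. sgn_of f (mix A (P \<union> Q) (P' \<union> Q'))))"
      by (rule avg_Pow_split) fact
    also have "\<dots> = avg (Pow A) (\<lambda>P'. m P)"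
      unfolding m_def using that
      by (intro avg_cong arg_cong[where f = "sgn_of f"]) (auto simp: mix_def)
    also have "\<dots> = m P" using ne by (simp add: avg_const)
    finally show ?thesis by (simp add: avg_cmult)
  qed
  have "avg (Pow N \<times> Pow N) (\<lambda>(X, X'). sgn_of f X * sgn_of f (mix A X X')) =
      avg (Pow A) (\<lambda>P. avg (Pow (N - A)) (\<lambda>Q. avg (Pow N) (\<lambda>X'. sgn_of f (P \<union> Q) * sgn_of f (mix A (P \<union> Q) X'))))"
    unfolding avg_times by (rule avg_Pow_split) fact
  also have "\<dots> = avg (Pow A) (\<lambda>P. avg (Pow (N - A)) (\<lambda>Q. sgn_of f (P \<union> Q) * m P))"
    using inner by (intro avg_cong) auto
  also have "\<dots> = avg (Pow A) (\<lambda>P. (m P)\<^sup>2)"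
    unfolding avg_multc m_def[symmetric] by (simp add: power2_eq_square m_def)
  also have "\<dots> = (\<Sum>U\<in>Pow A. (avg (Pow A) (\<lambda>P. m P * chi U P))\<^sup>2)"
    using finA by (rule parseval)
  also have "\<dots> = (\<Sum>U\<in>Pow A. weight N f U)"
  proof (rule sum.cong)
    fix U assume U: "U \<in> Pow A"
    have "avg (Pow N) (\<lambda>X. sgn_of f X * chi U X) =
        avg (Pow A) (\<lambda>P. avg (Pow (N - A)) (\<lambda>Q. sgn_of f (P \<union> Q) * chi U (P \<union> Q)))"
      by (rule avg_Pow_split) fact
    also have "\<dots> = avg (Pow A) (\<lambda>P. avg (Pow (N - A)) (\<lambda>Q. sgn_of f (P \<union> Q) * chi U P))"
    proof (intro avg_cong refl)
      fix P Q assume "P \<in> Pow A" "Q \<in> Pow (N - A)"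
      then have "U \<inter> (P \<union> Q) = U \<inter> P" using U by auto
      then show "sgn_of f (P \<union> Q) * chi U (P \<union> Q) = sgn_of f (P \<union> Q) * chi U P"
        by (simp add: chi_def)
    qed
    also have "\<dots> = avg (Pow A) (\<lambda>P. m P * chi U P)"
      unfolding avg_multc m_def ..
    finally show "(avg (Pow A) (\<lambda>P. m P * chi U P))\<^sup>2 = weight N f U"
      by (simp add: weight_def)
  qed simp
  finally show ?thesis .
qed

text \<open>The product of the signs is 1 minus twice the indicator of disagreement. The point is
  that resampling becomes a nonnegative measure on sets \<open>U\<close>, on which covering by
  blocks is plain combinatorics.\<close>

lemma resample_weight:
  assumes "finite N" "A \<subseteq> N"
  shows "resample N f A = wsum N (weight N f) (\<lambda>U. \<not> U \<subseteq> A) / 2"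
proof -
  have ne: "finite (Pow N \<times> Pow N)" "Pow N \<times> Pow N \<noteq> {}" using assms by auto
  have "resample N f A = avg (Pow N \<times> Pow N) (\<lambda>p. (1 - (\<lambda>(X, X'). sgn_of f X * sgn_of f (mix A X X')) p) * (1 / 2))"
    unfolding resample_def ufrac_def by (intro avg_cong) (auto simp: sgn_of_def split: if_splits)
  also have "\<dots> = (1 - (\<Sum>U\<in>Pow A. weight N f U)) / 2"
    unfolding avg_multc avg_diff avg_const[OF ne] avg_mix_sgn[OF assms] by simp
  also have "1 - (\<Sum>U\<in>Pow A. weight N f U) = (\<Sum>U\<in>Pow N - Pow A. weight N f U)"
    using assms total_weight[of N f] by (subst sum_diff) auto
  also have "\<dots> = wsum N (weight N f) (\<lambda>U. \<not> U \<subseteq> A)"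
    unfolding wsum_def using assms by (intro sum.mono_neutral_cong_left) auto
  finally show ?thesis .
qed

lemma wsum_mono:
  assumes "\<And>U. 0 \<le> w U" "\<And>U. U \<in> Pow N \<Longrightarrow> Q U \<Longrightarrow> R U"
  shows "wsum N w Q \<le> wsum N w R"
  unfolding wsum_def using assms by (intro sum_mono) auto

lemma wsum_le_add:
  assumes "\<And>U. 0 \<le> w U" "\<And>U. U \<in> Pow N \<Longrightarrow> Q U \<Longrightarrow> R U \<or> T U"
  shows "wsum N w Q \<le> wsum N w R + wsum N w T"
  unfolding wsum_def sum.distrib[symmetric] using assms by (intro sum_mono) (auto simp: add_increasing)

lemma wsum_nonneg: "(\<And>U. 0 \<le> w U) \<Longrightarrow> 0 \<le> wsum N w Q"
  unfolding wsum_def by (intro sum_nonneg) auto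

text \<open>Freeze the part outside \<open>J\<close> to a value \<open>X'\<close> that does no worse
  than average.\<close>

lemma junta_of_resample:
  assumes "finite N" "resample N f J \<le> \<iota>"
  shows "\<exists>g. (\<forall>X. g X = g (X \<inter> J)) \<and> ufrac (Pow N) (\<lambda>X. f X \<noteq> g X) \<le> \<iota>"
proof -
  have "\<exists>X'\<in>Pow N. ufrac (Pow N) (\<lambda>X. f X \<noteq> f (mix J X X')) \<le>
      avg (Pow N) (\<lambda>X'. ufrac (Pow N) (\<lambda>X. f X \<noteq> f (mix J X X')))"
    by (rule exists_le_avg) (use assms in auto)
  moreover have "avg (Pow N) (\<lambda>X'. ufrac (Pow N) (\<lambda>X. f X \<noteq> f (mix J X X'))) = resample N f J"
    unfolding resample_def by (rule ufrac_times_swap[symmetric])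
  ultimately obtain X' where "ufrac (Pow N) (\<lambda>X. f X \<noteq> f (mix J X X')) \<le> \<iota>"
    using assms(2) by (metis order.trans)
  moreover have "mix J (X \<inter> J) X' = mix J X X'" for X by (auto simp: mix_def)
  ultimately show ?thesis by (intro exI[of _ "\<lambda>X. f (mix J X X')"]) simp
qed

text \<open>Three properties of a random map fail with probability at most 1/50 each, so some map
  with good blocks \<open>S\<close> has them all. For this map the heavy variables of
  \<open>A = pull n \<phi> S\<close> lie in distinct blocks of \<open>S\<close>, so there are at
  most \<open>k\<close> of them; they form \<open>J\<close>. The loss is \<open>2 \<eta>\<close>
  outside \<open>A\<close>, \<open>4 \<eta>\<close> for sets of more than \<open>k\<close> elements
  and \<open>\<eta>\<close> for light variables in \<open>A\<close>.\<close>

lemma weight_concentrated: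
  fixes w :: "nat set \<Rightarrow> real" and \<eta> :: real
  assumes w: "\<And>U. 0 \<le> w U" "(\<Sum>U\<in>Pow {..<n}. w U) \<le> 1"
    and k: "k \<ge> 1" and \<eta>: "\<eta> > 0"
    and \<theta>: "\<theta> > 0" "100 * real k ^ 2 * \<theta> \<le> \<eta>\<^sup>2"
    and r: "r > 0" "100 * (real k + 1)\<^sup>2 \<le> real r" "50 * real k ^ 2 \<le> \<theta>\<^sup>2 * real r" "100 * real k ^ 3 \<le> \<eta>\<^sup>2 * real r"
    and freq: "1 / 10 \<le> ufrac (maps n r) (\<lambda>\<phi>. \<exists>S. finite S \<and> card S \<le> k \<and>
      wsum {..<n} w (\<lambda>U. \<not> U \<subseteq> pull n \<phi> S) \<le> 2 * \<eta>)"
  shows "\<exists>J\<subseteq>{..<n}. card J \<le> k \<and> wsum {..<n} w (\<lambda>U. \<not> U \<subseteq> J) \<le> 7 * \<eta>"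
proof -
  let ?N = "{..<n}"
  let ?W = "wsum ?N w"
  define \<beta> where "\<beta> = ?W (\<lambda>U. k < card U)"
  define g0 where "g0 = (\<lambda>\<phi> :: nat \<Rightarrow> nat. ?W (\<lambda>U. k < card U \<and> card (\<phi> ` U) \<le> k))"
  \<comment> \<open>Counting only sets of at most \<open>k\<close> elements keeps the total of
    \<open>q\<close> at most \<open>k\<close>, so at most \<open>k / \<theta>\<close> variables are
    heavy.\<close>
  define q where "q = (\<lambda>i. ?W (\<lambda>U. card U \<le> k \<and> i \<in> U))"
  define J0 where "J0 = {i \<in> ?N. \<theta> \<le> q i}"
  define Q where "Q = (\<lambda>\<phi> :: nat \<Rightarrow> nat. \<lambda>b. \<Sum>i\<in>?N - J0. if \<phi> i = b then q i else 0)"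
  \<comment> \<open>\<open>Q \<phi> b\<close> is the total influence of the light variables in block \<open>b\<close>; a small second moment
    \<open>g2\<close> shows that no \<open>k\<close> blocks together hold much of it.\<close>
  define g2 where "g2 = (\<lambda>\<phi>. \<Sum>b<r. (Q \<phi> b)\<^sup>2)"
  define T where "T = 50 * (\<theta> * real k + real k ^ 2 / real r)"
  have q_nonneg: "0 \<le> q i" for i unfolding q_def by (intro wsum_nonneg w)
  have \<beta>_nonneg: "0 \<le> \<beta>" unfolding \<beta>_def by (intro wsum_nonneg w)
  have maps_ne: "finite (maps n r)" "maps n r \<noteq> {}" using r(1) by auto
  have sum_q: "(\<Sum>i\<in>?N. q i) \<le> real k"
  proof -
    have "(\<Sum>i\<in>?N. q i) = (\<Sum>U\<in>Pow ?N. \<Sum>i\<in>?N. if card U \<le> k \<and> i \<in> U then w U else 0)"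
      unfolding q_def wsum_def by (rule sum.swap)
    also have "\<dots> \<le> (\<Sum>U\<in>Pow ?N. real k * w U)"
    proof (rule sum_mono)
      fix U assume U: "U \<in> Pow ?N"
      show "(\<Sum>i\<in>?N. if card U \<le> k \<and> i \<in> U then w U else 0) \<le> real k * w U"
      proof (cases "card U \<le> k")
        case True
        have "(\<Sum>i\<in>?N. if card U \<le> k \<and> i \<in> U then w U else 0) = (\<Sum>i\<in>U. w U)"
          using U True by (intro sum.mono_neutral_cong_right) auto
        also have "\<dots> \<le> real k * w U" using True w(1)[of U] by (simp add: mult_right_mono)
        finally show ?thesis .
      qed (use w(1)[of U] in simp)
    qed
    also have "\<dots> = real k * (\<Sum>U\<in>Pow ?N. w U)" by (rule sum_distrib_left[symmetric])
    also have "\<dots> \<le> real k" using w(2) mult_left_mono[of "\<Sum>U\<in>Pow ?N. w U" 1 "real k"] by simp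
    finally show ?thesis .
  qed
  have sum_q': "(\<Sum>i\<in>?N - J0. q i) \<le> real k"
    using sum_q sum_mono2[of ?N "?N - J0" q] q_nonneg by force
  \<comment> \<open>A set of more than \<open>k\<close> elements has \<open>k + 1\<close> elements
    with distinct blocks with probability at least 99/100, so the mean of \<open>g0\<close> is at
    most \<open>\<beta> / 100\<close>. The case \<open>\<beta> = 0\<close> is separate since Markov
    needs a positive threshold.\<close>
  have bad0: "ufrac (maps n r) (\<lambda>\<phi>. \<beta> / 2 < g0 \<phi>) \<le> 1 / 50"
  proof (cases "\<beta> = 0")
    case True
    have "g0 \<phi> \<le> \<beta>" for \<phi> unfolding g0_def \<beta>_def by (intro wsum_mono w) auto
    then have "\<not> \<beta> / 2 < g0 \<phi>" for \<phi> using True by (simp add: not_less)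
    then show ?thesis by (simp add: ufrac_def avg_def)
  next
    case False
    show ?thesis
    proof (rule markov)
      have "avg (maps n r) g0 = (\<Sum>U\<in>Pow ?N. avg (maps n r) (\<lambda>\<phi>. if k < card U \<and> card (\<phi> ` U) \<le> k then w U else 0))"
        unfolding g0_def wsum_def by (rule avg_sum)
      also have "\<dots> \<le> (\<Sum>U\<in>Pow ?N. 1 / 100 * (if k < card U then w U else 0))"
      proof (rule sum_mono)
        fix U assume U: "U \<in> Pow ?N"
        show "avg (maps n r) (\<lambda>\<phi>. if k < card U \<and> card (\<phi> ` U) \<le> k then w U else 0) \<le>
            1 / 100 * (if k < card U then w U else 0)"
        proof (cases "k < card U")
          case True
          then obtain U' where U': "U' \<subseteq> U" "card U' = k + 1" "finite U'"
            using obtain_subset_with_card_n[of "k + 1" U] by auto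
          have "ufrac (maps n r) (\<lambda>\<phi>. card (\<phi> ` U) \<le> k) \<le> ufrac (maps n r) (\<lambda>\<phi>. \<not> inj_on \<phi> U')"
          proof (rule ufrac_mono, rule notI)
            fix \<phi> assume "card (\<phi> ` U) \<le> k" "inj_on \<phi> U'"
            moreover have "card (\<phi> ` U') \<le> card (\<phi> ` U)"
              using U U' by (intro card_mono finite_imageI image_mono) (auto intro: finite_subset)
            ultimately show False using U' by (simp add: card_image)
          qed
          also have "\<dots> \<le> (real (card U'))\<^sup>2 / real r"
            using U U' r(1) by (intro ufrac_not_inj) auto
          also have "\<dots> \<le> 1 / 100"
            using r(1,2) U'(2) by (simp add: pos_divide_le_eq add.commute)
          finally have "ufrac (maps n r) (\<lambda>\<phi>. card (\<phi> ` U) \<le> k) * w U \<le> 1 / 100 * w U"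
            using w(1) by (rule mult_right_mono)
          moreover have "avg (maps n r) (\<lambda>\<phi>. if k < card U \<and> card (\<phi> ` U) \<le> k then w U else 0) =
              ufrac (maps n r) (\<lambda>\<phi>. card (\<phi> ` U) \<le> k) * w U"
            unfolding ufrac_def avg_multc[symmetric] using True by (intro avg_cong) auto
          ultimately show ?thesis using True by simp
        qed (simp add: avg_def)
      qed
      also have "\<dots> = \<beta> / 2 * (1 / 50)"
        unfolding sum_distrib_left[symmetric] \<beta>_def wsum_def by simp
      finally show "avg (maps n r) g0 \<le> \<beta> / 2 * (1 / 50)" .
      show "0 \<le> g0 \<phi>" for \<phi> unfolding g0_def by (intro wsum_nonneg w)
    qed (use False \<beta>_nonneg in auto)
  qed
  have bad1: "ufrac (maps n r) (\<lambda>\<phi>. \<not> inj_on \<phi> J0) \<le> 1 / 50"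
  proof -
    have "\<theta> * real (card J0) = (\<Sum>i\<in>J0. \<theta>)" by simp
    also have "\<dots> \<le> (\<Sum>i\<in>J0. q i)" by (rule sum_mono) (simp add: J0_def)
    also have "\<dots> \<le> (\<Sum>i\<in>?N. q i)" using q_nonneg by (intro sum_mono2) (auto simp: J0_def)
    finally have "\<theta> * real (card J0) \<le> real k" using sum_q by simp
    then have "(\<theta> * real (card J0))\<^sup>2 \<le> (real k)\<^sup>2" using \<theta>(1) by (intro power_mono) auto
    then have "50 * (\<theta>\<^sup>2 * (real (card J0))\<^sup>2) \<le> \<theta>\<^sup>2 * real r"
      using r(3) by (simp add: power_mult_distrib)
    then have "\<theta>\<^sup>2 * (50 * (real (card J0))\<^sup>2) \<le> \<theta>\<^sup>2 * real r" by (simp add: mult_ac)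
    then have "50 * (real (card J0))\<^sup>2 \<le> real r" using \<theta>(1) by simp
    then have "(real (card J0))\<^sup>2 / real r \<le> 1 / 50" using r(1) by (simp add: field_simps)
    moreover have "ufrac (maps n r) (\<lambda>\<phi>. \<not> inj_on \<phi> J0) \<le> (real (card J0))\<^sup>2 / real r"
      using r(1) by (intro ufrac_not_inj) (auto simp: J0_def)
    ultimately show ?thesis by linarith
  qed
  have T_pos: "T > 0" using \<theta> k r(1) by (auto simp: T_def intro!: add_pos_nonneg)
  \<comment> \<open>\<open>T\<close> is 50 times a bound on the mean of \<open>g2\<close>: equal
    indices contribute at most \<open>\<theta> k\<close> because light variables have
    \<open>q i < \<theta>\<close>, and distinct ones collide with probability at most
    \<open>1 / r\<close>, contributing at most \<open>k^2 / r\<close>.\<close>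
  have bad2: "ufrac (maps n r) (\<lambda>\<phi>. T < g2 \<phi>) \<le> 1 / 50"
  proof (rule markov)
    have "avg (maps n r) g2 =
        avg (maps n r) (\<lambda>\<phi>. \<Sum>i\<in>?N - J0. \<Sum>j\<in>?N - J0. q i * q j * of_bool (\<phi> i = \<phi> j))"
    proof (rule avg_cong)
      fix \<phi> assume \<phi>: "\<phi> \<in> maps n r"
      have "g2 \<phi> = (\<Sum>b<r. \<Sum>i\<in>?N - J0. \<Sum>j\<in>?N - J0. (if \<phi> i = b then q i else 0) * (if \<phi> j = b then q j else 0))"
        unfolding g2_def Q_def power2_eq_square by (simp add: sum_product)
      also have "\<dots> = (\<Sum>i\<in>?N - J0. \<Sum>b<r. \<Sum>j\<in>?N - J0. (if \<phi> i = b then q i else 0) * (if \<phi> j = b then q j else 0))"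
        by (rule sum.swap)
      also have "\<dots> = (\<Sum>i\<in>?N - J0. \<Sum>j\<in>?N - J0. \<Sum>b<r. (if \<phi> i = b then q i else 0) * (if \<phi> j = b then q j else 0))"
        by (intro sum.cong refl sum.swap)
      also have "\<dots> = (\<Sum>i\<in>?N - J0. \<Sum>j\<in>?N - J0. q i * q j * of_bool (\<phi> i = \<phi> j))"
      proof (intro sum.cong refl)
        fix i j assume "i \<in> ?N - J0"
        then have i: "\<phi> i < r" using \<phi> by (auto simp: maps_def PiE_iff)
        have "(\<Sum>b<r. (if \<phi> i = b then q i else 0) * (if \<phi> j = b then q j else 0)) =
            (\<Sum>b<r. if b = \<phi> i then q i * (if \<phi> j = \<phi> i then q j else 0) else 0)"
          by (intro sum.cong) auto
        then show "(\<Sum>b<r. (if \<phi> i = b then q i else 0) * (if \<phi> j = b then q j else 0)) =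
            q i * q j * of_bool (\<phi> i = \<phi> j)"
          using i by (simp add: sum.delta)
      qed
      finally show "g2 \<phi> = (\<Sum>i\<in>?N - J0. \<Sum>j\<in>?N - J0. q i * q j * of_bool (\<phi> i = \<phi> j))" .
    qed simp
    also have "\<dots> = (\<Sum>i\<in>?N - J0. \<Sum>j\<in>?N - J0. q i * q j * ufrac (maps n r) (\<lambda>\<phi>. \<phi> i = \<phi> j))"
      unfolding avg_sum avg_cmult ufrac_def ..
    also have "\<dots> \<le> (\<Sum>i\<in>?N - J0. \<Sum>j\<in>?N - J0. (if j = i then \<theta> * q i else 0) + q i * q j / real r)"
    proof (intro sum_mono)
      fix i j assume ij: "i \<in> ?N - J0" "j \<in> ?N - J0"
      show "q i * q j * ufrac (maps n r) (\<lambda>\<phi>. \<phi> i = \<phi> j) \<le>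
          (if j = i then \<theta> * q i else 0) + q i * q j / real r"
      proof (cases "i = j")
        case True
        have "q i \<le> \<theta>" using ij by (auto simp: J0_def)
        then have "q i * q i \<le> \<theta> * q i" using q_nonneg by (intro mult_right_mono) auto
        moreover have "0 \<le> q i * q i / real r" by simp
        moreover have "q i * q i * ufrac (maps n r) (\<lambda>\<phi>. True) \<le> q i * q i"
          using ufrac_le_1[OF maps_ne, of "\<lambda>_. True"] q_nonneg[of i] by (simp add: mult_left_le)
        ultimately have "q i * q i * ufrac (maps n r) (\<lambda>\<phi>. True) \<le> \<theta> * q i + q i * q i / real r"
          by linarith
        then show ?thesis using True by simp
      next
        case False
        then have "q i * q j * ufrac (maps n r) (\<lambda>\<phi>. \<phi> i = \<phi> j) \<le> q i * q j * (1 / real r)"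
          using ij q_nonneg r(1) by (intro mult_left_mono ufrac_collision) auto
        then show ?thesis using False by simp
      qed
    qed
    also have "\<dots> = \<theta> * (\<Sum>i\<in>?N - J0. q i) + (\<Sum>i\<in>?N - J0. q i) * (\<Sum>i\<in>?N - J0. q i) / real r"
      unfolding sum_product sum_divide_distrib by (simp add: sum.distrib sum_distrib_left)
    also have "\<dots> \<le> \<theta> * real k + real k * real k / real r"
      using sum_q' \<theta>(1) q_nonneg by (intro add_mono mult_left_mono divide_right_mono mult_mono) (auto intro: sum_nonneg)
    also have "\<dots> = T * (1 / 50)" by (simp add: T_def power2_eq_square)
    finally show "avg (maps n r) g2 \<le> T * (1 / 50)" .
    show "0 \<le> g2 \<phi>" for \<phi> unfolding g2_def by (intro sum_nonneg) auto
  qed (use T_pos in auto)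
  have "\<exists>\<phi>\<in>maps n r. (\<exists>S. finite S \<and> card S \<le> k \<and> ?W (\<lambda>U. \<not> U \<subseteq> pull n \<phi> S) \<le> 2 * \<eta>) \<and>
      g0 \<phi> \<le> \<beta> / 2 \<and> inj_on \<phi> J0 \<and> g2 \<phi> \<le> T"
  proof (rule ccontr)
    assume none: "\<not> ?thesis"
    have "1 / 10 \<le> ufrac (maps n r) (\<lambda>\<phi>. \<beta> / 2 < g0 \<phi>) +
        ufrac (maps n r) (\<lambda>\<phi>. \<not> inj_on \<phi> J0 \<or> T < g2 \<phi>)"
      by (rule order.trans[OF freq], rule ufrac_le_add) (use none in \<open>meson not_le\<close>)
    also have "\<dots> \<le> ufrac (maps n r) (\<lambda>\<phi>. \<beta> / 2 < g0 \<phi>) +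
        (ufrac (maps n r) (\<lambda>\<phi>. \<not> inj_on \<phi> J0) + ufrac (maps n r) (\<lambda>\<phi>. T < g2 \<phi>))"
      by (intro add_left_mono ufrac_le_add) auto
    finally show False using bad0 bad1 bad2 by simp
  qed
  then obtain \<phi> S where \<phi>: "\<phi> \<in> maps n r" "g0 \<phi> \<le> \<beta> / 2" "inj_on \<phi> J0" "g2 \<phi> \<le> T"
    and S: "finite S" "card S \<le> k" "?W (\<lambda>U. \<not> U \<subseteq> pull n \<phi> S) \<le> 2 * \<eta>"
    by blast
  define A where "A = pull n \<phi> S"
  have img: "card (\<phi> ` U) \<le> k" if "U \<subseteq> A" for U
  proof -
    have "card (\<phi> ` U) \<le> card S"
      using that S by (intro card_mono) (auto simp: A_def pull_def)
    then show ?thesis using S by simp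
  qed
  \<comment> \<open>A large set inside \<open>A\<close> has its image in the at most
    \<open>k\<close> blocks of \<open>S\<close> and is counted by \<open>g0\<close>. Hence
    \<open>\<beta> \<le> 2 \<eta> + \<beta> / 2\<close>.\<close>
  have "\<beta> \<le> ?W (\<lambda>U. \<not> U \<subseteq> A) + g0 \<phi>"
    unfolding \<beta>_def g0_def by (intro wsum_le_add w) (use img in blast)
  then have \<beta>: "\<beta> \<le> 4 * \<eta>" using \<phi>(2) S(3) by (simp add: A_def)
  define J where "J = J0 \<inter> A"
  have "card J \<le> k"
  proof -
    have "card J = card (\<phi> ` J)"
      using \<phi>(3) by (intro card_image[symmetric]) (auto simp: J_def inj_on_def)
    also have "\<dots> \<le> k" by (rule img) (simp add: J_def)
    finally show ?thesis .
  qed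
  have light: "(\<Sum>i\<in>A - J0. q i) \<le> \<eta>"
  proof -
    let ?S = "S \<inter> {..<r}"
    have AN: "A \<subseteq> ?N" by (simp add: A_def pull_subset)
    have "(\<Sum>i\<in>A - J0. q i) = (\<Sum>i\<in>?N - J0. \<Sum>b\<in>?S. if \<phi> i = b then q i else 0)"
    proof (rule sum.mono_neutral_cong_left)
      show "\<forall>i\<in>?N - J0 - (A - J0). (\<Sum>b\<in>?S. if \<phi> i = b then q i else 0) = 0"
        by (intro ballI sum.neutral) (auto simp: A_def pull_def)
      fix i assume "i \<in> A - J0"
      then have "\<phi> i \<in> ?S" using \<phi>(1) by (auto simp: A_def pull_def maps_def PiE_iff)
      then show "q i = (\<Sum>b\<in>?S. if \<phi> i = b then q i else 0)" using S(1) by (simp add: sum.delta')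
    qed (use AN in auto)
    also have "\<dots> = (\<Sum>b\<in>?S. Q \<phi> b * 1)"
      unfolding Q_def mult_1_right by (rule sum.swap)
    finally have "(\<Sum>i\<in>A - J0. q i)\<^sup>2 = (\<Sum>b\<in>?S. Q \<phi> b * 1)\<^sup>2" by simp
    \<comment> \<open>Cauchy-Schwarz over at most \<open>k\<close> blocks holds for every choice of
      \<open>S\<close>, so no union bound over the choices of blocks is needed.\<close>
    also have "\<dots> \<le> (\<Sum>b\<in>?S. (Q \<phi> b)\<^sup>2) * (\<Sum>b\<in>?S. 1\<^sup>2)"
      by (rule Cauchy_Schwarz_ineq_sum)
    also have "\<dots> \<le> g2 \<phi> * real k"
    proof (rule mult_mono)
      show "(\<Sum>b\<in>?S. (Q \<phi> b)\<^sup>2) \<le> g2 \<phi>" unfolding g2_def by (intro sum_mono2) auto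
      have "card ?S \<le> card S" using S by (intro card_mono) auto
      then show "(\<Sum>b\<in>?S. 1\<^sup>2) \<le> real k" using S by simp
    qed (auto simp: g2_def intro: sum_nonneg)
    also have "\<dots> \<le> T * real k" using \<phi>(4) by (intro mult_right_mono) auto
    also have "\<dots> = 50 * real k ^ 2 * \<theta> + 50 * real k ^ 3 / real r"
      by (simp add: T_def power2_eq_square power3_eq_cube algebra_simps)
    also have "\<dots> \<le> \<eta>\<^sup>2 / 2 + \<eta>\<^sup>2 / 2"
      using \<theta>(2) r(1,4) by (intro add_mono) (auto simp: field_simps)
    finally have "(\<Sum>i\<in>A - J0. q i)\<^sup>2 \<le> \<eta>\<^sup>2" by simp
    then show ?thesis using \<eta> by (auto intro: power2_le_imp_le)
  qed
  have "?W (\<lambda>U. \<not> U \<subseteq> J) \<le> ?W (\<lambda>U. \<not> U \<subseteq> A) + ?W (\<lambda>U. k < card U \<or> card U \<le> k \<and> \<not> U \<subseteq> J \<and> U \<subseteq> A)"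
    by (intro wsum_le_add w) auto
  also have "\<dots> \<le> ?W (\<lambda>U. \<not> U \<subseteq> A) + (\<beta> + ?W (\<lambda>U. card U \<le> k \<and> \<not> U \<subseteq> J \<and> U \<subseteq> A))"
    unfolding \<beta>_def by (intro add_left_mono wsum_le_add w) auto
  also have "?W (\<lambda>U. card U \<le> k \<and> \<not> U \<subseteq> J \<and> U \<subseteq> A) \<le> (\<Sum>i\<in>A - J0. q i)"
  proof -
    have finA: "finite (A - J0)" by (rule finite_subset[of _ ?N]) (auto simp: A_def pull_def)
    have "?W (\<lambda>U. card U \<le> k \<and> \<not> U \<subseteq> J \<and> U \<subseteq> A) \<le>
        (\<Sum>U\<in>Pow ?N. \<Sum>i\<in>A - J0. if card U \<le> k \<and> i \<in> U then w U else 0)"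
      unfolding wsum_def
    proof (rule sum_mono)
      fix U
      show "(if card U \<le> k \<and> \<not> U \<subseteq> J \<and> U \<subseteq> A then w U else 0) \<le>
          (\<Sum>i\<in>A - J0. if card U \<le> k \<and> i \<in> U then w U else 0)"
      proof (cases "card U \<le> k \<and> \<not> U \<subseteq> J \<and> U \<subseteq> A")
        case True
        then obtain i where i: "i \<in> U" "i \<in> A - J0" by (auto simp: J_def)
        have "(if card U \<le> k \<and> i \<in> U then w U else 0) \<le> (\<Sum>i\<in>A - J0. if card U \<le> k \<and> i \<in> U then w U else 0)"
          using i finA w(1) by (intro member_le_sum) auto
        then show ?thesis using True i by simp
      next
        case False
        then show ?thesis using w(1)[of U] by (auto intro!: sum_nonneg)
      qed
    qed
    also have "\<dots> = (\<Sum>i\<in>A - J0. q i)"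
      unfolding q_def wsum_def by (rule sum.swap)
    finally show ?thesis .
  qed
  finally have "?W (\<lambda>U. \<not> U \<subseteq> J) \<le> 7 * \<eta>"
    using \<beta> S(3) light by (simp add: A_def)
  moreover have "J \<subseteq> ?N" by (auto simp: J_def J0_def)
  ultimately show ?thesis using \<open>card J \<le> k\<close> by blast
qed

section \<open>The tester\<close>

primrec ask :: "'q list \<Rightarrow> (bool list \<Rightarrow> 'q decision_tree) \<Rightarrow> 'q decision_tree" where
  "ask [] c = c []"
| "ask (q # qs) c = Query q (\<lambda>b. ask qs (\<lambda>bs. c (b # bs)))"

lemma run_ask [simp]: "run f (ask qs c) = run f (c (map f qs))"
  by (induction qs arbitrary: c) auto

lemma num_queries_ask [simp]:
  "num_queries f (ask qs c) = length qs + num_queries f (c (map f qs))"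
  by (induction qs arbitrary: c) auto

lemma queried_ask: "queried (ask qs c) \<subseteq> set qs \<union> (\<Union>bs. queried (c bs))"
proof (induction qs arbitrary: c)
  case (Cons q qs)
  have "queried (ask qs (\<lambda>bs. c (b # bs))) \<subseteq> set (q # qs) \<union> (\<Union>bs. queried (c bs))" for b
    using Cons.IH[of "\<lambda>bs. c (b # bs)"] by auto
  then show ?case by auto
qed auto

lemma pull_pull: "(\<And>j. \<pi> j < n) \<Longrightarrow> pull k \<pi> (pull n \<phi> Y) = pull k (\<phi> \<circ> \<pi>) Y"
  by (auto simp: pull_def)

lemma map_mem_eq_bits_pull: "map (\<lambda>j. \<pi> j \<in> X) [0..<k] = bits k (pull k \<pi> X)"
  by (auto simp: bits_def pull_def)

text \<open>A hypothesis assigns a block to each of the \<open>k\<close> inputs of a circuit,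
  repetitions allowed. Its value is determined by the block pattern alone, without the map or the
  variables.\<close>

definition hval :: "nat \<Rightarrow> (nat \<Rightarrow> nat) \<times> (bool list \<Rightarrow> bool) \<Rightarrow> nat set \<Rightarrow> bool" where
  "hval k c Y = snd c (bits k (pull k (fst c) Y))"

lemma hval_cong: "Y \<inter> fst c ` {..<k} = Y' \<inter> fst c ` {..<k} \<Longrightarrow> hval k c Y = hval k c Y'"
proof -
  assume "Y \<inter> fst c ` {..<k} = Y' \<inter> fst c ` {..<k}"
  then have "pull k (fst c) Y = pull k (fst c) Y'" by (auto simp: pull_def)
  then show ?thesis by (simp add: hval_def)
qed

lemma ufrac_disj: "ufrac S (\<lambda>x. P x \<or> Q x) \<le> ufrac S P + ufrac S Q"
  by (rule ufrac_le_add)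

text \<open>\<open>\<eta>\<close> is the unit of error for soundness and \<open>\<eta>'\<close> the
  accuracy of learning. \<open>M\<close> is the sample size for a union bound over the hypotheses,
  \<open>m\<close> the number of resampling checks. The first bound on \<open>m\<close> makes them
  detect influence above \<open>\<eta>\<close>, the second makes an accurate hypothesis survive all
  of them. \<open>few\<close> is a union bound over all queries: each is uniform, so a circuit and
  its narrow approximation give the same answers.\<close>

locale circuit_tester =
  fixes n s L k r M m :: nat and \<epsilon> \<eta> \<eta>' \<theta> :: real
  assumes n: "n \<ge> 1" and s: "s \<ge> 1" and L: "L \<ge> 1" and k_def: "k = s * L + 1"
    and \<eta>: "\<eta> > 0" "\<epsilon> = 100 * \<eta>" "0 < \<eta>'" "\<eta>' \<le> \<eta>"
    and r: "even r" "100 * (real k + 1)\<^sup>2 \<le> real r"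
    and \<theta>: "\<theta> > 0" "100 * real k ^ 2 * \<theta> \<le> \<eta>\<^sup>2" "50 * real k ^ 2 \<le> \<theta>\<^sup>2 * real r" "100 * real k ^ 3 \<le> \<eta>\<^sup>2 * real r"
    and M: "real (card (maps k r \<times> (\<lambda>h. restrict h (cube k)) ` circuit_class k s)) * exp (- \<eta>' * real M) \<le> 1 / 20"
    and m: "exp (- \<eta> * real m) \<le> 1 / 20" "real m * (4 * \<eta>') \<le> 1 / 20"
    and few: "(real M + 2 * real m) * (real s / 2 ^ L) \<le> 1 / 20"
begin

abbreviation "N \<equiv> {..<n}"

abbreviation "Pairs \<equiv> Pow N \<times> Pow N"

definition hyps :: "((nat \<Rightarrow> nat) \<times> (bool list \<Rightarrow> bool)) set" where
  "hyps = maps k r \<times> (\<lambda>h. restrict h (cube k)) ` circuit_class k s"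

definition selected :: "(nat \<Rightarrow> nat set) \<Rightarrow> bool list \<Rightarrow> (nat \<Rightarrow> nat) \<times> (bool list \<Rightarrow> bool)" where
  "selected ys a = (SOME c. c \<in> hyps \<and> (\<forall>t<M. a ! t = hval k c (ys t)))"

definition region :: "(nat \<Rightarrow> nat) \<Rightarrow> (nat \<Rightarrow> nat) \<times> (bool list \<Rightarrow> bool) \<Rightarrow> nat set" where
  "region \<phi> c = pull n \<phi> (fst c ` {..<k})"

definition samples :: "(nat \<Rightarrow> nat) \<Rightarrow> (nat \<Rightarrow> nat set) \<Rightarrow> bool list list" where
  "samples \<phi> ys = map (\<lambda>t. bits n (pull n \<phi> (ys t))) [0..<M]"

text \<open>Everything random is fixed in \<open>\<omega>\<close>. The adaptive step is the third
  batch, whose points depend on the region found from the sample answers.\<close>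

definition tree where
  "tree \<omega> = (case \<omega> of ((\<phi>, ys), zs) \<Rightarrow>
     ask (samples \<phi> ys) (\<lambda>a.
       if \<exists>c\<in>hyps. \<forall>t<M. a ! t = hval k c (ys t) then
         ask (map (\<lambda>l. bits n (fst (zs l))) [0..<m]) (\<lambda>b.
         ask (map (\<lambda>l. bits n (mix (region \<phi> (selected ys a)) (fst (zs l)) (snd (zs l)))) [0..<m]) (\<lambda>b'.
         Output (b = b')))
       else Output False))"

abbreviation "Ys \<equiv> PiE {..<M} (\<lambda>_. halves r)"

abbreviation "Zs \<equiv> PiE {..<m} (\<lambda>_. Pairs)"

definition seeds where
  "seeds = (maps n r \<times> Ys) \<times> Zs"

lemma r_pos: "r > 0"
proof -
  have "0 < 100 * (real k + 1)\<^sup>2" by (simp add: add_nonneg_pos)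
  then show ?thesis using r(2) by linarith
qed

lemma finite_spaces [simp]: "finite Ys" "finite Zs"
  by (auto intro!: finite_PiE)

lemma spaces_nonempty [simp]: "Ys \<noteq> {}" "Zs \<noteq> {}" "maps n r \<noteq> {}" "halves r \<noteq> {}" "Pow N \<noteq> {}"
  using r r_pos by (auto simp: PiE_eq_empty_iff)

lemma seeds_nonempty: "finite seeds" "seeds \<noteq> {}"
proof -
  show "finite seeds" unfolding seeds_def by (intro finite_cartesian_product) auto
  show "seeds \<noteq> {}" unfolding seeds_def using spaces_nonempty by (simp only: Times_empty) blast
qed

lemma finite_hyps: "finite hyps"
  unfolding hyps_def using card_circuit_class(1) by (intro finite_cartesian_product) auto

lemma queried_tree: "queried (tree \<omega>) \<subseteq> cube n"
proof -
  obtain \<phi> ys zs where \<omega>: "\<omega> = ((\<phi>, ys), zs)" by (metis surj_pair)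
  have "queried (tree \<omega>) \<subseteq> set (samples \<phi> ys) \<union> cube n"
    unfolding tree_def \<omega> prod.case
    by (rule order.trans[OF queried_ask])
      (auto split: if_splits dest!: subsetD[OF queried_ask])
  then show ?thesis by (auto simp: samples_def)
qed

lemma num_queries_tree: "num_queries f (tree \<omega>) \<le> M + 2 * m"
  by (auto simp: tree_def samples_def split: prod.split)

section \<open>The outcome of a run and the estimates for its parts\<close>

definition fits :: "(bool list \<Rightarrow> bool) \<Rightarrow> (nat \<Rightarrow> nat) \<Rightarrow> (nat \<Rightarrow> nat set) \<Rightarrow> (nat \<Rightarrow> nat) \<times> (bool list \<Rightarrow> bool) \<Rightarrow> bool" where
  "fits f \<phi> ys c \<longleftrightarrow> (\<forall>t<M. f (bits n (pull n \<phi> (ys t))) = hval k c (ys t))"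

text \<open>The chosen hypothesis written with \<open>f\<close> in place of the received answers. It
  depends on \<open>\<phi>\<close> and \<open>ys\<close> only, so the pairs in \<open>zs\<close> are
  fresh relative to it.\<close>

definition sel where
  "sel f \<phi> ys = (SOME c. c \<in> hyps \<and> fits f \<phi> ys c)"

lemma sel: "\<exists>c\<in>hyps. fits f \<phi> ys c \<Longrightarrow> sel f \<phi> ys \<in> hyps \<and> fits f \<phi> ys (sel f \<phi> ys)"
  unfolding sel_def by (rule someI_ex) auto

lemma run_tree:
  "run f (tree ((\<phi>, ys), zs)) \<longleftrightarrow> (\<exists>c\<in>hyps. fits f \<phi> ys c) \<and>
     (\<forall>l<m. f (bits n (fst (zs l))) = f (bits n (mix (region \<phi> (sel f \<phi> ys)) (fst (zs l)) (snd (zs l)))))"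
proof -
  let ?a = "map f (samples \<phi> ys)"
  have a: "(\<forall>t<M. ?a ! t = hval k c (ys t)) \<longleftrightarrow> fits f \<phi> ys c" for c
    by (auto simp: samples_def fits_def)
  then have "selected ys ?a = sel f \<phi> ys"
    by (simp add: selected_def sel_def)
  then show ?thesis
    unfolding tree_def prod.case run_ask a by (auto simp: list_eq_iff_nth_eq)
qed

lemma ufrac_halves_pull:
  assumes "ufrac (Pow N) P \<le> \<delta>"
  shows "avg (maps n r) (\<lambda>\<phi>. ufrac (halves r) (\<lambda>Y. P (pull n \<phi> Y))) \<le> \<delta>"
proof -
  have "avg (maps n r) (\<lambda>\<phi>. ufrac (halves r) (\<lambda>Y. P (pull n \<phi> Y))) =
      avg (halves r) (\<lambda>Y. ufrac (maps n r) (\<lambda>\<phi>. P (pull n \<phi> Y)))"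
    unfolding ufrac_def by (rule avg_swap)
  also have "\<dots> \<le> \<delta>"
    using assms ufrac_pull[OF _ r_pos] by (intro avg_le) auto
  finally show ?thesis .
qed

text \<open>Samples pulled back along the same map are dependent, but the union bound needs only
  that each is uniform.\<close>

lemma ufrac_samples:
  assumes "ufrac (Pow N) P \<le> \<delta>"
  shows "ufrac (maps n r \<times> Ys) (\<lambda>(\<phi>, ys). \<exists>t\<in>{..<M}. P (pull n \<phi> (ys t))) \<le> real M * \<delta>"
  unfolding ufrac_times_swap
proof (rule avg_le)
  fix ys assume ys: "ys \<in> Ys"
  have "ufrac (maps n r) (\<lambda>\<phi>. \<exists>t\<in>{..<M}. P (pull n \<phi> (ys t))) \<le>
      (\<Sum>t<M. ufrac (maps n r) (\<lambda>\<phi>. P (pull n \<phi> (ys t))))"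
    by (rule ufrac_bex_le) simp
  also have "\<dots> \<le> (\<Sum>t<M. \<delta>)"
  proof (rule sum_mono)
    fix t assume "t \<in> {..<M}"
    then have "ys t \<in> halves r" using ys by auto
    then show "ufrac (maps n r) (\<lambda>\<phi>. P (pull n \<phi> (ys t))) \<le> \<delta>"
      using assms ufrac_pull[OF _ r_pos] by simp
  qed
  finally show "ufrac (maps n r) (\<lambda>\<phi>. \<exists>t\<in>{..<M}. P (pull n \<phi> (ys t))) \<le> real M * \<delta>" by simp
qed simp_all

text \<open>Junta and hypothesis together look at no more than \<open>2 k\<close> blocks, so the
  event depends on few coordinates of the half. The required \<open>16 k^2 \<le> r\<close> is within
  the assumption on \<open>r\<close>.\<close>

lemma ufrac_Pow_blocks:
  assumes "\<phi> \<in> maps n r" "J \<subseteq> N" "card J \<le> k" "\<And>X. g X = g (X \<inter> J)" "c \<in> hyps"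
  shows "ufrac (Pow {..<r}) (\<lambda>Y. g (pull n \<phi> Y) \<noteq> hval k c Y) \<le>
    2 * ufrac (halves r) (\<lambda>Y. g (pull n \<phi> Y) \<noteq> hval k c Y)"
proof (rule ufrac_Pow_le_halves)
  let ?D = "\<phi> ` J \<union> fst c ` {..<k}"
  have finJ: "finite J" using assms finite_subset by blast
  show "?D \<subseteq> {..<r}"
    using assms by (auto simp: maps_def hyps_def PiE_iff)
  have "card ?D \<le> card (\<phi> ` J) + card (fst c ` {..<k})" by (rule card_Un_le)
  also have "\<dots> \<le> 2 * k"
    using card_image_le[OF finJ, of \<phi>] card_image_le[of "{..<k}" "fst c"] assms(3) by simp
  finally show "card ?D \<le> 2 * k" .
  show "4 * (2 * k)\<^sup>2 \<le> r"
  proof -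
    have "real (4 * (2 * k)\<^sup>2) \<le> 100 * (real k + 1)\<^sup>2"
      by (simp add: power2_eq_square algebra_simps)
    then have "real (4 * (2 * k)\<^sup>2) \<le> real r" using r(2) by linarith
    then show ?thesis by (simp only: of_nat_le_iff)
  qed
  fix Y
  have "pull n \<phi> (Y \<inter> ?D) \<inter> J = pull n \<phi> Y \<inter> J" by (auto simp: pull_def)
  then have "g (pull n \<phi> (Y \<inter> ?D)) = g (pull n \<phi> Y)"
    using assms(4)[of "pull n \<phi> (Y \<inter> ?D)"] assms(4)[of "pull n \<phi> Y"] by simp
  moreover have "hval k c (Y \<inter> ?D) = hval k c Y" by (rule hval_cong) auto
  ultimately show "(g (pull n \<phi> Y) \<noteq> hval k c Y) = (g (pull n \<phi> (Y \<inter> ?D)) \<noteq> hval k c (Y \<inter> ?D))"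
    by simp
qed (use r in simp)

text \<open>Compare both evaluations of \<open>g\<close> with the hypothesis, which does not change
  when the blocks it ignores are resampled. Both block patterns are uniform, so each comparison
  costs \<open>\<gamma>\<close>. The passage from variables to blocks uses injectivity on
  \<open>J\<close>.\<close>

lemma resample_region:
  assumes "\<phi> \<in> maps n r" "J \<subseteq> N" "inj_on \<phi> J" "\<And>X. g X = g (X \<inter> J)"
    and "ufrac (Pow {..<r}) (\<lambda>Y. g (pull n \<phi> Y) \<noteq> hval k c Y) \<le> \<gamma>"
  shows "resample N g (region \<phi> c) \<le> 2 * \<gamma>"
proof -
  let ?A = "region \<phi> c" and ?S = "fst c ` {..<k}" and ?R = "Pow {..<r} \<times> Pow {..<r}"
  have \<phi>J: "\<phi> ` J \<subseteq> {..<r}" using assms by (auto simp: maps_def PiE_iff)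
  have mixJ: "mix ?A (X \<inter> J) (X' \<inter> J) = mix ?A X X' \<inter> J" for X X' by (auto simp: mix_def)
  have gJ: "g (X \<inter> J) = g X" for X using assms(4)[of X] by simp
  then have g_mix: "g (mix ?A (X \<inter> J) (X' \<inter> J)) = g (mix ?A X X')" for X X' unfolding mixJ .
  have "resample N g ?A = ufrac Pairs (\<lambda>(X, X'). g (X \<inter> J) \<noteq> g (mix ?A (X \<inter> J) (X' \<inter> J)))"
    unfolding resample_def gJ g_mix ..
  also have "\<dots> = ufrac ?R (\<lambda>(Y, Y'). g (pull n \<phi> Y \<inter> J) \<noteq> g (mix ?A (pull n \<phi> Y \<inter> J) (pull n \<phi> Y' \<inter> J)))"
    by (rule ufrac_pull_inj2[OF assms(2,3) \<phi>J, symmetric])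
  also have "\<dots> = ufrac ?R (\<lambda>(Y, Y'). g (pull n \<phi> Y) \<noteq> g (pull n \<phi> (mix ?S Y Y')))"
    unfolding gJ g_mix unfolding pull_mix region_def ..
  also have "\<dots> \<le> ufrac ?R (\<lambda>(Y, Y'). g (pull n \<phi> Y) \<noteq> hval k c Y) +
      ufrac ?R (\<lambda>(Y, Y'). g (pull n \<phi> (mix ?S Y Y')) \<noteq> hval k c (mix ?S Y Y'))"
  proof (rule ufrac_le_add)
    have "hval k c Y = hval k c (mix ?S Y Y')" for Y Y'
      by (rule hval_cong) (auto simp: mix_def)
    then show "(case p of (Y, Y') \<Rightarrow> g (pull n \<phi> Y) \<noteq> hval k c Y) \<or>
        (case p of (Y, Y') \<Rightarrow> g (pull n \<phi> (mix ?S Y Y')) \<noteq> hval k c (mix ?S Y Y'))"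
      if "case p of (Y, Y') \<Rightarrow> g (pull n \<phi> Y) \<noteq> g (pull n \<phi> (mix ?S Y Y'))" for p
      using that by (cases p, simp only: prod.case) blast
  qed
  also have "ufrac ?R (\<lambda>(Y, Y'). g (pull n \<phi> Y) \<noteq> hval k c Y) =
      ufrac (Pow {..<r}) (\<lambda>Y. g (pull n \<phi> Y) \<noteq> hval k c Y)"
    by (rule ufrac_fst) auto
  also have "ufrac ?R (\<lambda>(Y, Y'). g (pull n \<phi> (mix ?S Y Y')) \<noteq> hval k c (mix ?S Y Y')) =
      ufrac (Pow {..<r}) (\<lambda>Y. g (pull n \<phi> Y) \<noteq> hval k c Y)"
    by (rule ufrac_mix) simp
  finally show ?thesis using assms(5) by simp
qed

text \<open>Fix the blocks not met by \<open>J\<close> to a choice \<open>Q\<close> no worse than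
  average. A block met by \<open>J\<close> contains exactly one of its elements and is replaced by
  that variable; every other block becomes a constant. The hypothesis turns into a circuit over the
  original variables with no more gates and no further error.\<close>

lemma close_to_class:
  assumes \<phi>: "\<phi> \<in> maps n r" and J: "J \<subseteq> N" "inj_on \<phi> J" "\<And>X. g X = g (X \<inter> J)" and c: "c \<in> hyps"
    and close: "ufrac (Pow {..<r}) (\<lambda>Y. g (pull n \<phi> Y) \<noteq> hval k c Y) \<le> \<gamma>"
  shows "\<exists>g'\<in>circuit_class n s. ufrac (Pow N) (\<lambda>X. g X \<noteq> g' (bits n X)) \<le> \<gamma>"
proof -
  have finJ: "finite J" using J finite_subset by blast
  have \<phi>J: "\<phi> ` J \<subseteq> {..<r}" using \<phi> J by (auto simp: maps_def PiE_iff)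
  let ?P = "\<lambda>Y. g (pull n \<phi> Y) \<noteq> hval k c Y"
  obtain h where h: "h \<in> circuit_class k s" "snd c = restrict h (cube k)"
    using c by (auto simp: hyps_def)
  have "ufrac (Pow {..<r}) ?P =
      avg (Pow ({..<r} - \<phi> ` J)) (\<lambda>Q. ufrac (Pow (\<phi> ` J)) (\<lambda>P. ?P (P \<union> Q)))"
    unfolding ufrac_def avg_Pow_split[OF \<phi>J] by (rule avg_swap)
  moreover have "\<exists>Q\<in>Pow ({..<r} - \<phi> ` J). ufrac (Pow (\<phi> ` J)) (\<lambda>P. ?P (P \<union> Q)) \<le>
      avg (Pow ({..<r} - \<phi> ` J)) (\<lambda>Q. ufrac (Pow (\<phi> ` J)) (\<lambda>P. ?P (P \<union> Q)))"
    by (rule exists_le_avg) auto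
  ultimately obtain Q where Q: "Q \<subseteq> {..<r} - \<phi> ` J" "ufrac (Pow (\<phi> ` J)) (\<lambda>P. ?P (P \<union> Q)) \<le> \<gamma>"
    using close by (auto intro: order.trans)
  define \<theta>' where "\<theta>' = (\<lambda>j. if fst c j \<in> \<phi> ` J then Input (inv_into J \<phi> (fst c j)) else Const (fst c j \<in> Q))"
  define g' where "g' = (\<lambda>x. h (map (\<lambda>j. node_val x (\<theta>' j)) [0..<k]))"
  have "\<theta>' j \<in> Input ` {..<n} \<union> range Const" for j
    using J(1) inv_into_into[of "fst c j" \<phi> J] by (auto simp: \<theta>'_def)
  then have g': "g' \<in> circuit_class n s"
    unfolding g'_def by (rule circuit_class_subst[OF h(1)])
  have val: "node_val (bits n X) (\<theta>' j) \<longleftrightarrow> fst c j \<in> \<phi> ` (X \<inter> J) \<union> Q" for X j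
  proof (cases "fst c j \<in> \<phi> ` J")
    case True
    then obtain i where i: "i \<in> J" "fst c j = \<phi> i" by auto
    then have "inv_into J \<phi> (fst c j) = i" "i < n" using J by auto
    moreover have "\<phi> i \<in> \<phi> ` (X \<inter> J) \<longleftrightarrow> i \<in> X"
      using i J(2) by (auto dest: inj_onD)
    moreover have "\<phi> i \<notin> Q" using i Q by auto
    ultimately show ?thesis using True i by (simp add: \<theta>'_def)
  qed (auto simp: \<theta>'_def)
  have g'_eq: "g' (bits n X) = hval k c (\<phi> ` (X \<inter> J) \<union> Q)" for X
  proof -
    have "map (\<lambda>j. node_val (bits n X) (\<theta>' j)) [0..<k] = bits k (pull k (fst c) (\<phi> ` (X \<inter> J) \<union> Q))"
      unfolding val by (rule map_mem_eq_bits_pull)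
    then show ?thesis by (simp add: g'_def hval_def h(2))
  qed
  define P' where "P' = (\<lambda>Z. g Z \<noteq> hval k c (\<phi> ` Z \<union> Q))"
  have "ufrac (Pow N) (\<lambda>X. g X \<noteq> g' (bits n X)) = ufrac (Pow N) (\<lambda>X. P' (X \<inter> J))"
    unfolding P'_def g'_eq using J(3) by simp
  also have "\<dots> = ufrac (Pow J) P'"
    using J by (intro ufrac_Pow_Int) auto
  also have "\<dots> = ufrac (Pow (\<phi> ` J)) (\<lambda>P. P' {i \<in> J. \<phi> i \<in> P})"
    by (rule ufrac_Pow_inj[OF finJ J(2), symmetric])
  also have "\<dots> = ufrac (Pow (\<phi> ` J)) (\<lambda>P. ?P (P \<union> Q))"
  proof (rule ufrac_cong)
    fix P assume P: "P \<in> Pow (\<phi> ` J)"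
    then have "\<phi> ` {i \<in> J. \<phi> i \<in> P} = P" by auto
    moreover have "pull n \<phi> (P \<union> Q) \<inter> J = {i \<in> J. \<phi> i \<in> P}"
      using J(1) Q(1) by (auto simp: pull_def)
    ultimately show "P' {i \<in> J. \<phi> i \<in> P} = ?P (P \<union> Q)"
      using J(3)[of "pull n \<phi> (P \<union> Q)"] by (simp add: P'_def)
  qed simp
  finally have "ufrac (Pow N) (\<lambda>X. g X \<noteq> g' (bits n X)) \<le> \<gamma>" using Q(2) by simp
  then show ?thesis using g' by blast
qed

text \<open>The pairs are independent of map and samples, so both the condition \<open>G\<close> and
  the tested event may depend on those.\<close>

lemma ufrac_pairs:
  assumes "\<And>\<phi> ys. \<phi> \<in> maps n r \<Longrightarrow> ys \<in> Ys \<Longrightarrow> G \<phi> ys \<Longrightarrow> ufrac Pairs (P \<phi> ys) \<le> \<delta>" "0 \<le> \<delta>"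
  shows "ufrac seeds (\<lambda>((\<phi>, ys), zs). G \<phi> ys \<and> (\<exists>l\<in>{..<m}. P \<phi> ys (zs l))) \<le> real m * \<delta>"
proof -
  have "ufrac seeds (\<lambda>(p, zs). (case p of (\<phi>, ys) \<Rightarrow> G \<phi> ys) \<and>
      (case p of (\<phi>, ys) \<Rightarrow> \<exists>l\<in>{..<m}. P \<phi> ys (zs l))) \<le> real m * \<delta>"
    unfolding seeds_def
  proof (rule ufrac_times_le)
    fix p assume p: "p \<in> maps n r \<times> Ys" "case p of (\<phi>, ys) \<Rightarrow> G \<phi> ys"
    obtain \<phi> ys where [simp]: "p = (\<phi>, ys)" by (metis surj_pair)
    have "ufrac Zs (\<lambda>zs. \<exists>l\<in>{..<m}. P \<phi> ys (zs l)) \<le> real (card {..<m}) * \<delta>"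
      by (rule ufrac_PiE_ex_le) (use p assms in auto)
    then show "ufrac Zs (\<lambda>zs. case p of (\<phi>, ys) \<Rightarrow> \<exists>l\<in>{..<m}. P \<phi> ys (zs l)) \<le> real m * \<delta>"
      by simp
  qed (use assms in \<open>auto simp: Times_empty\<close>)
  then show ?thesis by (simp add: case_prod_unfold)
qed

lemma ufrac_seeds_fst: "ufrac seeds (\<lambda>((\<phi>, ys), zs). P \<phi> ys) = ufrac (maps n r \<times> Ys) (\<lambda>(\<phi>, ys). P \<phi> ys)"
  unfolding seeds_def using ufrac_fst[of Zs "maps n r \<times> Ys" "\<lambda>(\<phi>, ys). P \<phi> ys"]
  by (simp add: case_prod_unfold)

lemma ufrac_seeds_map: "ufrac seeds (\<lambda>((\<phi>, ys), zs). P \<phi>) = ufrac (maps n r) P"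
  unfolding ufrac_seeds_fst using ufrac_fst[of Ys "maps n r" P] by simp

lemma ufrac_collide:
  assumes "J \<subseteq> N" "card J \<le> k"
  shows "ufrac (maps n r) (\<lambda>\<phi>. \<not> inj_on \<phi> J) \<le> 1 / 100"
proof -
  have "ufrac (maps n r) (\<lambda>\<phi>. \<not> inj_on \<phi> J) \<le> (real (card J))\<^sup>2 / real r"
    using assms r_pos by (intro ufrac_not_inj) auto
  also have "\<dots> \<le> 1 / 100"
  proof -
    have "(real (card J))\<^sup>2 \<le> (real k + 1)\<^sup>2" using assms by (intro power_mono) auto
    then have "100 * (real (card J))\<^sup>2 \<le> real r" using r(2) by linarith
    then show ?thesis using r_pos by (simp add: field_simps)
  qed
  finally show ?thesis .
qed

section \<open>Completeness and soundness of the tester\<close>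

lemma ufrac_learning_fails:
  "ufrac (maps n r \<times> Ys) (\<lambda>(\<phi>, ys). \<exists>c\<in>hyps. (\<forall>t<M. F (pull n \<phi> (ys t)) = hval k c (ys t)) \<and>
     \<eta>' < ufrac (halves r) (\<lambda>Y. F (pull n \<phi> Y) \<noteq> hval k c Y)) \<le> 1 / 20"
  unfolding ufrac_times
proof (rule avg_le)
  fix \<phi>
  have "ufrac Ys (\<lambda>ys. \<exists>c\<in>hyps. (\<forall>t<M. F (pull n \<phi> (ys t)) = hval k c (ys t)) \<and>
     \<eta>' < ufrac (halves r) (\<lambda>Y. F (pull n \<phi> Y) \<noteq> hval k c Y)) \<le> real (card hyps) * exp (- \<eta>' * real M)"
    by (rule ufrac_consistent_but_far) (auto simp: finite_hyps)
  also have "\<dots> \<le> 1 / 20" using M by (simp add: hyps_def)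
  finally show "ufrac Ys (\<lambda>ys. \<exists>c\<in>hyps. (\<forall>t<M. F (pull n \<phi> (ys t)) = hval k c (ys t)) \<and>
     \<eta>' < ufrac (halves r) (\<lambda>Y. F (pull n \<phi> Y) \<noteq> hval k c Y)) \<le> 1 / 20" .
qed simp_all

text \<open>The run is analysed as if on the narrow approximation \<open>F'\<close>:
  \<open>bad1\<close> and \<open>bad3\<close> are the queries at which it differs from
  \<open>F\<close>. Learning and resampling are estimated for \<open>F'\<close>, because those
  estimates need a junta. The failure probabilities sum to at most 0.16.\<close>

lemma run_tree_of_class:
  assumes f: "f \<in> circuit_class n s"
  shows "ufrac seeds (\<lambda>\<omega>. \<not> run f (tree \<omega>)) \<le> 1 / 3"
proof -
  let ?\<delta> = "real s / 2 ^ L"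
  define F where "F = (\<lambda>X. f (bits n X))"
  obtain C where C: "boolean_circuit n C" "circuit_size C \<le> s" "\<And>x. x \<in> cube n \<Longrightarrow> f x = eval_circuit C x"
    using f by (auto simp: circuit_class_def)
  obtain h \<pi> where h: "h \<in> circuit_class k s" and \<pi>: "\<And>j. \<pi> j < n"
    and "ufrac (Pow N) (\<lambda>X. eval_circuit C (bits n X) \<noteq> h (map (\<lambda>j. \<pi> j \<in> X) [0..<k])) \<le> ?\<delta>"
    using circuit_near_narrow[OF C(1,2) L n] unfolding k_def by blast
  define F' where "F' = (\<lambda>X. h (bits k (pull k \<pi> X)))"
  have FF': "ufrac (Pow N) (\<lambda>X. F X \<noteq> F' X) \<le> ?\<delta>"
    using \<open>ufrac _ _ \<le> ?\<delta>\<close> by (simp add: F_def F'_def C(3) map_mem_eq_bits_pull)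
  define J where "J = \<pi> ` {..<k}"
  have J: "J \<subseteq> N" "card J \<le> k"
    using \<pi> card_image_le[of "{..<k}" \<pi>] by (auto simp: J_def)
  have F'J: "F' X = F' (X \<inter> J)" for X
  proof -
    have "pull k \<pi> (X \<inter> J) = pull k \<pi> X" by (auto simp: pull_def J_def)
    then show ?thesis by (simp add: F'_def)
  qed
  define good where "good = (\<lambda>\<phi> c. inj_on \<phi> J \<and> c \<in> hyps \<and>
    ufrac (halves r) (\<lambda>Y. F' (pull n \<phi> Y) \<noteq> hval k c Y) \<le> \<eta>')"
  define bad1 where "bad1 = (\<lambda>\<phi> ys. \<exists>t\<in>{..<M}. F (pull n \<phi> (ys t)) \<noteq> F' (pull n \<phi> (ys t)))"
  define bad2 where "bad2 = (\<lambda>\<phi> ys. \<exists>c\<in>hyps. (\<forall>t<M. F' (pull n \<phi> (ys t)) = hval k c (ys t)) \<and>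
     \<eta>' < ufrac (halves r) (\<lambda>Y. F' (pull n \<phi> Y) \<noteq> hval k c Y))"
  define bad3 where "bad3 = (\<lambda>\<phi> ys zs. \<exists>l\<in>{..<m}. case zs l of (X, X') \<Rightarrow>
     F X \<noteq> F' X \<or> F (mix (region \<phi> (sel f \<phi> ys)) X X') \<noteq> F' (mix (region \<phi> (sel f \<phi> ys)) X X'))"
  define bad4 where "bad4 = (\<lambda>\<phi> ys zs. good \<phi> (sel f \<phi> ys) \<and> (\<exists>l\<in>{..<m}. case zs l of (X, X') \<Rightarrow>
     F' X \<noteq> F' (mix (region \<phi> (sel f \<phi> ys)) X X')))"
  have main: "bad1 \<phi> ys \<or> bad2 \<phi> ys \<or> \<not> inj_on \<phi> J \<or> bad3 \<phi> ys zs \<or> bad4 \<phi> ys zs"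
    if \<phi>: "\<phi> \<in> maps n r" and rej: "\<not> run f (tree ((\<phi>, ys), zs))" for \<phi> ys zs
  proof (rule ccontr)
    assume no: "\<not> ?thesis"
    have same: "f (bits n (pull n \<phi> (ys t))) = F' (pull n \<phi> (ys t))" if "t < M" for t
      using no that by (auto simp: bad1_def F_def)
    \<comment> \<open>The hypothesis that must be consistent: the narrow circuit with each of its
      variables replaced by the block containing it.\<close>
    let ?c0 = "(restrict (\<phi> \<circ> \<pi>) {..<k}, restrict h (cube k))"
    have "?c0 \<in> hyps" using h \<pi> \<phi> by (auto simp: hyps_def maps_def PiE_iff)
    moreover have "hval k ?c0 Y = F' (pull n \<phi> Y)" for Y
    proof -
      have "pull k (restrict (\<phi> \<circ> \<pi>) {..<k}) Y = pull k (\<phi> \<circ> \<pi>) Y" by (auto simp: pull_def)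
      then show ?thesis by (simp add: hval_def F'_def pull_pull[of \<pi> n, OF \<pi>])
    qed
    ultimately have ex: "\<exists>c\<in>hyps. fits f \<phi> ys c" using same by (auto simp: fits_def)
    then have c: "sel f \<phi> ys \<in> hyps" "fits f \<phi> ys (sel f \<phi> ys)" using sel by auto
    then have "\<forall>t<M. F' (pull n \<phi> (ys t)) = hval k (sel f \<phi> ys) (ys t)"
      using same by (auto simp: fits_def)
    then have "good \<phi> (sel f \<phi> ys)" using no c by (auto simp: good_def bad2_def not_less)
    then have "F (fst (zs l)) = F (mix (region \<phi> (sel f \<phi> ys)) (fst (zs l)) (snd (zs l)))" if "l < m" for l
      using no that by (auto simp: bad3_def bad4_def case_prod_unfold)
    then show False using rej ex by (simp add: run_tree F_def)
  qed
  have "ufrac seeds (\<lambda>\<omega>. \<not> run f (tree \<omega>)) \<le>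
      ufrac seeds (\<lambda>((\<phi>, ys), zs). bad1 \<phi> ys) + (ufrac seeds (\<lambda>((\<phi>, ys), zs). bad2 \<phi> ys) +
      (ufrac seeds (\<lambda>((\<phi>, ys), zs). \<not> inj_on \<phi> J) + (ufrac seeds (\<lambda>((\<phi>, ys), zs). bad3 \<phi> ys zs) +
       ufrac seeds (\<lambda>((\<phi>, ys), zs). bad4 \<phi> ys zs))))"
    (is "_ \<le> ?sum")
  proof -
    let ?U = "\<lambda>Q \<omega>. case \<omega> of ((\<phi>, ys), zs) \<Rightarrow> Q \<phi> ys zs"
    have "ufrac seeds (\<lambda>\<omega>. \<not> run f (tree \<omega>)) \<le>
        ufrac seeds (\<lambda>\<omega>. ?U (\<lambda>\<phi> ys zs. bad1 \<phi> ys) \<omega> \<or> (?U (\<lambda>\<phi> ys zs. bad2 \<phi> ys) \<omega> \<or>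
          (?U (\<lambda>\<phi> ys zs. \<not> inj_on \<phi> J) \<omega> \<or> (?U bad3 \<omega> \<or> ?U bad4 \<omega>))))"
    proof (rule ufrac_mono)
      fix \<omega> assume "\<omega> \<in> seeds" "\<not> run f (tree \<omega>)"
      then obtain \<phi> ys zs where "\<omega> = ((\<phi>, ys), zs)" "\<phi> \<in> maps n r" "\<not> run f (tree ((\<phi>, ys), zs))"
        by (auto simp: seeds_def)
      then show "?U (\<lambda>\<phi> ys zs. bad1 \<phi> ys) \<omega> \<or> (?U (\<lambda>\<phi> ys zs. bad2 \<phi> ys) \<omega> \<or>
          (?U (\<lambda>\<phi> ys zs. \<not> inj_on \<phi> J) \<omega> \<or> (?U bad3 \<omega> \<or> ?U bad4 \<omega>)))"
        using main by simp
    qed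
    also have "\<dots> \<le> ?sum"
      by (intro order.trans[OF ufrac_disj] add_mono) (simp_all add: case_prod_unfold)
    finally show ?thesis .
  qed
  moreover have "ufrac seeds (\<lambda>((\<phi>, ys), zs). bad1 \<phi> ys) \<le> real M * ?\<delta>"
    unfolding ufrac_seeds_fst bad1_def using FF' by (rule ufrac_samples)
  moreover have "ufrac seeds (\<lambda>((\<phi>, ys), zs). bad2 \<phi> ys) \<le> 1 / 20"
    unfolding ufrac_seeds_fst bad2_def by (rule ufrac_learning_fails)
  moreover have "ufrac seeds (\<lambda>((\<phi>, ys), zs). \<not> inj_on \<phi> J) \<le> 1 / 100"
    unfolding ufrac_seeds_map using J by (rule ufrac_collide)
  moreover have "ufrac seeds (\<lambda>((\<phi>, ys), zs). bad3 \<phi> ys zs) \<le> real m * (?\<delta> + ?\<delta>)"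
  proof -
    have "ufrac seeds (\<lambda>((\<phi>, ys), zs). True \<and> bad3 \<phi> ys zs) \<le> real m * (?\<delta> + ?\<delta>)"
      unfolding bad3_def
    proof (rule ufrac_pairs)
      fix \<phi> ys
      let ?A = "region \<phi> (sel f \<phi> ys)"
      have "ufrac Pairs (\<lambda>(X, X'). F X \<noteq> F' X \<or> F (mix ?A X X') \<noteq> F' (mix ?A X X')) \<le>
          ufrac Pairs (\<lambda>(X, X'). F X \<noteq> F' X) + ufrac Pairs (\<lambda>(X, X'). F (mix ?A X X') \<noteq> F' (mix ?A X X'))"
        by (rule ufrac_le_add) auto
      also have "\<dots> = ufrac (Pow N) (\<lambda>X. F X \<noteq> F' X) + ufrac (Pow N) (\<lambda>X. F X \<noteq> F' X)"
        using ufrac_fst[of "Pow N" "Pow N" "\<lambda>X. F X \<noteq> F' X"] ufrac_mix[of N "\<lambda>X. F X \<noteq> F' X" ?A] by simp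
      finally show "ufrac Pairs (\<lambda>(X, X'). F X \<noteq> F' X \<or> F (mix ?A X X') \<noteq> F' (mix ?A X X')) \<le> ?\<delta> + ?\<delta>"
        using FF' by linarith
    qed simp
    then show ?thesis by simp
  qed
  moreover have "ufrac seeds (\<lambda>((\<phi>, ys), zs). bad4 \<phi> ys zs) \<le> real m * (4 * \<eta>')"
    unfolding bad4_def
  proof (rule ufrac_pairs)
    fix \<phi> ys assume \<phi>: "\<phi> \<in> maps n r" and "good \<phi> (sel f \<phi> ys)"
    then have g: "inj_on \<phi> J" "sel f \<phi> ys \<in> hyps"
      "ufrac (halves r) (\<lambda>Y. F' (pull n \<phi> Y) \<noteq> hval k (sel f \<phi> ys) Y) \<le> \<eta>'"
      by (auto simp: good_def)
    have "ufrac (Pow {..<r}) (\<lambda>Y. F' (pull n \<phi> Y) \<noteq> hval k (sel f \<phi> ys) Y) \<le> 2 * \<eta>'"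
      using ufrac_Pow_blocks[where g = F', OF \<phi> J F'J g(2)] g(3) by linarith
    then have "resample N F' (region \<phi> (sel f \<phi> ys)) \<le> 2 * (2 * \<eta>')"
      by (rule resample_region[where g = F', OF \<phi> J(1) g(1) F'J])
    then show "ufrac Pairs (\<lambda>(X, X'). F' X \<noteq> F' (mix (region \<phi> (sel f \<phi> ys)) X X')) \<le> 4 * \<eta>'"
      by (simp add: resample_def)
  qed (use \<eta> in simp)
  ultimately have "ufrac seeds (\<lambda>\<omega>. \<not> run f (tree \<omega>)) \<le>
      real M * ?\<delta> + (1 / 20 + (1 / 100 + (real m * (?\<delta> + ?\<delta>) + real m * (4 * \<eta>'))))"
    by linarith
  also have "\<dots> = (real M + 2 * real m) * ?\<delta> + 1 / 20 + 1 / 100 + real m * (4 * \<eta>')"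
    by (simp only: distrib_left distrib_right)
  also have "\<dots> \<le> 1 / 3" using few m(2) by linarith
  finally show ?thesis .
qed

lemma run_tree_of_far:
  assumes far: "\<And>g. g \<in> circuit_class n s \<Longrightarrow> \<epsilon> \<le> ufrac (Pow N) (\<lambda>X. f (bits n X) \<noteq> g (bits n X))"
  shows "ufrac seeds (\<lambda>\<omega>. run f (tree \<omega>)) \<le> 1 / 3"
proof -
  define F where "F = (\<lambda>X. f (bits n X))"
  \<comment> \<open>Quantifying over all \<open>S\<close> makes the event independent of the
    samples. When it fails, every region that could be selected has more than
    \<open>2 \<eta>\<close> of the weight not inside it, so each check detects a change with
    probability above \<open>\<eta>\<close>.\<close>
  define bad where "bad = (\<lambda>\<phi>. \<exists>S. finite S \<and> card S \<le> k \<and> wsum N (weight N F) (\<lambda>U. \<not> U \<subseteq> pull n \<phi> S) \<le> 2 * \<eta>)"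
  have k1: "k \<ge> 1" by (simp add: k_def)
  show ?thesis
  proof (cases "1 / 10 \<le> ufrac (maps n r) bad")
    case False
    define pass where "pass = (\<lambda>\<phi> ys zs. (\<not> bad \<phi> \<and> sel f \<phi> ys \<in> hyps) \<and>
      (\<forall>l<m. case zs l of (X, X') \<Rightarrow> F X = F (mix (region \<phi> (sel f \<phi> ys)) X X')))"
    have main: "bad \<phi> \<or> pass \<phi> ys zs" if "run f (tree ((\<phi>, ys), zs))" for \<phi> ys zs
      using that sel[of f \<phi> ys] by (auto simp: run_tree F_def pass_def case_prod_unfold)
    have "ufrac seeds (\<lambda>\<omega>. run f (tree \<omega>)) \<le>
        ufrac seeds (\<lambda>((\<phi>, ys), zs). bad \<phi>) + ufrac seeds (\<lambda>((\<phi>, ys), zs). pass \<phi> ys zs)"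
      by (rule ufrac_le_add) (use main in \<open>auto simp: seeds_def\<close>)
    moreover have "ufrac seeds (\<lambda>((\<phi>, ys), zs). bad \<phi>) \<le> 1 / 10"
      unfolding ufrac_seeds_map using False by simp
    moreover have "ufrac seeds (\<lambda>((\<phi>, ys), zs). pass \<phi> ys zs) \<le> 1 / 20"
    proof -
      have "ufrac seeds (\<lambda>(p, zs). (case p of (\<phi>, ys) \<Rightarrow> \<not> bad \<phi> \<and> sel f \<phi> ys \<in> hyps) \<and>
        (case p of (\<phi>, ys) \<Rightarrow> \<forall>l<m. case zs l of (X, X') \<Rightarrow> F X = F (mix (region \<phi> (sel f \<phi> ys)) X X'))) \<le> 1 / 20"
        unfolding seeds_def
      proof (rule ufrac_times_le)
        fix p assume p: "p \<in> maps n r \<times> Ys" "case p of (\<phi>, ys) \<Rightarrow> \<not> bad \<phi> \<and> sel f \<phi> ys \<in> hyps"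
        obtain \<phi> ys where [simp]: "p = (\<phi>, ys)" by (metis surj_pair)
        let ?c = "sel f \<phi> ys"
        have "card (fst ?c ` {..<k}) \<le> k" using card_image_le[of "{..<k}" "fst ?c"] by simp
        then have "2 * \<eta> < wsum N (weight N F) (\<lambda>U. \<not> U \<subseteq> region \<phi> ?c)"
          using p(2) unfolding bad_def region_def by (simp del: image_subset_iff) (meson finite_imageI finite_lessThan not_le)
        then have "\<eta> < resample N F (region \<phi> ?c)"
          by (subst resample_weight) (auto simp: region_def pull_def)
        then have "ufrac Pairs (\<lambda>q. case q of (X, X') \<Rightarrow> F X = F (mix (region \<phi> ?c) X X')) \<le> 1 - \<eta>"
          using ufrac_not[of Pairs "\<lambda>q. case q of (X, X') \<Rightarrow> F X = F (mix (region \<phi> ?c) X X')"]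
          by (simp add: resample_def case_prod_unfold Times_empty)
        then have "ufrac Zs (\<lambda>zs. \<forall>l<m. case zs l of (X, X') \<Rightarrow> F X = F (mix (region \<phi> ?c) X X')) \<le> exp (- \<eta> * real m)"
          by (intro ufrac_PiE_all_le) auto
        then show "ufrac Zs (\<lambda>zs. case p of (\<phi>, ys) \<Rightarrow> \<forall>l<m. case zs l of (X, X') \<Rightarrow> F X = F (mix (region \<phi> (sel f \<phi> ys)) X X')) \<le> 1 / 20"
          using m(1) by simp
      qed (auto simp: Times_empty)
      then show ?thesis by (simp add: pass_def case_prod_unfold)
    qed
    ultimately show ?thesis by linarith
  next
    case True
    have "\<exists>J\<subseteq>N. card J \<le> k \<and> wsum N (weight N F) (\<lambda>U. \<not> U \<subseteq> J) \<le> 7 * \<eta>"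
      using k1 \<eta>(1) \<theta> r_pos r(2) True unfolding bad_def
      by (intro weight_concentrated[where \<theta> = \<theta> and r = r]) (auto simp: weight_nonneg total_weight)
    then obtain J where J: "J \<subseteq> N" "card J \<le> k" "wsum N (weight N F) (\<lambda>U. \<not> U \<subseteq> J) \<le> 7 * \<eta>"
      by blast
    then have "resample N F J \<le> 7 / 2 * \<eta>" by (simp add: resample_weight)
    then obtain g where gJ: "\<And>X. g X = g (X \<inter> J)" and Fg: "ufrac (Pow N) (\<lambda>X. F X \<noteq> g X) \<le> 7 / 2 * \<eta>"
      using junta_of_resample[of N F J "7 / 2 * \<eta>"] by blast
    \<comment> \<open>The threshold is ten times the mean error \<open>7 / 2 * \<eta>\<close> of the
      junta, so Markov gives 1/10.\<close>
    define bad1 where "bad1 = (\<lambda>\<phi>. 35 * \<eta> < ufrac (halves r) (\<lambda>Y. F (pull n \<phi> Y) \<noteq> g (pull n \<phi> Y)))"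
    define bad2 where "bad2 = (\<lambda>\<phi> ys. \<exists>c\<in>hyps. (\<forall>t<M. F (pull n \<phi> (ys t)) = hval k c (ys t)) \<and>
      \<eta>' < ufrac (halves r) (\<lambda>Y. F (pull n \<phi> Y) \<noteq> hval k c Y))"
    have main: "\<not> inj_on \<phi> J \<or> bad1 \<phi> \<or> bad2 \<phi> ys"
      if \<phi>: "\<phi> \<in> maps n r" and acc: "run f (tree ((\<phi>, ys), zs))" for \<phi> ys zs
    proof (rule ccontr)
      assume no: "\<not> ?thesis"
      define c where "c = sel f \<phi> ys"
      have c: "c \<in> hyps" "fits f \<phi> ys c"
        using acc sel[of f \<phi> ys] by (auto simp: run_tree c_def)
      then have "ufrac (halves r) (\<lambda>Y. F (pull n \<phi> Y) \<noteq> hval k c Y) \<le> \<eta>'"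
        using no by (auto simp: bad2_def fits_def F_def not_less)
      moreover have "ufrac (halves r) (\<lambda>Y. g (pull n \<phi> Y) \<noteq> hval k c Y) \<le>
          ufrac (halves r) (\<lambda>Y. F (pull n \<phi> Y) \<noteq> g (pull n \<phi> Y)) +
          ufrac (halves r) (\<lambda>Y. F (pull n \<phi> Y) \<noteq> hval k c Y)"
        by (rule ufrac_le_add) auto
      moreover have "ufrac (halves r) (\<lambda>Y. F (pull n \<phi> Y) \<noteq> g (pull n \<phi> Y)) \<le> 35 * \<eta>"
        using no by (simp add: bad1_def not_less)
      ultimately have "ufrac (halves r) (\<lambda>Y. g (pull n \<phi> Y) \<noteq> hval k c Y) \<le> 36 * \<eta>"
        using \<eta>(4) by linarith
      then have "ufrac (Pow {..<r}) (\<lambda>Y. g (pull n \<phi> Y) \<noteq> hval k c Y) \<le> 72 * \<eta>"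
        using ufrac_Pow_blocks[where g = g, OF \<phi> J(1,2) gJ c(1)] by linarith
      then obtain g' where g': "g' \<in> circuit_class n s" "ufrac (Pow N) (\<lambda>X. g X \<noteq> g' (bits n X)) \<le> 72 * \<eta>"
        using close_to_class[where g = g, OF \<phi> J(1) _ gJ c(1)] no by blast
      \<comment> \<open>The hypothesis is within \<open>36 \<eta>\<close> of the junta on halves,
        hence \<open>72 \<eta>\<close> on independent bits. Adding \<open>7 / 2 * \<eta>\<close> for
        the junta itself stays below \<open>\<epsilon> = 100 \<eta>\<close>.\<close>
      have "\<epsilon> \<le> ufrac (Pow N) (\<lambda>X. F X \<noteq> g' (bits n X))"
        using far[OF g'(1)] by (simp add: F_def)
      also have "\<dots> \<le> ufrac (Pow N) (\<lambda>X. F X \<noteq> g X) + ufrac (Pow N) (\<lambda>X. g X \<noteq> g' (bits n X))"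
        by (rule ufrac_le_add) auto
      finally show False using Fg g'(2) \<eta>(1,2) by linarith
    qed
    have "ufrac seeds (\<lambda>\<omega>. run f (tree \<omega>)) \<le> ufrac seeds (\<lambda>((\<phi>, ys), zs). \<not> inj_on \<phi> J) +
        ufrac seeds (\<lambda>\<omega>. (case \<omega> of ((\<phi>, ys), zs) \<Rightarrow> bad1 \<phi>) \<or> (case \<omega> of ((\<phi>, ys), zs) \<Rightarrow> bad2 \<phi> ys))"
      by (rule ufrac_le_add) (use main in \<open>auto simp: seeds_def\<close>)
    also have "\<dots> \<le> ufrac seeds (\<lambda>((\<phi>, ys), zs). \<not> inj_on \<phi> J) +
        (ufrac seeds (\<lambda>((\<phi>, ys), zs). bad1 \<phi>) + ufrac seeds (\<lambda>((\<phi>, ys), zs). bad2 \<phi> ys))"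
      by (intro add_left_mono order.trans[OF ufrac_disj]) (simp add: case_prod_unfold)
    also have "\<dots> \<le> 1 / 100 + (1 / 10 + 1 / 20)"
    proof (intro add_mono)
      show "ufrac seeds (\<lambda>((\<phi>, ys), zs). \<not> inj_on \<phi> J) \<le> 1 / 100"
        unfolding ufrac_seeds_map using J(1,2) by (rule ufrac_collide)
      show "ufrac seeds (\<lambda>((\<phi>, ys), zs). bad1 \<phi>) \<le> 1 / 10"
        unfolding ufrac_seeds_map bad1_def
      proof (rule markov)
        show "avg (maps n r) (\<lambda>\<phi>. ufrac (halves r) (\<lambda>Y. F (pull n \<phi> Y) \<noteq> g (pull n \<phi> Y))) \<le> 35 * \<eta> * (1 / 10)"
          using ufrac_halves_pull[OF Fg] by simp
      qed (use \<eta>(1) in \<open>auto simp: ufrac_nonneg\<close>)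
      show "ufrac seeds (\<lambda>((\<phi>, ys), zs). bad2 \<phi> ys) \<le> 1 / 20"
        unfolding ufrac_seeds_fst bad2_def by (rule ufrac_learning_fails)
    qed
    finally show ?thesis by simp
  qed
qed

lemma prob_pmf_of_set_eq_ufrac:
  "finite S \<Longrightarrow> S \<noteq> {} \<Longrightarrow> measure_pmf.prob (pmf_of_set S) {x. P x} = ufrac S P"
  by (simp add: measure_pmf_of_set ufrac_card Int_def conj_commute)

lemma tester:
  "two_sided_tester n \<epsilon> (circuit_class n s) (map_pmf tree (pmf_of_set seeds))"
  "makes_at_most (map_pmf tree (pmf_of_set seeds)) (M + 2 * m)"
proof -
  let ?A = "map_pmf tree (pmf_of_set seeds)"
  have prob: "measure_pmf.prob ?A {t. P t} = ufrac seeds (\<lambda>\<omega>. P (tree \<omega>))" for P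
    using prob_pmf_of_set_eq_ufrac[OF seeds_nonempty, of "\<lambda>\<omega>. P (tree \<omega>)"] by (simp add: vimage_def)
  show "two_sided_tester n \<epsilon> (circuit_class n s) ?A"
    unfolding two_sided_tester_def prob
  proof (intro conjI ballI allI impI)
    show "queried t \<subseteq> cube n" if "t \<in> set_pmf ?A" for t
      using that queried_tree by auto
    show "2 / 3 \<le> ufrac seeds (\<lambda>\<omega>. run f (tree \<omega>))" if "f \<in> circuit_class n s" for f
      using run_tree_of_class[OF that] ufrac_not[OF seeds_nonempty, of "\<lambda>\<omega>. run f (tree \<omega>)"] by simp
    show "2 / 3 \<le> ufrac seeds (\<lambda>\<omega>. \<not> run f (tree \<omega>))" if far: "far_from n \<epsilon> f (circuit_class n s)" for f
    proof -
      have fin: "finite (cube n)" "cube n \<noteq> {}"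
        using bij_betw_finite[OF bij_betw_bits[of n]] bits_in_cube[of n] by (simp, blast)
      have "\<epsilon> \<le> ufrac (Pow N) (\<lambda>X. f (bits n X) \<noteq> g (bits n X))" if "g \<in> circuit_class n s" for g
        using far that prob_pmf_of_set_eq_ufrac[OF fin, of "\<lambda>x. f x \<noteq> g x"]
          ufrac_bij_betw[OF bij_betw_bits[of n], of "\<lambda>x. f x \<noteq> g x"]
        by (auto simp: far_from_def)
      then show ?thesis
        using run_tree_of_far[of f] ufrac_not[OF seeds_nonempty, of "\<lambda>\<omega>. run f (tree \<omega>)"] by simp
    qed
  qed
  show "makes_at_most ?A (M + 2 * m)"
    using num_queries_tree by (auto simp: makes_at_most_def)
qed

end

section \<open>Choice of the parameters\<close>

lemma const_in_circuit_class: "f \<in> circuit_class n s" if "\<And>x. x \<in> cube n \<Longrightarrow> f x = b"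
proof -
  define C where "C = \<lparr>gates = {}, gtype = (\<lambda>_. Conj), edges = {}, top_node = Const b\<rparr>"
  have "boolean_circuit n C"
    by (auto simp: boolean_circuit_def C_def nodes_def acyclic_def)
  moreover have "eval_circuit C x = b" for x
    unfolding eval_circuit_def
    by (subst eval_node_unfold') (auto simp: C_def eval_step_def acyclic_def)
  ultimately show ?thesis using that by (force simp: circuit_class_def circuit_size_def C_def)
qed

text \<open>Nothing is far in these cases: for \<open>n = 0\<close> every function is constant on
  the cube, and no distance exceeds 1.\<close>

lemma trivial_tester:
  assumes "n = 0 \<or> \<epsilon> > 1" "\<epsilon> > 0"
  shows "two_sided_tester n \<epsilon> (circuit_class n s) (return_pmf (Output True))"
    and "makes_at_most (return_pmf (Output True)) q"
proof -
  have "\<not> far_from n \<epsilon> f (circuit_class n s)" for f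
  proof
    assume far: "far_from n \<epsilon> f (circuit_class n s)"
    show False
    proof (cases "n = 0")
      case True
      then have c: "cube n = {[]}" by (auto simp: cube_def)
      then have "f \<in> circuit_class n s" by (intro const_in_circuit_class[where b = "f []"]) simp
      then have "\<epsilon> \<le> measure_pmf.prob (pmf_of_set (cube n)) {x. f x \<noteq> f x}"
        using far by (auto simp: far_from_def simp del: not_True_eq_False)
      then show False using assms by simp
    next
      case False
      have T: "(\<lambda>_. True) \<in> circuit_class n s" by (rule const_in_circuit_class) simp
      have "\<epsilon> \<le> measure_pmf.prob (pmf_of_set (cube n)) {x. \<not> f x}"
        using bspec[OF far[unfolded far_from_def] T] by simp
      also have "\<dots> \<le> 1" by simp
      finally show False using False assms by simp
    qed
  qed
  then show "two_sided_tester n \<epsilon> (circuit_class n s) (return_pmf (Output True))"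
    by (simp add: two_sided_tester_def)
  show "makes_at_most (return_pmf (Output True)) q"
    by (simp add: makes_at_most_def)
qed

lemma exp_ge_power: "(2::real) ^ a \<le> exp (real a)"
proof -
  have "(2::real) ^ a \<le> exp 1 ^ a"
    using exp_ge_add_one_self[of 1] by (intro power_mono) auto
  then show ?thesis by (simp add: exp_of_nat_mult[symmetric])
qed

text \<open>The exponent is what the sample size must beat. Its term \<open>s * (s + k + 2)\<close>
  comes from the edge sets and is the source of \<open>s^2\<close> in the query bound; the choice of
  blocks adds only \<open>k * ln r\<close>.\<close>

lemma card_hyps_le:
  assumes "r > 0"
  shows "real (card (maps k r \<times> (\<lambda>h. restrict h (cube k)) ` circuit_class k s)) \<le>
    exp (real k * ln (real r) + 2 * real s + real s * (real s + real k + 2) + (real s + real k + 2))"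
proof -
  have "card (maps k r \<times> (\<lambda>h. restrict h (cube k)) ` circuit_class k s) \<le>
      r ^ k * (3 ^ s * 2 ^ (s * (s + k + 2)) * (s + k + 2))"
    unfolding card_cartesian_product using card_circuit_class(2)[of k s]
    by (intro mult_mono) (auto simp: maps_def card_PiE)
  then have "real (card (maps k r \<times> (\<lambda>h. restrict h (cube k)) ` circuit_class k s)) \<le>
      real (r ^ k * (3 ^ s * 2 ^ (s * (s + k + 2)) * (s + k + 2)))"
    by (rule of_nat_mono)
  also have "\<dots> = real r ^ k * (3 ^ s * 2 ^ (s * (s + k + 2)) * real (s + k + 2))"
    by (simp only: of_nat_mult of_nat_power of_nat_numeral)
  also have "\<dots> \<le> exp (real k * ln (real r)) * (exp (2 * real s) * exp (real (s * (s + k + 2))) * exp (real (s + k + 2)))"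
  proof (intro mult_mono)
    show "real r ^ k \<le> exp (real k * ln (real r))"
      using assms by (simp add: exp_of_nat_mult)
    have "(3::real) ^ s \<le> exp 2 ^ s"
      using exp_ge_add_one_self[of 2] by (intro power_mono) auto
    then show "(3::real) ^ s \<le> exp (2 * real s)"
      by (simp add: exp_of_nat_mult[symmetric] mult.commute)
    show "(2::real) ^ (s * (s + k + 2)) \<le> exp (real (s * (s + k + 2)))" by (rule exp_ge_power)
    show "real (s + k + 2) \<le> exp (real (s + k + 2))"
      using exp_ge_add_one_self[of "real (s + k + 2)"] by linarith
  qed auto
  also have "\<dots> = exp (real k * ln (real r) + 2 * real s + real s * (real s + real k + 2) + (real s + real k + 2))"
    by (simp add: exp_add[symmetric] algebra_simps)
  finally show ?thesis .
qed

lemma exp_20: "exp (- 20 :: real) \<le> 1 / 20"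
proof -
  have "20 \<le> exp (20 :: real)" using exp_ge_add_one_self[of 20] by linarith
  then show ?thesis by (simp add: exp_minus field_simps)
qed

text \<open>The number of queries is chosen before \<open>n\<close>, so it is uniform in the number
  of variables.\<close>

lemma tester_with_parameters:
  fixes s L :: nat and \<epsilon> u :: real
  defines "u \<equiv> ln ((real s)\<^sup>2 / \<epsilon>)"
  assumes s: "s \<ge> 1" and \<epsilon>: "0 < \<epsilon>" "\<epsilon> \<le> 1" and L: "L \<ge> 1" "6 * u \<le> real L"
    and big: "20 * (10000000000000 * (real L)\<^sup>2) \<le> exp (real L / 3)"
  shows "\<exists>q::nat. real q \<le> 10000000000000 * ((real s)\<^sup>2 / \<epsilon>) * (real L)\<^sup>2 \<and>
    (\<forall>n\<ge>1. \<exists>A. two_sided_tester n \<epsilon> (circuit_class n s) A \<and> makes_at_most A q)"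
proof -
  define T where "T = (real s)\<^sup>2 / \<epsilon>"
  define \<eta> where "\<eta> = \<epsilon> / 100"
  \<comment> \<open>There are at most \<open>21 / \<eta>\<close> checks, each failing with
    probability at most \<open>4 \<eta>'\<close>, and the total should be 1/20:
    \<open>21 * 4 * 20 = 1680\<close>.\<close>
  define \<eta>' where "\<eta>' = \<eta> / 1680"
  define k where "k = s * L + 1"
  \<comment> \<open>The largest value allowed by \<open>weight_concentrated\<close>. Its condition
    \<open>50 k^2 \<le> \<theta>^2 r\<close> then asks for \<open>r\<close> of order
    \<open>k^6 / \<eta>^4\<close>, which fixes \<open>R\<close>; the factor 2 in \<open>r\<close>
    makes it even.\<close>
  define \<theta> where "\<theta> = \<eta>\<^sup>2 / (100 * real k ^ 2)"
  define R where "R = 1000000 * real k ^ 6 / \<eta> ^ 4"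
  define r where "r = 2 * nat \<lceil>R\<rceil>"
  define B where "B = real k * ln (real r) + 2 * real s + real s * (real s + real k + 2) + (real s + real k + 2)"
  define M where "M = nat \<lceil>(B + 20) / \<eta>'\<rceil>"
  define m where "m = nat \<lceil>20 / \<eta>\<rceil>"
  have s1: "real s \<ge> 1" and L1: "real L \<ge> 1" using s L by auto
  have k1: "real k \<ge> 1" "k \<ge> 1" by (auto simp: k_def)
  have \<eta>: "0 < \<eta>" "\<eta> \<le> 1 / 100" "0 < \<eta>'" "\<eta>' \<le> \<eta>" using \<epsilon> by (auto simp: \<eta>_def \<eta>'_def)
  have sT: "real s \<le> (real s)\<^sup>2" "(real s)\<^sup>2 \<le> T" "1 / \<epsilon> \<le> T"
  proof -
    show s2: "real s \<le> (real s)\<^sup>2" using s1 by (simp add: power2_eq_square)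
    show "(real s)\<^sup>2 \<le> T" using \<epsilon> by (simp add: T_def pos_le_divide_eq mult_left_le)
    have "1 \<le> (real s)\<^sup>2" using s2 s1 by linarith
    then show "1 / \<epsilon> \<le> T" using \<epsilon> by (simp add: T_def divide_right_mono)
  qed
  have T1: "1 \<le> T" using sT s1 by linarith
  then have u: "0 \<le> u" "exp u = T" by (auto simp: u_def T_def[symmetric])
  have uL: "u \<le> real L" using L(2) u by linarith
  have R: "R \<ge> 1" "R \<le> real r" "real r \<le> 4 * R"
  proof -
    have "\<eta> ^ 4 \<le> 1" using \<eta> by (intro power_le_one) auto
    moreover have "1 \<le> real k ^ 6" using k1 by (intro one_le_power)
    ultimately have "\<eta> ^ 4 \<le> 1000000 * real k ^ 6" by linarith
    then show R1: "R \<ge> 1" using \<eta> by (simp add: R_def pos_le_divide_eq)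
    have *: "real r = 2 * real_of_int \<lceil>R\<rceil>" using R1 by (simp add: r_def)
    have "R \<le> real_of_int \<lceil>R\<rceil>" "real_of_int \<lceil>R\<rceil> \<le> R + 1" by linarith+
    then show "R \<le> real r" "real r \<le> 4 * R" using * R1 by linarith+
  qed
  have r_pos: "r > 0" using R by (intro Nat.gr0I) auto
  have kpow: "real k ^ a \<le> real k ^ 6" if "a \<le> 6" for a using k1 that by (intro power_increasing) auto
  have \<eta>pow: "\<eta> ^ 4 \<le> 1" "\<eta>\<^sup>2 \<le> 1"
    using \<eta> by (auto intro!: power_le_one)
  have even_r: "even r" by (simp add: r_def)
  have r_large: "100 * (real k + 1)\<^sup>2 \<le> real r"
  proof -
    have "(real k + 1)\<^sup>2 \<le> (2 * real k)\<^sup>2" using k1 by (intro power_mono) auto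
    then have "100 * (real k + 1)\<^sup>2 \<le> 400 * real k ^ 2" by (simp add: power_mult_distrib)
    also have "\<dots> \<le> 1000000 * real k ^ 6" using kpow[of 2] zero_le_power[of "real k" 6] by linarith
    also have "\<dots> \<le> R"
      using \<eta> \<eta>pow by (simp add: R_def pos_le_divide_eq mult_left_le)
    finally show ?thesis using R by linarith
  qed
  have \<theta>_pos: "0 < \<theta>" using \<eta> k1 by (simp add: \<theta>_def)
  have \<theta>_small: "100 * (real k)\<^sup>2 * \<theta> \<le> \<eta>\<^sup>2" using k1 by (simp add: \<theta>_def)
  have \<theta>_r: "50 * (real k)\<^sup>2 \<le> \<theta>\<^sup>2 * real r"
  proof -
    have "50 * (real k)\<^sup>2 \<le> \<theta>\<^sup>2 * R"
      using \<eta>(1) k1 by (simp add: \<theta>_def R_def power_divide power_mult_distrib field_simps flip: power_mult power_add)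
    also have "\<dots> \<le> \<theta>\<^sup>2 * real r" using R by (intro mult_left_mono) auto
    finally show ?thesis .
  qed
  have \<eta>_r: "100 * real k ^ 3 \<le> \<eta>\<^sup>2 * real r"
  proof -
    have "\<eta>\<^sup>2 * (100 * real k ^ 3) \<le> 1 * (1000000 * real k ^ 6)"
      using kpow[of 3] \<eta>pow by (intro mult_mono) auto
    then have "\<eta>\<^sup>2 * (100 * real k ^ 3) * \<eta>\<^sup>2 \<le> 1000000 * real k ^ 6 * \<eta>\<^sup>2" using \<eta> by (intro mult_right_mono) auto
    then have "100 * real k ^ 3 \<le> \<eta>\<^sup>2 * R"
      using \<eta>(1) by (simp add: R_def field_simps flip: power_add)
    also have "\<dots> \<le> \<eta>\<^sup>2 * real r" using R by (intro mult_left_mono) auto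
    finally show ?thesis .
  qed
  have M_large: "real (card (maps k r \<times> (\<lambda>h. restrict h (cube k)) ` circuit_class k s)) * exp (- \<eta>' * real M) \<le> 1 / 20"
  proof -
    have "(B + 20) / \<eta>' \<le> real M" by (simp add: M_def real_nat_ceiling_ge)
    then have "B + 20 \<le> \<eta>' * real M" using \<eta> by (simp add: pos_divide_le_eq mult.commute)
    then have "exp (- \<eta>' * real M) \<le> exp (- 20 - B)" by simp
    moreover have "real (card (maps k r \<times> (\<lambda>h. restrict h (cube k)) ` circuit_class k s)) \<le> exp B"
      unfolding B_def by (rule card_hyps_le[OF r_pos])
    ultimately have "real (card (maps k r \<times> (\<lambda>h. restrict h (cube k)) ` circuit_class k s)) * exp (- \<eta>' * real M) \<le>
        exp B * exp (- 20 - B)"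
      by (intro mult_mono) auto
    also have "\<dots> = exp (- 20)" by (simp flip: exp_add)
    finally show ?thesis using exp_20 by linarith
  qed
  have m_large: "exp (- \<eta> * real m) \<le> 1 / 20"
  proof -
    have "20 / \<eta> \<le> real m" by (simp add: m_def real_nat_ceiling_ge)
    then have "20 \<le> \<eta> * real m" using \<eta> by (simp add: pos_divide_le_eq mult.commute)
    then have "exp (- \<eta> * real m) \<le> exp (- 20)" by simp
    then show ?thesis using exp_20 by linarith
  qed
  have m_le: "real m \<le> 21 / \<eta>"
  proof -
    have "real m \<le> 20 / \<eta> + 1" using \<eta> by (simp add: m_def)
    also have "1 \<le> 1 / \<eta>" using \<eta> by simp
    finally show ?thesis by (simp add: add_divide_distrib[symmetric])
  qed
  then have "real m * (4 * \<eta>') \<le> 21 / \<eta> * (4 * \<eta>')" using \<eta> by (intro mult_right_mono) auto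
  then have m_small: "real m * (4 * \<eta>') \<le> 1 / 20" using \<eta> by (simp add: \<eta>'_def)
  have k_le: "real k \<le> 2 * (real s * real L)"
  proof -
    have "1 * 1 \<le> real s * real L" using s1 L1 by (intro mult_mono) auto
    then show ?thesis by (simp add: k_def mult.commute)
  qed
  have ln_r: "ln (real r) \<le> 5000000 * real L"
  proof -
    have "ln (real k) \<le> ln (real s * (2 * real L))" using k_le k1 by (simp add: mult_ac)
    also have "\<dots> = ln (real s) + ln (2 * real L)" using s1 L1 by (simp add: ln_mult)
    also have "ln (real s) \<le> u"
      unfolding u_def T_def[symmetric] using sT s1 by (intro ln_mono) linarith+
    also have "ln (2 * real L) \<le> 2 * real L" using L1 ln_le_minus_one[of "2 * real L"] by simp
    finally have lnk: "ln (real k) \<le> u + 2 * real L" by simp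
    have "ln (1 / \<eta>) = ln (100 * (1 / \<epsilon>))" by (simp add: \<eta>_def)
    also have "\<dots> = ln 100 + ln (1 / \<epsilon>)" using \<epsilon> by (intro ln_mult_pos) auto
    also have "ln (100 :: real) \<le> 100" using ln_le_minus_one[of "100 :: real"] by simp
    also have "ln (1 / \<epsilon>) \<le> u"
      unfolding u_def T_def[symmetric] using sT(3) \<epsilon> by (intro ln_mono) auto
    finally have ln\<eta>: "ln (1 / \<eta>) \<le> 100 + u" by simp
    have "ln (real r) \<le> ln (4000000 * (real k ^ 6 * (1 / \<eta>) ^ 4))"
      using R r_pos by (simp add: R_def power_divide)
    also have "\<dots> = ln (4000000) + (6 * ln (real k) + 4 * ln (1 / \<eta>))"
    proof -
      have "0 < real k ^ 6" "0 < (1 / \<eta>) ^ 4" using k1 \<eta> by auto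
      then have "ln (4000000 * (real k ^ 6 * (1 / \<eta>) ^ 4)) = ln 4000000 + (ln (real k ^ 6) + ln ((1 / \<eta>) ^ 4))"
        by (simp only: ln_mult_pos mult_pos_pos zero_less_numeral)
      then show ?thesis by (simp only: ln_realpow of_nat_numeral)
    qed
    also have "ln (4000000 :: real) \<le> 4000000" using ln_le_minus_one[of "4000000 :: real"] by simp
    finally have "ln (real r) \<le> 4000000 + (6 * ln (real k) + 4 * ln (1 / \<eta>))" by simp
    also have "\<dots> \<le> 4000000 + (6 * (u + 2 * real L) + 4 * (100 + u))"
      by (intro add_mono mult_left_mono lnk ln\<eta>) auto
    also have "\<dots> \<le> 5000000 * real L" using uL L1 by simp
    finally show ?thesis .
  qed
  define x where "x = (real s)\<^sup>2 * (real L)\<^sup>2"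
  have x: "real s \<le> x" "(real s)\<^sup>2 \<le> x" "real s * real L \<le> x" "(real s)\<^sup>2 * real L \<le> x" "1 \<le> x"
    "real s * (real L)\<^sup>2 \<le> x"
  proof -
    have LL: "1 \<le> (real L)\<^sup>2" "real L \<le> (real L)\<^sup>2" using L1 by (simp_all add: one_le_power self_le_power)
    have "real s * 1 \<le> (real s)\<^sup>2 * (real L)\<^sup>2" by (intro mult_mono) (use LL sT in auto)
    then show "real s \<le> x" by (simp add: x_def)
    then show "1 \<le> x" using s1 by simp
    have "(real s)\<^sup>2 * 1 \<le> (real s)\<^sup>2 * (real L)\<^sup>2" by (intro mult_mono) (use LL in auto)
    then show "(real s)\<^sup>2 \<le> x" by (simp add: x_def)
    show "real s * real L \<le> x" "(real s)\<^sup>2 * real L \<le> x" "real s * (real L)\<^sup>2 \<le> x"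
      unfolding x_def by (intro mult_mono; use LL sT in auto)+
  qed
  have "real k * ln (real r) \<le> 2 * (real s * real L) * (5000000 * real L)"
    using k_le ln_r r_pos by (intro mult_mono) auto
  also have "\<dots> = 10000000 * (real s * (real L)\<^sup>2)" by (simp add: power2_eq_square)
  finally have kr: "real k * ln (real r) \<le> 10000000 * x" using x(6) by linarith
  have "real s * real k \<le> real s * (2 * (real s * real L))" using k_le by (intro mult_left_mono) auto
  then have sk: "real s * real k \<le> 2 * x" using x(4) by (simp add: power2_eq_square mult_ac)
  have "B = real k * ln (real r) + 2 * real s + ((real s)\<^sup>2 + real s * real k + 2 * real s) + (real s + real k + 2)"
    by (simp add: B_def power2_eq_square algebra_simps)
  then have "B + 20 \<le> 20000000 * x"
    using kr sk x k_le by linarith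
  then have "(B + 20) / \<eta>' \<le> 20000000 * x / \<eta>'" using \<eta> by (intro divide_right_mono) auto
  also have "\<dots> = 3360000000000 * (T * (real L)\<^sup>2)" using \<epsilon> by (simp add: x_def T_def \<eta>'_def \<eta>_def)
  finally have BM: "(B + 20) / \<eta>' \<le> 3360000000000 * (T * (real L)\<^sup>2)" .
  have TL: "T \<le> T * (real L)\<^sup>2"
    using L1 T1 mult_left_mono[of 1 "(real L)\<^sup>2" T] by (simp add: one_le_power)
  have "0 \<le> B"
    unfolding B_def using r_pos by (intro add_nonneg_nonneg mult_nonneg_nonneg) auto
  then have "0 \<le> (B + 20) / \<eta>'" using \<eta> by simp
  then have "real M \<le> (B + 20) / \<eta>' + 1" unfolding M_def by linarith
  then have M_le: "real M \<le> 3370000000000 * (T * (real L)\<^sup>2)" using BM TL T1 by linarith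
  have "21 / \<eta> = 2100 * (1 / \<epsilon>)" by (simp add: \<eta>_def)
  then have "real m \<le> 2100 * (T * (real L)\<^sup>2)" using m_le sT(3) TL by linarith
  then have Q: "real M + 2 * real m \<le> 10000000000000 * (T * (real L)\<^sup>2)" using M_le TL T1 by linarith
  \<comment> \<open>\<open>L\<close> must outweigh a number of queries that itself contains
    \<open>L^2\<close>. Since \<open>s \<le> T\<close>, the product is at most a constant times
    \<open>L^2 T^2 / 2^L\<close>. Here \<open>2^L\<close> is at least \<open>exp (2 L / 3)\<close>,
    one factor \<open>exp (L / 3)\<close> absorbs \<open>T^2\<close> because
    \<open>6 u \<le> L\<close>, and the other absorbs \<open>L^2\<close> by
    \<open>big\<close>.\<close>
  have few: "(real M + 2 * real m) * (real s / 2 ^ L) \<le> 1 / 20"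
  proof -
    have "2 / 3 * real L \<le> ln 2 * real L"
      using ln2_ge_two_thirds by (rule mult_right_mono) simp
    then have "exp (2 / 3 * real L) \<le> exp (ln 2 * real L)" by (simp only: exp_le_cancel_iff)
    also have "exp (ln 2 * real L) = 2 ^ L" by (simp add: exp_of_nat2_mult)
    finally have pow: "exp (2 / 3 * real L) \<le> 2 ^ L" .
    have "T\<^sup>2 = exp (2 * u)" unfolding u(2)[symmetric] by (simp add: power2_eq_square flip: exp_add)
    also have "\<dots> \<le> exp (real L / 3)" using L(2) by simp
    finally have T2: "T\<^sup>2 \<le> exp (real L / 3)" .
    have "(real M + 2 * real m) * (real s / 2 ^ L) \<le> 10000000000000 * (T * (real L)\<^sup>2) * (T / exp (2 / 3 * real L))"
      using Q pow order.trans[OF sT(1,2)] T1 by (intro mult_mono frac_le) auto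
    also have "\<dots> = 10000000000000 * (real L)\<^sup>2 * T\<^sup>2 / exp (2 / 3 * real L)"
      by (simp add: power2_eq_square)
    also have "\<dots> \<le> exp (real L / 3) / 20 * exp (real L / 3) / exp (2 / 3 * real L)"
      using big T2 by (intro divide_right_mono mult_mono) auto
    also have "\<dots> = 1 / 20" by (simp flip: exp_add)
    finally show ?thesis .
  qed
  have "\<exists>A. two_sided_tester n \<epsilon> (circuit_class n s) A \<and> makes_at_most A (M + 2 * m)" if n: "n \<ge> 1" for n
  proof -
    interpret circuit_tester n s L k r M m \<epsilon> \<eta> \<eta>' \<theta>
      by unfold_locales (use n s L \<eta> even_r r_large \<theta>_pos \<theta>_small \<theta>_r \<eta>_r M_large m_large m_small few in
        \<open>simp_all add: k_def \<eta>_def\<close>)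
    show ?thesis using tester by blast
  qed
  moreover have "real (M + 2 * m) \<le> 10000000000000 * ((real s)\<^sup>2 / \<epsilon>) * (real L)\<^sup>2"
    using Q by (simp add: T_def)
  ultimately show ?thesis by blast
qed

theorem theorem19:
  "\<exists>q :: nat \<Rightarrow> real \<Rightarrow> nat.
     soft_O_on {(s, \<epsilon>). s \<ge> 1 \<and> \<epsilon> > 0} (\<lambda>(s, \<epsilon>). real (q s \<epsilon>)) (\<lambda>(s, \<epsilon>). (real s)\<^sup>2 / \<epsilon>) \<and>
     (\<forall>\<epsilon> > 0. \<forall>s \<ge> 1. \<forall>n. \<exists>A.
        two_sided_tester n \<epsilon> (circuit_class n s) A \<and> makes_at_most A (q s \<epsilon>))"
proof -
  have "eventually (\<lambda>l::nat. 20 * (10000000000000 * (real l)\<^sup>2) \<le> exp (real l / 3)) at_top"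
    by real_asymp
  then obtain c where c: "\<And>l. l \<ge> c \<Longrightarrow> 20 * (10000000000000 * (real l)\<^sup>2) \<le> exp (real l / 3)"
    by (auto simp: eventually_at_top_linorder)
  \<comment> \<open>The square keeps the bound nonnegative for all arguments, also when
    \<open>\<epsilon> > 1\<close> makes the logarithm negative.\<close>
  define p where "p = smult (10000000000000) ([:real c + 2, 6:] ^ 2)"
  have p: "poly p u = 10000000000000 * (real c + 2 + 6 * u)\<^sup>2" for u
    by (simp add: p_def algebra_simps)
  have "\<exists>q::nat. real q \<le> (real s)\<^sup>2 / \<epsilon> * poly p (ln ((real s)\<^sup>2 / \<epsilon>)) \<and>
      (\<forall>n. \<exists>A. two_sided_tester n \<epsilon> (circuit_class n s) A \<and> makes_at_most A q)"
    if s: "s \<ge> 1" and \<epsilon>: "\<epsilon> > 0" for s :: nat and \<epsilon> :: real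
  proof (cases "\<epsilon> > 1")
    case True
    then show ?thesis
      using \<epsilon> trivial_tester[of _ \<epsilon>] by (intro exI[of _ 0]) (auto simp: p)
  next
    case False
    define u where "u = ln ((real s)\<^sup>2 / \<epsilon>)"
    have "1 \<le> (real s)\<^sup>2" using s by simp
    then have "1 \<le> (real s)\<^sup>2 / \<epsilon>" using \<epsilon> False by (simp add: pos_le_divide_eq)
    then have u: "0 \<le> u" by (simp add: u_def)
    \<comment> \<open>\<open>c\<close> provides the asymptotic inequality, 1 ensures positivity, and
      rounding up costs at most one more, whence \<open>c + 2\<close> in \<open>p\<close>.\<close>
    define l where "l = c + 1 + nat \<lceil>6 * u\<rceil>"
    have l: "l \<ge> 1" "l \<ge> c" "6 * u \<le> real l" "real l \<le> real c + 2 + 6 * u"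
      using u by (auto simp: l_def) linarith+
    obtain q :: nat where q: "real q \<le> 10000000000000 * ((real s)\<^sup>2 / \<epsilon>) * (real l)\<^sup>2"
      and A: "\<And>n. n \<ge> 1 \<Longrightarrow> \<exists>A. two_sided_tester n \<epsilon> (circuit_class n s) A \<and> makes_at_most A q"
      using tester_with_parameters[OF s \<epsilon> _ l(1) _ c[OF l(2)]] l(3) False by (auto simp: u_def)
    have "10000000000000 * ((real s)\<^sup>2 / \<epsilon>) * (real l)\<^sup>2 \<le> 10000000000000 * ((real s)\<^sup>2 / \<epsilon>) * (real c + 2 + 6 * u)\<^sup>2"
      using l(4) \<epsilon> by (intro mult_left_mono power_mono) auto
    then have "real q \<le> (real s)\<^sup>2 / \<epsilon> * poly p (ln ((real s)\<^sup>2 / \<epsilon>))"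
      using q by (simp add: p u_def mult_ac)
    moreover have "\<exists>A. two_sided_tester n \<epsilon> (circuit_class n s) A \<and> makes_at_most A q" for n
      using A[of n] trivial_tester[of n \<epsilon>] \<epsilon> by (cases "n \<ge> 1") (auto simp: not_le)
    ultimately show ?thesis by blast
  qed
  then obtain q :: "nat \<Rightarrow> real \<Rightarrow> nat" where q: "\<And>s \<epsilon>. s \<ge> 1 \<Longrightarrow> \<epsilon> > 0 \<Longrightarrow>
      real (q s \<epsilon>) \<le> (real s)\<^sup>2 / \<epsilon> * poly p (ln ((real s)\<^sup>2 / \<epsilon>)) \<and>
      (\<forall>n. \<exists>A. two_sided_tester n \<epsilon> (circuit_class n s) A \<and> makes_at_most A (q s \<epsilon>))"
    by metis
  then show ?thesis
    by (intro exI[of _ q]) (auto simp: soft_O_on_def intro!: exI[of _ p])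
qed

end
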